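(* Let $f_1,\dots,f_h$ ($h\ge 2$) be simultaneously formally linearizable germs of biholomorphisms of $\mathbb{C}^n$ fixing the origin whose linear parts are simultaneously diagonalizable. If $f_1,\dots,f_h$ satisfy the simultaneous Brjuno condition, then $f_1,\dots,f_h$ are holomorphically simultaneously linearizable, i.e. there is a germ of biholomorphism $\varphi$ of $(\mathbb{C}^n,0)$ with $\varphi(0)=0$ such that $\varphi^{-1}\circ f_k\circ\varphi$ is linear for every $k=1,\dots,h$.
   Context: Simultaneously formally linearizable: there is an invertible formal power series map $\varphi$, $\varphi(0)=0$, with $\varphi^{-1}\circ f_k\circ\varphi$ linear for all $k$. If the linear parts are simultaneously diagonalizable, let $\Lambda_k=(\lambda_{k,1},\dots,\lambda_{k,n})$ be the eigenvalues of the linear part of $f_k$ listed along a common eigenbasis. For $Q\in\mathbb{N}^n$ write $|Q|=\sum q_i$, $\Lambda_k^Q=\prod_i\lambda_{k,i}^{q_i}$, and $\mathrm{Res}_j(\Lambda_k)=\{Q:|Q|\ge2,\ \Lambda_k^Q=\lambda_{k,j}\}$. Set $\varepsilon_Q=\min_{1\le j\le n}\max_{1\le k\le h}|\Lambda_k^Q-\lambda_{k,j}|$ and, for $m\ge2$, $\omega(m)=\min\{\varepsilon_Q: 2\le|Q|\le m,\ Q\notin\bigcap_{k=1}^h\bigcap_{j=1}^n\mathrm{Res}_j(\Lambda_k)\}$ (with the convention $\log(1/0)=+\infty$). The germs satisfy the simultaneous Brjuno condition if there is a strictly increasing sequence of integers $(p_\nu)_{\nu\ge0}$ with $p_0=1$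 such that $\sum_{\nu\ge0}\frac1{p_\nu}\log\frac1{\omega(p_{\nu+1})}<+\infty$. *)

theory Defs
  imports "HOL-Analysis.Analysis"
begin

definition mdeg :: "('n::finite \<Rightarrow> nat) \<Rightarrow> nat" where
  "mdeg Q = (\<Sum>i\<in>UNIV. Q i)"

definition mzero :: "'n::finite \<Rightarrow> nat" where
  "mzero = (\<lambda>i. 0)"

definition munit :: "'n::finite \<Rightarrow> ('n \<Rightarrow> nat)" where
  "munit j = (\<lambda>i. if i = j then 1 else 0)"

definition monom :: "complex^'n \<Rightarrow> ('n::finite \<Rightarrow> nat) \<Rightarrow> complex" where
  "monom z Q = (\<Prod>i\<in>UNIV. (z$i) ^ (Q i))"

section \<open>Formal power series maps C^n -> C^n (coefficient functions)\<close>

type_synonym 'n fmap = "('n \<Rightarrow> nat) \<Rightarrow> complex^'n"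

definition slots :: "('n::finite \<Rightarrow> nat) \<Rightarrow> ('n \<times> nat) set" where
  "slots P = {(i, j). j < P i}"

text \<open>Formal composition F o G (for G with zero constant term):
  F o G = sum_P F_P * prod_i G_i^(P i), the coefficient of Q of the product being computed
  by the multinomial (Cauchy) formula over all slots.\<close>
definition fcomp :: "'n::finite fmap \<Rightarrow> 'n fmap \<Rightarrow> 'n fmap" where
  "fcomp F G = (\<lambda>Q. \<Sum>P\<in>{P. mdeg P \<le> mdeg Q}.
      (\<Sum>s\<in>{s \<in> PiE (slots P) (\<lambda>_. {R. \<forall>i. R i \<le> Q i}). (\<lambda>i. \<Sum>t\<in>slots P. s t i) = Q}.
          \<Prod>t\<in>slots P. G (s t) $ fst t) *s F P)"

definition fid :: "'n::finite fmap" where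
  "fid = (\<lambda>Q. \<chi> i. if Q = munit i then 1 else 0)"

definition flinear :: "'n::finite fmap \<Rightarrow> bool" where
  "flinear G \<longleftrightarrow> (\<forall>Q. mdeg Q \<noteq> 1 \<longrightarrow> G Q = 0)"

definition formally_linearizable :: "nat \<Rightarrow> (nat \<Rightarrow> 'n::finite fmap) \<Rightarrow> bool" where
  "formally_linearizable h c \<longleftrightarrow>
     (\<exists>\<Phi> \<Psi>. \<Phi> mzero = 0 \<and> \<Psi> mzero = 0 \<and> fcomp \<Phi> \<Psi> = fid \<and> fcomp \<Psi> \<Phi> = fid \<and>
        (\<forall>k\<in>{1..h}. flinear (fcomp \<Psi> (fcomp (c k) \<Phi>))))"

definition lin_part :: "'n::finite fmap \<Rightarrow> complex^'n^'n" where
  "lin_part c = (\<chi> i j. c (munit j) $ i)"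

definition diag :: "('n::finite \<Rightarrow> complex) \<Rightarrow> complex^'n^'n" where
  "diag d = (\<chi> i j. if i = j then d i else 0)"

definition has_expansion :: "(complex^'n \<Rightarrow> complex^'n) \<Rightarrow> 'n::finite fmap \<Rightarrow> bool" where
  "has_expansion g c \<longleftrightarrow> (\<forall>\<^sub>F z in nhds 0. ((\<lambda>Q. monom z Q *s c Q) has_sum g z) UNIV)"

definition holo_germ :: "(complex^'n::finite \<Rightarrow> complex^'n) \<Rightarrow> bool" where
  "holo_germ g \<longleftrightarrow> (\<exists>c. has_expansion g c)"

definition germ_inverse :: "(complex^'n::finite \<Rightarrow> complex^'n) \<Rightarrow> (complex^'n \<Rightarrow> complex^'n) \<Rightarrow> bool" where
  "germ_inverse g \<psi> \<longleftrightarrow> \<psi> 0 = 0 \<and> (\<forall>\<^sub>F z in nhds 0. \<psi> (g z) = z) \<and> (\<forall>\<^sub>F w in nhds 0. g (\<psi> w) = w)"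

definition biholo_germ0 :: "(complex^'n::finite \<Rightarrow> complex^'n) \<Rightarrow> bool" where
  "biholo_germ0 g \<longleftrightarrow> holo_germ g \<and> g 0 = 0 \<and> (\<exists>\<psi>. holo_germ \<psi> \<and> germ_inverse g \<psi>)"

definition lampow :: "(nat \<Rightarrow> 'n::finite \<Rightarrow> complex) \<Rightarrow> nat \<Rightarrow> ('n \<Rightarrow> nat) \<Rightarrow> complex" where
  "lampow lam k Q = (\<Prod>i\<in>UNIV. lam k i ^ Q i)"

definition Res :: "(nat \<Rightarrow> 'n::finite \<Rightarrow> complex) \<Rightarrow> nat \<Rightarrow> 'n \<Rightarrow> ('n \<Rightarrow> nat) set" where
  "Res lam k j = {Q. mdeg Q \<ge> 2 \<and> lampow lam k Q = lam k j}"

definition eps :: "nat \<Rightarrow> (nat \<Rightarrow> 'n::finite \<Rightarrow> complex) \<Rightarrow> ('n \<Rightarrow> nat) \<Rightarrow> real" where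
  "eps h lam Q = Min (range (\<lambda>j. Max ((\<lambda>k. cmod (lampow lam k Q - lam k j)) ` {1..h})))"

definition nonres :: "nat \<Rightarrow> (nat \<Rightarrow> 'n::finite \<Rightarrow> complex) \<Rightarrow> nat \<Rightarrow> ('n \<Rightarrow> nat) set" where
  "nonres h lam m = {Q. 2 \<le> mdeg Q \<and> mdeg Q \<le> m \<and> Q \<notin> (\<Inter>k\<in>{1..h}. \<Inter>j. Res lam k j)}"

definition omega :: "nat \<Rightarrow> (nat \<Rightarrow> 'n::finite \<Rightarrow> complex) \<Rightarrow> nat \<Rightarrow> real" where
  "omega h lam m = Min (eps h lam ` nonres h lam m)"

definition brjuno_term :: "nat \<Rightarrow> (nat \<Rightarrow> 'n::finite \<Rightarrow> complex) \<Rightarrow> (nat \<Rightarrow> nat) \<Rightarrow> nat \<Rightarrow> real" where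
  "brjuno_term h lam p \<nu> =
     (if nonres h lam (p (Suc \<nu>)) = {} then 0
      else ln (1 / omega h lam (p (Suc \<nu>))) / real (p \<nu>))"

text \<open>The series has eventually constant sign (omega is nonincreasing), so
  "sum < +infinity" amounts to: no term is +infinity (omega > 0) and the positive parts are summable.\<close>
definition simultaneous_brjuno :: "nat \<Rightarrow> (nat \<Rightarrow> 'n::finite \<Rightarrow> complex) \<Rightarrow> bool" where
  "simultaneous_brjuno h lam \<longleftrightarrow>
     (\<exists>p::nat \<Rightarrow> nat. strict_mono p \<and> p 0 = 1 \<and>
        (\<forall>\<nu>. nonres h lam (p (Suc \<nu>)) \<noteq> {} \<longrightarrow> omega h lam (p (Suc \<nu>)) > 0) \<and>
        summable (\<lambda>\<nu>. max 0 (brjuno_term h lam p \<nu>)))"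

end

theory Submission
  imports Defs "HOL-Complex_Analysis.Conformal_Mappings" "HOL-Library.Landau_Symbols"
begin

text \<open>
  The formal composition is the one that makes Taylor expansions multiplicative: if f and g have
  asymptotic expansions F and G to order N at the origin and G has no constant term, then the
  composite of f and g has the expansion \<^term>\<open>fcomp F G\<close> to order N. Asymptotic expansions are
  unique, so every identity between formal compositions reduces to one between polynomial maps, and
  an identity between convergent series holds for their sums because it holds on every complex line
  through the origin.

  Write the formal conjugacy between the f_k and their diagonal linear parts coefficientwise: the
  Q-th coefficient of the conjugacy, times a divisor, is a polynomial in the lower ones. Since all
  j are used in the resonance condition of \<^const>\<open>nonres\<close>, the Brjuno condition leaves two cases.
  Either some Q is resonant for all k and j; then the linear parts are scalar roots of unity, the
  nonzero divisors are bounded below, and composing with the inverse of the resonant part removes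
  all resonant coefficients. Or no such Q exists. Then, for a threshold below omega(m), two
  comparable multi-indices whose divisors lie below the threshold differ by at least m in degree.
  This gives a superadditive function W on multi-indices which grows by one at every such Q and
  satisfies W(Q) <= 2 |Q| / m; summing over the scales m = p_(nu+1), the total loss is at most
  B |Q| with B a multiple of the Brjuno sum. A Cauchy majorant argument then bounds the
  coefficients geometrically.
\<close>

section \<open>Multi-indices\<close>

text \<open>The Brjuno condition bounds the worst divisor up to each degree, whereas one coefficient
  of the conjugacy collects a product of divisors over all substitutions that build its index;
  bounding every factor by the worst one loses too much. Instead of counting along trees of
  substitutions, the proof looks for a function G of the index such that the loss at Q plus the
  values of G on the parts of Q is at most G(Q). The weight exp(-G(Q)) then turns the recursion into
  one without divisors, and only linear growth of G matters. The gaps come from a classical remark: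
  small divisors at Q <= R for the same j make the divisor at R - Q + e_j small as well, so R - Q
  cannot have low degree. An index at which some j is resonant for all k, but not every j, has eps =
  0 and is ruled out by omega > 0. Hence outside the scalar case no divisor vanishes and the linear
  part determines the conjugacy. In the scalar case the resonant coefficients are free, so a given
  formal conjugacy may diverge and has to be normalized.\<close>

lemma mdeg_mzero [simp]: "mdeg mzero = 0"
  by (simp add: mdeg_def mzero_def)

lemma mdeg_eq_0_iff: "mdeg Q = 0 \<longleftrightarrow> Q = mzero"
  by (auto simp: mdeg_def mzero_def)

lemma mdeg_munit [simp]: "mdeg (munit j) = 1"
  by (simp add: mdeg_def munit_def)

lemma munit_inject [simp]: "munit i = munit j \<longleftrightarrow> i = j"
  by (auto simp: munit_def fun_eq_iff split: if_splits)

lemma munit_neq_mzero [simp]: "munit j \<noteq> mzero" "mzero \<noteq> munit j"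
  by (metis mdeg_munit mdeg_mzero zero_neq_one)+

lemma le_mdeg: "Q i \<le> mdeg Q"
  unfolding mdeg_def by (rule member_le_sum) auto

lemma mdeg_mono: "Q \<le> R \<Longrightarrow> mdeg Q \<le> mdeg R"
  unfolding mdeg_def by (rule sum_mono) (simp add: le_fun_def)

lemma mdeg_strict_mono:
  fixes Q R :: "'n::finite \<Rightarrow> nat"
  assumes "Q \<le> R" "Q \<noteq> R" shows "mdeg Q < mdeg R"
proof -
  obtain i where "Q i \<noteq> R i" using assms(2) by auto
  then show ?thesis unfolding mdeg_def
    using assms(1) by (intro sum_strict_mono_ex1) (auto simp: le_fun_def order_less_le)
qed

lemma mdeg_eq_1E:
  assumes "mdeg Q = 1" obtains j where "Q = munit j"
proof -
  obtain j where j: "Q j \<noteq> 0" using assms unfolding mdeg_def by (metis sum.neutral zero_neq_one)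
  have "munit j \<le> Q" using j by (auto simp: munit_def le_fun_def)
  then have "Q = munit j" using mdeg_strict_mono[of "munit j" Q] assms by auto
  then show ?thesis by (rule that)
qed

lemma finite_mdeg_le [simp, intro]: "finite {Q :: 'n::finite \<Rightarrow> nat. mdeg Q \<le> N}"
proof (rule finite_subset)
  show "{Q :: 'n \<Rightarrow> nat. mdeg Q \<le> N} \<subseteq> PiE UNIV (\<lambda>_. {..N})"
    by (auto intro: order_trans[OF le_mdeg])
qed (simp add: finite_PiE)

lemma finite_multi_le [simp, intro]: "finite {R :: 'n::finite \<Rightarrow> nat. \<forall>i. R i \<le> Q i}"
  by (rule finite_subset[OF _ finite_mdeg_le[of "mdeg Q"]]) (auto intro!: mdeg_mono simp: le_fun_def)

lemma mdeg_sum: "mdeg (\<lambda>i. \<Sum>t\<in>T. s t i) = (\<Sum>t\<in>T. mdeg (s t))"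
  unfolding mdeg_def by (rule sum.swap)

lemma monom_sum: "monom z (\<lambda>i. \<Sum>t\<in>T. s t i) = (\<Prod>t\<in>T. monom z (s t))"
  unfolding monom_def by (simp add: power_sum prod.swap[of _ T])

lemma norm_monom_le:
  assumes "\<And>i. cmod (z $ i) \<le> r"
  shows "cmod (monom z Q) \<le> r ^ mdeg Q"
proof -
  have "cmod (monom z Q) = (\<Prod>i\<in>UNIV. cmod (z$i) ^ Q i)"
    by (simp add: monom_def prod_norm[symmetric] norm_power)
  also have "\<dots> \<le> (\<Prod>i\<in>UNIV. r ^ Q i)"
    by (rule prod_mono) (auto intro!: power_mono assms)
  also have "\<dots> = r ^ mdeg Q" by (simp add: mdeg_def power_sum)
  finally show ?thesis .
qed

lemma norm_monom_le_norm: "cmod (monom z Q) \<le> norm z ^ mdeg Q"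
  by (rule norm_monom_le) (rule Finite_Cartesian_Product.norm_nth_le)

lemma monom_mzero [simp]: "monom z mzero = 1"
  by (simp add: monom_def mzero_def)

lemma monom_munit [simp]: "monom z (munit j) = z $ j"
proof -
  have "monom z (munit j) = (\<Prod>i\<in>UNIV. if i = j then z $ i else 1)"
    unfolding monom_def munit_def by (rule prod.cong) auto
  then show ?thesis by simp
qed

lemma monom_scale: "monom (\<chi> i. d i * z $ i) Q = (\<Prod>i\<in>UNIV. d i ^ Q i) * monom z Q"
  by (simp add: monom_def power_mult_distrib prod.distrib)

section \<open>Splitting a multi-index over the slots of a monomial\<close>

lemma slots_Sigma: "slots P = Sigma UNIV (\<lambda>i. {..<P i})"
  by (auto simp: slots_def)

lemma finite_slots [simp, intro]: "finite (slots P)"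
  by (simp add: slots_Sigma)

lemma card_slots [simp]: "card (slots P) = mdeg P"
  by (simp add: slots_Sigma mdeg_def)

lemma monom_slots: "monom w P = (\<Prod>t\<in>slots P. w $ fst t)"
proof -
  have "(\<Prod>t\<in>slots P. w $ fst t) = (\<Prod>(i,j)\<in>Sigma UNIV (\<lambda>i. {..<P i}). w $ i)"
    unfolding slots_Sigma by (simp add: case_prod_unfold)
  also have "\<dots> = (\<Prod>i\<in>UNIV. \<Prod>j<P i. w $ i)" by (subst prod.Sigma[symmetric]) auto
  finally show ?thesis by (simp add: monom_def)
qed

text \<open>The inner index set of \<open>fcomp\<close>, with the slots of a monomial replaced by
  any set of factors, so that products of series can be treated by induction and sorted by total
  index.\<close>

definition splits :: "'t set \<Rightarrow> ('n::finite \<Rightarrow> nat) \<Rightarrow> ('t \<Rightarrow> 'n \<Rightarrow> nat) set" where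
  "splits T Q = {s \<in> PiE T (\<lambda>_. {R. \<forall>i. R i \<le> Q i}). (\<lambda>i. \<Sum>t\<in>T. s t i) = Q}"

lemma finite_splits [simp, intro]: "finite T \<Longrightarrow> finite (splits T Q)"
  by (simp add: splits_def finite_PiE)

lemma splits_mdeg: "s \<in> splits T Q \<Longrightarrow> (\<Sum>t\<in>T. mdeg (s t)) = mdeg Q"
  by (auto simp: splits_def mdeg_sum[symmetric])

lemma splits_le: "s \<in> splits T Q \<Longrightarrow> t \<in> T \<Longrightarrow> s t \<le> Q"
  by (auto simp: splits_def le_fun_def PiE_def Pi_def)

text \<open>A box bounded by degree instead of by \<open>Q\<close> is the same for every
  \<open>Q\<close> of degree at most \<open>N\<close>; a single product set can then be sorted by
  the index it sums to.\<close>

lemma splits_alt: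
  assumes "finite T" "mdeg Q \<le> N"
  shows "splits T Q = {s \<in> PiE T (\<lambda>_. {R. mdeg R \<le> N}). (\<lambda>i. \<Sum>t\<in>T. s t i) = Q}"
proof (intro subset_antisym subsetI)
  fix s assume s: "s \<in> splits T Q"
  then show "s \<in> {s \<in> PiE T (\<lambda>_. {R. mdeg R \<le> N}). (\<lambda>i. \<Sum>t\<in>T. s t i) = Q}"
    using order_trans[OF mdeg_mono[OF splits_le[OF s]] assms(2)] by (auto simp: splits_def PiE_def)
next
  fix s assume s: "s \<in> {s \<in> PiE T (\<lambda>_. {R. mdeg R \<le> N}). (\<lambda>i. \<Sum>t\<in>T. s t i) = Q}"
  then have Q: "Q = (\<lambda>i. \<Sum>t\<in>T. s t i)" by simp
  have "s t i \<le> Q i" if "t \<in> T" for t i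
    unfolding Q using that assms(1) by (intro member_le_sum) auto
  then show "s \<in> splits T Q" using s by (auto simp: splits_def PiE_def)
qed

lemma fcomp_splits:
  "fcomp F G Q = (\<Sum>P | mdeg P \<le> mdeg Q. (\<Sum>s\<in>splits (slots P) Q. \<Prod>t\<in>slots P. G (s t) $ fst t) *s F P)"
  by (simp add: fcomp_def splits_def)

lemma splits_prod_eq_0:
  fixes G :: "'n::finite fmap"
  assumes "G mzero = 0" "s t = mzero" "t \<in> slots P"
  shows "(\<Prod>t\<in>slots P. G (s t) $ fst t) = 0"
  by (rule prod_zero) (use assms in \<open>auto intro!: bexI[of _ t]\<close>)

lemma splits_nonzero_mdeg_ge:
  assumes "s \<in> splits T Q" "finite T" "\<And>t. t \<in> T \<Longrightarrow> s t \<noteq> mzero"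
  shows "card T \<le> mdeg Q"
proof -
  have "card T = (\<Sum>t\<in>T. 1)" by simp
  also have "\<dots> \<le> (\<Sum>t\<in>T. mdeg (s t))"
    using assms(3) by (intro sum_mono) (metis One_nat_def Suc_leI mdeg_eq_0_iff neq0_conv)
  finally show ?thesis using splits_mdeg[OF assms(1)] by simp
qed

lemma splits_sum_eq_0:
  fixes G :: "'n::finite fmap"
  assumes "G mzero = 0" "mdeg Q < mdeg P"
  shows "(\<Sum>s\<in>splits (slots P) Q. \<Prod>t\<in>slots P. G (s t) $ fst t) = 0"
proof (rule sum.neutral, safe)
  fix s assume s: "s \<in> splits (slots P) Q"
  then have "\<not> (\<forall>t\<in>slots P. s t \<noteq> mzero)"
    using splits_nonzero_mdeg_ge[OF s] assms(2) by (metis card_slots finite_slots not_less)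
  then show "(\<Prod>t\<in>slots P. G (s t) $ fst t) = 0" using splits_prod_eq_0[where G = G, OF assms(1)] by blast
qed

text \<open>Without a constant term in \<open>G\<close>, a product over \<open>mdeg P\<close> slots
  starts in degree \<open>mdeg P\<close>. The cut-off in \<open>fcomp\<close> therefore loses
  nothing, and one truncation of \<open>F\<close> serves all indices up to degree
  \<open>N\<close>.\<close>

lemma fcomp_mdeg_le:
  assumes "G mzero = 0" "mdeg Q \<le> N"
  shows "fcomp F G Q = (\<Sum>P | mdeg P \<le> N. (\<Sum>s\<in>splits (slots P) Q. \<Prod>t\<in>slots P. G (s t) $ fst t) *s F P)"
  unfolding fcomp_splits
  by (rule sum.mono_neutral_left) (use assms splits_sum_eq_0[where G = G, OF assms(1)] in auto)

lemma fcomp_mzero: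
  fixes F G :: "'a::finite fmap" shows "fcomp F G mzero = F mzero"
proof -
  have 1: "{P. mdeg P \<le> mdeg mzero} = {mzero :: 'a \<Rightarrow> nat}" by (auto simp: mdeg_eq_0_iff)
  have 2: "slots (mzero :: 'a \<Rightarrow> nat) = {}" by (auto simp: slots_def mzero_def)
  have 3: "splits {} (mzero :: 'a \<Rightarrow> nat) = {\<lambda>_. undefined}" by (auto simp: splits_def mzero_def)
  show ?thesis by (simp add: fcomp_splits 1 2 3 del: mdeg_mzero)
qed

section \<open>Asymptotic expansions\<close>

text \<open>With \<open>nhds 0\<close> rather than \<open>at 0\<close> the estimate includes the
  origin, which an inner map may reach at nonzero arguments. The norm is cast to complex because
  both sides of a Landau symbol share their type.\<close>

definition bigO :: "nat \<Rightarrow> (complex^'n::finite \<Rightarrow> complex) set" where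
  "bigO N = O[nhds 0](\<lambda>z. complex_of_real (norm z) ^ N)"

lemma bigOI:
  assumes "\<forall>\<^sub>F z in nhds 0. cmod (f z) \<le> C * norm z ^ N"
  shows "f \<in> bigO N"
  unfolding bigO_def by (rule bigoI[of _ C]) (use assms in \<open>simp add: norm_power\<close>)

lemma bigOE:
  assumes "f \<in> bigO N"
  obtains C where "C > 0" "\<forall>\<^sub>F z in nhds 0. cmod (f z) \<le> C * norm z ^ N"
  using assms unfolding bigO_def by (elim landau_o.bigE) (auto simp: norm_power)

lemma bigO_mono:
  fixes f :: "complex^'n::finite \<Rightarrow> complex"
  assumes "f \<in> bigO M" "N \<le> M" shows "f \<in> bigO N"
proof -
  have "(\<lambda>z::complex^'n. complex_of_real (norm z) ^ M) \<in> bigO N"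
  proof (rule bigOI[of _ 1])
    have "\<forall>\<^sub>F z in nhds (0::complex^'n). norm z < 1"
      unfolding eventually_nhds_metric by (auto intro!: exI[of _ 1])
    then show "\<forall>\<^sub>F z in nhds (0::complex^'n). norm (complex_of_real (norm z) ^ M) \<le> 1 * norm z ^ N"
      by eventually_elim (use assms(2) in \<open>auto simp: norm_power intro: power_decreasing\<close>)
  qed
  with assms(1) show ?thesis unfolding bigO_def by (rule landau_o.big.trans)
qed

lemma bigO_mult:
  assumes "f \<in> bigO M" "g \<in> bigO N" shows "(\<lambda>z. f z * g z) \<in> bigO (M + N)"
  using landau_o.big.mult[OF assms[unfolded bigO_def]] by (simp add: power_add bigO_def)

lemma bigO_mult0: "f \<in> bigO N \<Longrightarrow> g \<in> bigO 0 \<Longrightarrow> (\<lambda>z. f z * g z) \<in> bigO N"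
  using bigO_mult[of f N g 0] by simp

lemma bigO_cmult: "f \<in> bigO N \<Longrightarrow> (\<lambda>z. c * f z) \<in> bigO N"
  by (simp add: bigO_def)

lemma bigO_zero [simp]: "(\<lambda>z. 0) \<in> bigO N"
  by (simp add: bigO_def)

lemma bigO_add: "f \<in> bigO N \<Longrightarrow> g \<in> bigO N \<Longrightarrow> (\<lambda>z. f z + g z) \<in> bigO N"
  unfolding bigO_def by (rule sum_in_bigo)

lemma bigO_diff: "f \<in> bigO N \<Longrightarrow> g \<in> bigO N \<Longrightarrow> (\<lambda>z. f z - g z) \<in> bigO N"
  unfolding bigO_def by (rule sum_in_bigo)

lemma bigO_sum: "(\<And>x. x \<in> A \<Longrightarrow> f x \<in> bigO N) \<Longrightarrow> (\<lambda>z. \<Sum>x\<in>A. f x z) \<in> bigO N"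
  unfolding bigO_def by (rule big_sum_in_bigo)

lemma bigO_monom: "(\<lambda>z. monom z Q) \<in> bigO (mdeg Q)"
  by (rule bigOI[of _ 1]) (simp add: norm_monom_le_norm)

definition tpoly :: "nat \<Rightarrow> (('n::finite \<Rightarrow> nat) \<Rightarrow> complex) \<Rightarrow> complex^'n \<Rightarrow> complex" where
  "tpoly N a z = (\<Sum>Q | mdeg Q \<le> N. a Q * monom z Q)"

definition sasy :: "nat \<Rightarrow> (complex^'n::finite \<Rightarrow> complex) \<Rightarrow> (('n \<Rightarrow> nat) \<Rightarrow> complex) \<Rightarrow> bool" where
  "sasy N f a \<longleftrightarrow> (\<lambda>z. f z - tpoly N a z) \<in> bigO (Suc N)"

lemma sasy_tpoly: "sasy N (tpoly N a) a"
  by (simp add: sasy_def)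

lemma tpoly_bigO: "tpoly N a \<in> bigO 0"
  unfolding tpoly_def by (intro bigO_sum bigO_cmult bigO_mono[OF bigO_monom]) simp

lemma sasy_bigO:
  assumes "sasy N f a" shows "f \<in> bigO 0"
proof -
  have "(\<lambda>z. (f z - tpoly N a z) + tpoly N a z) \<in> bigO 0"
    by (intro bigO_add tpoly_bigO bigO_mono[OF assms[unfolded sasy_def]]) simp
  then show ?thesis by simp
qed

text \<open>Factors are exchanged one at a time by \<open>f g - p q = (f - p) g + (g - q) p\<close>.
  Boundedness of the product is carried along because the first error is multiplied by it.\<close>

lemma sasy_prod_diff:
  assumes "finite T" "\<And>t. t \<in> T \<Longrightarrow> sasy N (f t) (a t)"
  shows "(\<lambda>z. (\<Prod>t\<in>T. f t z) - (\<Prod>t\<in>T. tpoly N (a t) z)) \<in> bigO (Suc N) \<and> (\<lambda>z. \<Prod>t\<in>T. f t z) \<in> bigO 0"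
  using assms
proof (induction T)
  case empty then show ?case by (simp add: bigO_def)
next
  case (insert u T)
  have u: "(\<lambda>z. f u z - tpoly N (a u) z) \<in> bigO (Suc N)" using insert.prems by (auto simp: sasy_def)
  have fu: "f u \<in> bigO 0" using insert.prems by (intro sasy_bigO) auto
  have IH: "(\<lambda>z. (\<Prod>t\<in>T. f t z) - (\<Prod>t\<in>T. tpoly N (a t) z)) \<in> bigO (Suc N)" "(\<lambda>z. \<Prod>t\<in>T. f t z) \<in> bigO 0"
    using insert by auto
  have "(\<lambda>z. (f u z - tpoly N (a u) z) * (\<Prod>t\<in>T. f t z)
      + ((\<Prod>t\<in>T. f t z) - (\<Prod>t\<in>T. tpoly N (a t) z)) * tpoly N (a u) z) \<in> bigO (Suc N)"
    by (intro bigO_add bigO_mult0 u IH tpoly_bigO)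
  moreover have "(\<lambda>z. f u z * (\<Prod>t\<in>T. f t z)) \<in> bigO 0"
    by (rule bigO_mult0[OF fu IH(2)])
  ultimately show ?case using insert.hyps by (simp add: algebra_simps)
qed

lemma sasy_prod:
  fixes f :: "'t \<Rightarrow> complex^'n::finite \<Rightarrow> complex"
  assumes T: "finite T" and f: "\<And>t. t \<in> T \<Longrightarrow> sasy N (f t) (a t)"
  shows "sasy N (\<lambda>z. \<Prod>t\<in>T. f t z) (\<lambda>Q. \<Sum>s\<in>splits T Q. \<Prod>t\<in>T. a t (s t))"
proof -
  define S where "S = PiE T (\<lambda>_. {R :: 'n \<Rightarrow> nat. mdeg R \<le> N})"
  define \<sigma> where "\<sigma> = (\<lambda>s::'t \<Rightarrow> 'n \<Rightarrow> nat. \<lambda>i. \<Sum>t\<in>T. s t i)"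
  have S: "finite S" unfolding S_def by (intro finite_PiE T) auto
  have eq: "(\<Prod>t\<in>T. tpoly N (a t) z) = (\<Sum>s\<in>S. (\<Prod>t\<in>T. a t (s t)) * monom z (\<sigma> s))" for z
    unfolding tpoly_def S_def \<sigma>_def by (subst prod_sum_PiE) (auto simp: T monom_sum prod.distrib)
  have sp: "splits T Q = {s \<in> S. \<sigma> s = Q}" if "mdeg Q \<le> N" for Q
    unfolding S_def \<sigma>_def by (rule splits_alt[OF T that])
  have eq2: "tpoly N (\<lambda>Q. \<Sum>s\<in>splits T Q. \<Prod>t\<in>T. a t (s t)) z
     = (\<Sum>s\<in>{s\<in>S. mdeg (\<sigma> s) \<le> N}. (\<Prod>t\<in>T. a t (s t)) * monom z (\<sigma> s))" for z
  proof -
    have "tpoly N (\<lambda>Q. \<Sum>s\<in>splits T Q. \<Prod>t\<in>T. a t (s t)) z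
      = (\<Sum>Q | mdeg Q \<le> N. \<Sum>s\<in>{s\<in>{s\<in>S. mdeg (\<sigma> s) \<le> N}. \<sigma> s = Q}. (\<Prod>t\<in>T. a t (s t)) * monom z (\<sigma> s))"
      unfolding tpoly_def by (intro sum.cong refl) (auto simp: sp sum_distrib_right intro!: sum.cong)
    also have "\<dots> = (\<Sum>s\<in>{s\<in>S. mdeg (\<sigma> s) \<le> N}. (\<Prod>t\<in>T. a t (s t)) * monom z (\<sigma> s))"
      by (rule sum.group) (auto simp: S)
    finally show ?thesis .
  qed
  \<comment> \<open>The terms of degree above \<open>N\<close> are exactly the difference between
    the product of the truncations and the truncation of the product.\<close>
  have "(\<lambda>z. (\<Sum>s\<in>{s\<in>S. \<not> mdeg (\<sigma> s) \<le> N}. (\<Prod>t\<in>T. a t (s t)) * monom z (\<sigma> s))) \<in> bigO (Suc N)"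
    by (intro bigO_sum bigO_cmult bigO_mono[OF bigO_monom]) auto
  moreover have "(\<Sum>s\<in>{s\<in>S. \<not> mdeg (\<sigma> s) \<le> N}. (\<Prod>t\<in>T. a t (s t)) * monom z (\<sigma> s)) =
     (\<Prod>t\<in>T. tpoly N (a t) z) - tpoly N (\<lambda>Q. \<Sum>s\<in>splits T Q. \<Prod>t\<in>T. a t (s t)) z" for z
  proof -
    have "S = {s\<in>S. mdeg (\<sigma> s) \<le> N} \<union> {s\<in>S. \<not> mdeg (\<sigma> s) \<le> N}" by auto
    then have "(\<Sum>s\<in>S. (\<Prod>t\<in>T. a t (s t)) * monom z (\<sigma> s)) =
       (\<Sum>s\<in>{s\<in>S. mdeg (\<sigma> s) \<le> N}. (\<Prod>t\<in>T. a t (s t)) * monom z (\<sigma> s)) +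
       (\<Sum>s\<in>{s\<in>S. \<not> mdeg (\<sigma> s) \<le> N}. (\<Prod>t\<in>T. a t (s t)) * monom z (\<sigma> s))"
      using S by (subst sum.union_disjoint[symmetric]) auto
    then show ?thesis unfolding eq eq2 by simp
  qed
  ultimately have "(\<lambda>z. (\<Prod>t\<in>T. tpoly N (a t) z) - tpoly N (\<lambda>Q. \<Sum>s\<in>splits T Q. \<Prod>t\<in>T. a t (s t)) z) \<in> bigO (Suc N)"
    by simp
  from bigO_add[OF conjunct1[OF sasy_prod_diff[where f=f and a=a, OF T f]] this]
  show ?thesis unfolding sasy_def by simp
qed

section \<open>Uniqueness of asymptotic expansions\<close>

lemma root_unity_orthogonal:
  assumes "a < M" "b < M"
  defines "\<zeta> \<equiv> exp (2 * of_real pi * \<i> / of_nat M) :: complex"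
  shows "(\<Sum>k<M. (\<zeta> ^ k) ^ a * (inverse \<zeta> ^ k) ^ b) = (if a = b then of_nat M else 0)"
proof -
  define w where "w = \<zeta> ^ a * inverse \<zeta> ^ b"
  have \<zeta>: "\<zeta> \<noteq> 0" "\<zeta> ^ j = exp (2 * of_real pi * \<i> * of_nat j / of_nat M)" for j
    by (simp_all add: \<zeta>_def exp_of_nat_mult[symmetric] mult_ac)
  have M: "\<zeta> ^ M = 1" using assms(1) by (simp add: \<zeta>(2) exp_eq_1)
  have "(\<Sum>k<M. (\<zeta> ^ k) ^ a * (inverse \<zeta> ^ k) ^ b) = (\<Sum>k<M. w ^ k)"
    unfolding w_def by (intro sum.cong refl) (simp add: power_mult_distrib power_mult[symmetric] mult.commute)
  also have "\<dots> = (if a = b then of_nat M else 0)"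
  proof (cases "a = b")
    case True
    then have "w = 1" using \<zeta>(1) by (simp add: w_def power_inverse)
    then show ?thesis using True by simp
  next
    case False
    \<comment> \<open>Both exponents lie below \<open>M\<close>, so distinct ones are distinct
      modulo \<open>M\<close>.\<close>
    have "\<zeta> ^ a \<noteq> \<zeta> ^ b"
      using False assms(1,2) complex_root_unity_eq[of M a b] by (auto simp: \<zeta>(2))
    then have "w \<noteq> 1" using \<zeta>(1) by (auto simp: w_def power_inverse field_simps)
    moreover have "w ^ M = (\<zeta> ^ M) ^ a * inverse ((\<zeta> ^ M) ^ b)"
      by (simp add: w_def power_mult_distrib power_mult[symmetric] mult.commute power_inverse)
    then have "w ^ M = 1" by (simp add: M)
    ultimately show ?thesis using False by (simp add: sum_gp_strict)
  qed
  finally show ?thesis .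
qed

text \<open>The coefficient of index R is extracted by averaging over the torus of M-th roots of unity, M > N.\<close>

lemma sasy_zero_unique:
  fixes a :: "('n::finite \<Rightarrow> nat) \<Rightarrow> complex"
  assumes "tpoly N a \<in> bigO (Suc N)" "mdeg R \<le> N"
  shows "a R = 0"
proof -
  define M where "M = Suc N"
  define \<zeta> where "\<zeta> = (exp (2 * of_real pi * \<i> / of_nat M) :: complex)"
  define A where "A = PiE (UNIV::'n set) (\<lambda>_. {..<M})"
  define z where "z = (\<lambda>t \<alpha>. (\<chi> i. of_real t * \<zeta> ^ (\<alpha> i)) :: complex^'n)"
  have A: "finite A" by (simp add: A_def finite_PiE)
  have n\<zeta>: "cmod \<zeta> = 1" by (simp add: \<zeta>_def norm_exp_eq_Re)
  have main: "(\<Sum>\<alpha>\<in>A. tpoly N a (z t \<alpha>) * (\<Prod>i\<in>UNIV. (inverse \<zeta> ^ \<alpha> i) ^ R i)) =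
      a R * of_real t ^ mdeg R * of_nat M ^ CARD('n)" for t
  proof -
    have "(\<Sum>\<alpha>\<in>A. tpoly N a (z t \<alpha>) * (\<Prod>i\<in>UNIV. (inverse \<zeta> ^ \<alpha> i) ^ R i)) =
      (\<Sum>\<alpha>\<in>A. \<Sum>Q | mdeg Q \<le> N. a Q * of_real t ^ mdeg Q * (\<Prod>i\<in>UNIV. (\<zeta> ^ \<alpha> i) ^ Q i * (inverse \<zeta> ^ \<alpha> i) ^ R i))"
      unfolding tpoly_def sum_distrib_right
      by (intro sum.cong refl) (simp add: z_def monom_def power_mult_distrib prod.distrib power_sum mdeg_def)
    also have "\<dots> = (\<Sum>Q | mdeg Q \<le> N. a Q * of_real t ^ mdeg Q * (\<Sum>\<alpha>\<in>A. \<Prod>i\<in>UNIV. (\<zeta> ^ \<alpha> i) ^ Q i * (inverse \<zeta> ^ \<alpha> i) ^ R i))"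
      by (subst sum.swap) (simp add: sum_distrib_left)
    also have "\<dots> = (\<Sum>Q | mdeg Q \<le> N. a Q * of_real t ^ mdeg Q * (\<Prod>i\<in>UNIV. \<Sum>k<M. (\<zeta> ^ k) ^ Q i * (inverse \<zeta> ^ k) ^ R i))"
      unfolding A_def by (subst prod_sum_PiE) auto
    also have "\<dots> = (\<Sum>Q | mdeg Q \<le> N. if Q = R then a Q * of_real t ^ mdeg Q * of_nat M ^ CARD('n) else 0)"
    proof (intro sum.cong refl)
      fix Q :: "'n \<Rightarrow> nat" assume Q: "Q \<in> {Q. mdeg Q \<le> N}"
      have lt: "Q i < M" "R i < M" for i
        using le_mdeg[of Q i] le_mdeg[of R i] Q assms(2) by (auto simp: M_def)
      have "(\<Prod>i\<in>UNIV. \<Sum>k<M. (\<zeta> ^ k) ^ Q i * (inverse \<zeta> ^ k) ^ R i) = (\<Prod>i\<in>UNIV. if Q i = R i then of_nat M else 0)"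
        unfolding \<zeta>_def by (intro prod.cong refl root_unity_orthogonal lt)
      also have "\<dots> = (if Q = R then of_nat M ^ CARD('n) else 0)"
        by (auto simp: fun_eq_iff)
      finally show "a Q * of_real t ^ mdeg Q * (\<Prod>i\<in>UNIV. \<Sum>k<M. (\<zeta> ^ k) ^ Q i * (inverse \<zeta> ^ k) ^ R i) =
         (if Q = R then a Q * of_real t ^ mdeg Q * of_nat M ^ CARD('n) else 0)" by simp
    qed
    also have "\<dots> = a R * of_real t ^ mdeg R * of_nat M ^ CARD('n)"
      using assms(2) by simp
    finally show ?thesis .
  qed
  obtain C where C: "C > 0" "\<forall>\<^sub>F z in nhds 0. cmod (tpoly N a z) \<le> C * norm z ^ Suc N"
    using bigOE[OF assms(1)] .
  then obtain d where d: "d > 0" "\<And>z. norm z < d \<Longrightarrow> cmod (tpoly N a z) \<le> C * norm z ^ Suc N"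
    by (auto simp: eventually_nhds_metric)
  define n where "n = real CARD('n)"
  have n: "n \<ge> 1" unfolding n_def by (simp add: Suc_leI)
  have nz: "norm (z t \<alpha>) \<le> n * t" if "t > 0" for t \<alpha>
  proof -
    have "norm (z t \<alpha>) \<le> (\<Sum>i\<in>UNIV. norm (z t \<alpha> $ i))" by (simp add: norm_vec_def L2_set_le_sum)
    also have "\<dots> = n * t" using that by (simp add: z_def norm_mult norm_power n\<zeta> n_def)
    finally show ?thesis .
  qed
  define K where "K = card A * C * n ^ Suc N"
  have K: "K \<ge> 0" using C(1) n by (simp add: K_def)
  \<comment> \<open>The torus average isolates \<open>a R * t ^ mdeg R\<close> up to a power of
    \<open>M\<close>, while the hypothesis bounds it by a multiple of \<open>t ^ Suc N\<close>. As
    \<open>mdeg R \<le> N\<close>, one factor \<open>t\<close> is left over and can tend to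
    0.\<close>
  have bd: "cmod (a R) \<le> K * t" if t: "t > 0" "t < 1" "n * t < d" for t
  proof -
    have "cmod (a R) * t ^ mdeg R * 1 \<le> cmod (a R) * t ^ mdeg R * real M ^ CARD('n)"
      using t by (intro mult_left_mono one_le_power) (auto simp: M_def)
    also have "\<dots> = cmod (a R * of_real t ^ mdeg R * of_nat M ^ CARD('n))"
      using t by (simp add: norm_mult norm_power)
    also have "\<dots> \<le> (\<Sum>\<alpha>\<in>A. cmod (tpoly N a (z t \<alpha>) * (\<Prod>i\<in>UNIV. (inverse \<zeta> ^ \<alpha> i) ^ R i)))"
      unfolding main[symmetric] by (rule norm_sum)
    also have "\<dots> \<le> (\<Sum>\<alpha>\<in>A. C * (n * t) ^ Suc N)"
    proof (rule sum_mono)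
      fix \<alpha>
      have 1: "cmod (\<Prod>i\<in>UNIV. (inverse \<zeta> ^ \<alpha> i) ^ R i) = 1"
        by (simp add: prod_norm[symmetric] norm_power norm_inverse n\<zeta>)
      have "cmod (tpoly N a (z t \<alpha>)) \<le> C * norm (z t \<alpha>) ^ Suc N"
        using nz[OF t(1), of \<alpha>] t(3) by (intro d(2)) linarith
      also have "\<dots> \<le> C * (n * t) ^ Suc N"
        using nz[OF t(1), of \<alpha>] C(1) by (intro mult_left_mono power_mono) auto
      finally show "cmod (tpoly N a (z t \<alpha>) * (\<Prod>i\<in>UNIV. (inverse \<zeta> ^ \<alpha> i) ^ R i)) \<le> C * (n * t) ^ Suc N"
        by (simp add: norm_mult 1)
    qed
    also have "\<dots> = K * t ^ Suc N" by (simp add: K_def power_mult_distrib)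
    also have "\<dots> \<le> K * t ^ Suc (mdeg R)" using assms(2) t K by (intro mult_left_mono power_decreasing) auto
    finally have "cmod (a R) * t ^ mdeg R \<le> (K * t) * t ^ mdeg R" by (simp add: mult_ac)
    then show ?thesis using t(1) by (simp add: mult_le_cancel_right)
  qed
  have "((\<lambda>t. K * t) \<longlongrightarrow> K * 0) (at_right 0)" by (intro tendsto_intros)
  moreover have "\<forall>\<^sub>F t in at_right 0. cmod (a R) \<le> K * t"
  proof -
    have "\<forall>\<^sub>F t in at_right 0. t \<in> {0<..<min 1 (d / n)}"
      by (rule eventually_at_right_real) (use d(1) n in auto)
    then show ?thesis
    proof eventually_elim
      case (elim t)
      then have "n * t < d" using n by (simp add: field_simps)
      then show ?case using elim by (intro bd) auto
    qed
  qed
  ultimately have "cmod (a R) \<le> K * 0"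
    by (rule tendsto_lowerbound) auto
  then show ?thesis by simp
qed

lemma sasy_unique:
  assumes "sasy N f a" "sasy N f b" "mdeg R \<le> N"
  shows "a R = b R"
proof -
  have "(\<lambda>z. (f z - tpoly N b z) - (f z - tpoly N a z)) \<in> bigO (Suc N)"
    using bigO_diff[OF assms(2)[unfolded sasy_def] assms(1)[unfolded sasy_def]] .
  moreover have "(f z - tpoly N b z) - (f z - tpoly N a z) = tpoly N (\<lambda>Q. a Q - b Q) z" for z
    by (simp add: tpoly_def algebra_simps sum_subtractf)
  ultimately have "tpoly N (\<lambda>Q. a Q - b Q) \<in> bigO (Suc N)" by simp
  from sasy_zero_unique[OF this assms(3)] show ?thesis by simp
qed

lemma sasy_cong:
  assumes "sasy N f a" "\<And>Q. mdeg Q \<le> N \<Longrightarrow> a Q = b Q" shows "sasy N f b"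
proof -
  have "tpoly N a = tpoly N b" unfolding tpoly_def by (intro ext sum.cong) (auto simp: assms(2))
  then show ?thesis using assms(1) by (simp add: sasy_def)
qed

lemma sasy_lincomb:
  assumes "finite A" "\<And>x. x \<in> A \<Longrightarrow> sasy N (f x) (a x)"
  shows "sasy N (\<lambda>z. \<Sum>x\<in>A. c x * f x z) (\<lambda>Q. \<Sum>x\<in>A. c x * a x Q)"
proof -
  have "tpoly N (\<lambda>Q. \<Sum>x\<in>A. c x * a x Q) z = (\<Sum>x\<in>A. c x * tpoly N (a x) z)" for z
    by (simp add: tpoly_def sum_distrib_left sum_distrib_right sum.swap[of _ A] mult_ac)
  then have "(\<Sum>x\<in>A. c x * f x z) - tpoly N (\<lambda>Q. \<Sum>x\<in>A. c x * a x Q) z = (\<Sum>x\<in>A. c x * (f x z - tpoly N (a x) z))" for z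
    by (simp add: sum_subtractf algebra_simps)
  then show ?thesis using assms(2) unfolding sasy_def by (auto intro!: bigO_sum bigO_cmult)
qed

lemma sasy_bigO_1:
  assumes "sasy N f a" "a mzero = 0" shows "f \<in> bigO 1"
proof -
  have "tpoly N a \<in> bigO 1"
    unfolding tpoly_def
  proof (rule bigO_sum)
    fix Q assume "Q \<in> {Q :: 'a \<Rightarrow> nat. mdeg Q \<le> N}"
    show "(\<lambda>z. a Q * monom z Q) \<in> bigO 1"
    proof (cases "Q = mzero")
      case False
      then have "mdeg Q \<ge> 1" by (simp add: Suc_leI mdeg_eq_0_iff neq0_conv[symmetric])
      then show ?thesis by (intro bigO_cmult bigO_mono[OF bigO_monom])
    qed (simp add: assms(2))
  qed
  moreover have "(\<lambda>z. f z - tpoly N a z) \<in> bigO 1"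
    using assms(1) unfolding sasy_def by (rule bigO_mono) simp
  ultimately have "(\<lambda>z. (f z - tpoly N a z) + tpoly N a z) \<in> bigO 1" by (intro bigO_add)
  then show ?thesis by simp
qed

section \<open>Expansions of maps and of their compositions\<close>

definition asy :: "nat \<Rightarrow> (complex^'n::finite \<Rightarrow> complex^'n) \<Rightarrow> 'n fmap \<Rightarrow> bool" where
  "asy N f F \<longleftrightarrow> (\<forall>i. sasy N (\<lambda>z. f z $ i) (\<lambda>Q. F Q $ i))"

lemma asy_norm_bound:
  assumes "asy N g G" "G mzero = 0"
  obtains C where "C > 0" "\<forall>\<^sub>F z in nhds 0. norm (g z) \<le> C * norm z"
proof -
  have "\<forall>i. \<exists>C. C > 0 \<and> (\<forall>\<^sub>F z in nhds 0. cmod (g z $ i) \<le> C * norm z)"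
  proof
    fix i
    have "(\<lambda>z. g z $ i) \<in> bigO 1" using assms by (intro sasy_bigO_1[of N _ "\<lambda>Q. G Q $ i"]) (auto simp: asy_def)
    from bigOE[OF this] show "\<exists>C. C > 0 \<and> (\<forall>\<^sub>F z in nhds 0. cmod (g z $ i) \<le> C * norm z)" by auto
  qed
  then obtain C where C: "\<And>i. C i > 0" "\<And>i. \<forall>\<^sub>F z in nhds 0. cmod (g z $ i) \<le> C i * norm z" by metis
  have "\<forall>\<^sub>F z in nhds 0. \<forall>i. cmod (g z $ i) \<le> C i * norm z"
    using C(2) by (simp add: eventually_all_finite)
  then have "\<forall>\<^sub>F z in nhds 0. norm (g z) \<le> (\<Sum>i\<in>UNIV. C i) * norm z"
  proof eventually_elim
    case (elim z)
    have "norm (g z) \<le> (\<Sum>i\<in>UNIV. cmod (g z $ i))" by (simp add: norm_vec_def L2_set_le_sum)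
    also have "\<dots> \<le> (\<Sum>i\<in>UNIV. C i * norm z)" using elim by (intro sum_mono) auto
    finally show ?case by (simp add: sum_distrib_right)
  qed
  moreover have "(\<Sum>i\<in>UNIV. C i) > 0" by (intro sum_pos) (auto simp: C)
  ultimately show ?thesis using that by blast
qed

lemma filterlim_nhds_0_linear_bound:
  fixes g :: "complex^'n::finite \<Rightarrow> complex^'m::finite"
  assumes "\<forall>\<^sub>F z in nhds 0. norm (g z) \<le> C * norm z"
  shows "filterlim g (nhds 0) (nhds 0)"
proof -
  have "((\<lambda>z::complex^'n. C * norm z) \<longlongrightarrow> C * norm (0::complex^'n)) (nhds 0)"
    by (intro tendsto_intros filterlim_ident)
  then have *: "((\<lambda>z::complex^'n. C * norm z) \<longlongrightarrow> 0) (nhds 0)" by simp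
  show ?thesis by (rule Lim_null_comparison[OF assms *])
qed

lemma bigO_compose:
  assumes "h \<in> bigO N" "C > 0" "\<forall>\<^sub>F z in nhds 0. norm (g z) \<le> C * norm z"
  shows "(\<lambda>z. h (g z)) \<in> bigO N"
proof -
  obtain K where K: "K > 0" "\<forall>\<^sub>F z in nhds 0. cmod (h z) \<le> K * norm z ^ N" using bigOE[OF assms(1)] .
  have "\<forall>\<^sub>F z in nhds 0. cmod (h (g z)) \<le> K * norm (g z) ^ N"
    using filterlim_nhds_0_linear_bound[OF assms(3)] K(2) by (auto simp: filterlim_iff)
  with assms(3) have "\<forall>\<^sub>F z in nhds 0. cmod (h (g z)) \<le> (K * C ^ N) * norm z ^ N"
  proof eventually_elim
    case (elim z)
    have "norm (g z) ^ N \<le> (C * norm z) ^ N" using elim by (intro power_mono) auto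
    then have "K * norm (g z) ^ N \<le> K * (C * norm z) ^ N" using K by simp
    then show ?case using elim by (simp add: power_mult_distrib mult_ac)
  qed
  then show ?thesis by (rule bigOI)
qed

text \<open>Since \<open>g\<close> is O(|z|), the Taylor remainder of \<open>f\<close> keeps its
  order \<open>N + 1\<close> after substitution. What is left is a polynomial in the components of
  \<open>g\<close>, whose monomials are products over slots.\<close>

lemma asy_compose:
  assumes f: "asy N f F" and g: "asy N g G" and G: "G mzero = 0"
  shows "asy N (\<lambda>z. f (g z)) (fcomp F G)"
  unfolding asy_def
proof
  fix i
  obtain C where C: "C > 0" "\<forall>\<^sub>F z in nhds 0. norm (g z) \<le> C * norm z" using asy_norm_bound[OF g G] .
  have 1: "(\<lambda>z. f (g z) $ i - tpoly N (\<lambda>Q. F Q $ i) (g z)) \<in> bigO (Suc N)"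
    by (rule bigO_compose[OF _ C]) (use f in \<open>simp add: asy_def sasy_def\<close>)
  have "sasy N (\<lambda>z. \<Sum>P | mdeg P \<le> N. F P $ i * (\<Prod>t\<in>slots P. g z $ fst t))
     (\<lambda>Q. \<Sum>P | mdeg P \<le> N. F P $ i * (\<Sum>s\<in>splits (slots P) Q. \<Prod>t\<in>slots P. G (s t) $ fst t))"
    by (intro sasy_lincomb sasy_prod) (use g in \<open>auto simp: asy_def\<close>)
  then have "sasy N (\<lambda>z. \<Sum>P | mdeg P \<le> N. F P $ i * (\<Prod>t\<in>slots P. g z $ fst t)) (\<lambda>Q. fcomp F G Q $ i)"
    by (rule sasy_cong) (simp add: fcomp_mdeg_le[where N = N and G = G, OF G] mult.commute)
  moreover have "tpoly N (\<lambda>Q. F Q $ i) (g z) = (\<Sum>P | mdeg P \<le> N. F P $ i * (\<Prod>t\<in>slots P. g z $ fst t))" for z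
    by (simp add: tpoly_def monom_slots)
  ultimately have 2: "(\<lambda>z. tpoly N (\<lambda>Q. F Q $ i) (g z) - tpoly N (\<lambda>Q. fcomp F G Q $ i) z) \<in> bigO (Suc N)"
    by (simp add: sasy_def)
  from bigO_add[OF 1 2] show "sasy N (\<lambda>z. f (g z) $ i) (\<lambda>Q. fcomp F G Q $ i)"
    by (simp add: sasy_def)
qed

lemma asy_unique:
  assumes "asy N f F" "asy N f G" "mdeg R \<le> N"
  shows "F R = G R"
  using assms by (auto simp: vec_eq_iff asy_def intro: sasy_unique)

definition vpoly :: "nat \<Rightarrow> 'n::finite fmap \<Rightarrow> complex^'n \<Rightarrow> complex^'n" where
  "vpoly N F z = (\<chi> i. tpoly N (\<lambda>Q. F Q $ i) z)"

lemma asy_vpoly: "asy N (vpoly N F) F"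
  unfolding asy_def vpoly_def by (simp, intro allI sasy_tpoly)

theorem fcomp_assoc:
  fixes F G H :: "'n::finite fmap"
  assumes "G mzero = 0" "H mzero = 0"
  shows "fcomp F (fcomp G H) = fcomp (fcomp F G) H"
proof
  fix Q :: "'n \<Rightarrow> nat"
  define N where "N = mdeg Q"
  have "asy N (\<lambda>z. vpoly N F (vpoly N G (vpoly N H z))) (fcomp F (fcomp G H))"
    by (intro asy_compose asy_vpoly) (simp_all add: fcomp_mzero assms)
  moreover have "asy N (\<lambda>z. vpoly N F (vpoly N G (vpoly N H z))) (fcomp (fcomp F G) H)"
    using asy_compose[OF asy_compose[OF asy_vpoly asy_vpoly] asy_vpoly, of G H N F] assms by blast
  ultimately show "fcomp F (fcomp G H) Q = fcomp (fcomp F G) H Q"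
    by (rule asy_unique) (simp add: N_def)
qed

section \<open>Formal composition and inversion\<close>

definition flin :: "complex^'n^'n \<Rightarrow> 'n::finite fmap" where
  "flin A = (\<lambda>Q. \<chi> i. \<Sum>j\<in>UNIV. if Q = munit j then A $ i $ j else 0)"

lemma flin_mzero [simp]: "flin A mzero = 0"
  by (simp add: flin_def vec_eq_iff)

lemma flin_munit: "flin A (munit j) $ i = A $ i $ j"
  by (simp add: flin_def)

lemma flin_eq_0: "mdeg Q \<noteq> 1 \<Longrightarrow> flin A Q = 0"
  by (auto simp: flin_def vec_eq_iff intro!: sum.neutral)

lemma lin_part_flin [simp]: "lin_part (flin A) = A"
  by (simp add: lin_part_def flin_munit vec_eq_iff)

lemma flin_lin_part:
  assumes "mdeg Q = 1" shows "flin (lin_part F) Q = F Q"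
proof -
  obtain j where "Q = munit j" using mdeg_eq_1E[OF assms] .
  then show ?thesis by (simp add: vec_eq_iff flin_munit lin_part_def)
qed

lemma flinear_eq_flin: "flinear F \<Longrightarrow> F = flin (lin_part F)"
proof
  fix Q assume "flinear F"
  then show "F Q = flin (lin_part F) Q"
    by (cases "mdeg Q = 1") (auto simp: flin_eq_0 flin_lin_part flinear_def)
qed

lemma fid_eq_flin: "fid = flin (mat 1)"
proof
  fix Q :: "'a \<Rightarrow> nat"
  show "fid Q = flin (mat 1) Q"
  proof (cases "mdeg Q = 1")
    case True
    then obtain j where "Q = munit j" by (rule mdeg_eq_1E)
    then show ?thesis by (auto simp: vec_eq_iff flin_munit fid_def mat_def)
  next
    case False
    then have "Q \<noteq> munit i" for i by auto
    then show ?thesis using False by (simp add: flin_eq_0 fid_def vec_eq_iff)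
  qed
qed

lemma asy_cong:
  assumes "asy N f F" "\<And>Q. mdeg Q \<le> N \<Longrightarrow> F Q = G Q" shows "asy N f G"
  unfolding asy_def
proof
  fix i
  show "sasy N (\<lambda>z. f z $ i) (\<lambda>Q. G Q $ i)"
    by (rule sasy_cong[of N _ "\<lambda>Q. F Q $ i"]) (use assms in \<open>auto simp: asy_def\<close>)
qed

lemma asy_matrix:
  fixes A :: "complex^'n::finite^'n"
  assumes "N \<ge> 1" shows "asy N ((*v) A) (flin A)"
  unfolding asy_def
proof
  fix i
  have "tpoly N (\<lambda>Q. flin A Q $ i) z = (A *v z) $ i" for z
  proof -
    have "tpoly N (\<lambda>Q. flin A Q $ i) z = (\<Sum>j\<in>UNIV. \<Sum>Q | mdeg Q \<le> N. if Q = munit j then A $ i $ j * z $ j else 0)"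
      unfolding tpoly_def flin_def
      by (subst sum.swap) (auto simp: sum_distrib_right intro!: sum.cong)
    also have "\<dots> = (\<Sum>j\<in>UNIV. A $ i $ j * z $ j)" using assms by simp
    finally show ?thesis by (simp add: matrix_vector_mult_def)
  qed
  then show "sasy N (\<lambda>z. (A *v z) $ i) (\<lambda>Q. flin A Q $ i)" by (simp add: sasy_def)
qed

lemma fcomp_flin_left:
  fixes G :: "'n::finite fmap"
  assumes "G mzero = 0" shows "fcomp (flin A) G Q = A *v G Q"
proof -
  \<comment> \<open>\<open>asy_matrix\<close> is stated for orders at least 1, which
    \<open>mdeg Q\<close> alone would miss at the zero index.\<close>
  define N where "N = Suc (mdeg Q)"
  have "asy N (\<lambda>z. A *v vpoly N G z) (fcomp (flin A) G)"
    by (intro asy_compose asy_matrix asy_vpoly assms) (simp add: N_def)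
  moreover have "asy N (\<lambda>z. A *v vpoly N G z) (\<lambda>Q. A *v G Q)"
    unfolding asy_def matrix_vector_mult_def vec_lambda_beta
    using asy_vpoly[of N G] by (intro allI sasy_lincomb) (auto simp: asy_def)
  ultimately show ?thesis by (rule asy_unique) (simp add: N_def)
qed

lemma diag_mult_vec: "diag d *v z = (\<chi> i. d i * z $ i)"
  by (auto simp: diag_def matrix_vector_mult_def vec_eq_iff if_distrib[of "\<lambda>x. x * _"] cong: if_cong)

text \<open>Here the products Lambda^Q arise: a diagonal substitution multiplies each monomial by a
  scalar.\<close>

lemma fcomp_flin_diag:
  fixes F :: "'n::finite fmap"
  shows "fcomp F (flin (diag d)) Q = (\<Prod>i\<in>UNIV. d i ^ Q i) *s F Q"
proof -
  define N where "N = Suc (mdeg Q)"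
  have "asy N (\<lambda>z. vpoly N F (diag d *v z)) (fcomp F (flin (diag d)))"
    by (intro asy_compose asy_matrix asy_vpoly) (simp_all add: N_def)
  moreover have "vpoly N F (diag d *v z) = vpoly N (\<lambda>Q. (\<Prod>i\<in>UNIV. d i ^ Q i) *s F Q) z" for z
    by (simp add: vpoly_def vec_eq_iff tpoly_def diag_mult_vec monom_scale mult_ac)
  then have "asy N (\<lambda>z. vpoly N F (diag d *v z)) (\<lambda>Q. (\<Prod>i\<in>UNIV. d i ^ Q i) *s F Q)"
    using asy_vpoly by simp
  ultimately show ?thesis by (rule asy_unique) (simp add: N_def)
qed

lemma fcomp_fid_left: "G mzero = 0 \<Longrightarrow> fcomp fid G = G"
  unfolding fid_eq_flin by (rule ext) (simp add: fcomp_flin_left)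

lemma mat_1_eq_diag: "mat 1 = diag (\<lambda>_. 1)"
  by (simp add: mat_def diag_def)

lemma fcomp_fid_right: "fcomp F fid = F"
  unfolding fid_eq_flin mat_1_eq_diag by (rule ext) (simp add: fcomp_flin_diag)

lemma lin_part_fcomp:
  fixes F G :: "'n::finite fmap"
  assumes "F mzero = 0" "G mzero = 0"
  shows "lin_part (fcomp F G) = lin_part F ** lin_part G"
proof -
  have asy: "asy 1 ((*v) (lin_part F)) F" if "F mzero = 0" for F :: "'n fmap"
  proof (rule asy_cong[OF asy_matrix])
    fix Q :: "'n \<Rightarrow> nat" assume "mdeg Q \<le> 1"
    then consider "mdeg Q = 0" | "mdeg Q = 1" by linarith
    then show "flin (lin_part F) Q = F Q" by cases (use that in \<open>auto simp: mdeg_eq_0_iff flin_lin_part\<close>)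
  qed simp
  have "asy 1 (\<lambda>z. lin_part F *v (lin_part G *v z)) (fcomp F G)"
    by (intro asy_compose asy assms)
  then have "asy 1 ((*v) (lin_part F ** lin_part G)) (fcomp F G)"
    by (simp add: matrix_vector_mul_assoc)
  then have "fcomp F G (munit j) = flin (lin_part F ** lin_part G) (munit j)" for j
    by (rule asy_unique[OF _ asy_matrix]) auto
  then show ?thesis by (simp add: vec_eq_iff lin_part_def flin_munit)
qed

lemma flin_comp: "fcomp (flin A) (flin B) = flin (A ** B)"
proof
  fix Q
  have "fcomp (flin A) (flin B) Q = A *v flin B Q" by (simp add: fcomp_flin_left)
  also have "\<dots> = flin (A ** B) Q"
  proof (cases "mdeg Q = 1")
    case True
    then obtain j where "Q = munit j" by (rule mdeg_eq_1E)
    then show ?thesis by (simp add: vec_eq_iff flin_munit matrix_vector_mult_def matrix_matrix_mult_def)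
  qed (simp add: flin_eq_0)
  finally show "fcomp (flin A) (flin B) Q = flin (A ** B) Q" .
qed

section \<open>Triangularity in the degree and formal inversion\<close>

lemma fcomp_add_left: "fcomp (\<lambda>Q. F Q + F' Q) G Q = fcomp F G Q + fcomp F' G Q"
  by (simp add: fcomp_def vector_add_ldistrib sum.distrib)

definition fhigh :: "'n::finite fmap \<Rightarrow> 'n fmap" where
  "fhigh F = (\<lambda>Q. if mdeg Q \<ge> 2 then F Q else 0)"

text \<open>Separates the only occurrence of \<open>G Q\<close> itself: by
  \<open>fcomp_fhigh_cong\<close> the second summand depends on coefficients of \<open>G\<close> of
  lower degree alone.\<close>

lemma fcomp_fhigh:
  fixes F :: "'n::finite fmap"
  assumes "F mzero = 0" "G mzero = 0"
  shows "fcomp F G Q = lin_part F *v G Q + fcomp (fhigh F) G Q"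
proof -
  have F: "F = (\<lambda>Q. flin (lin_part F) Q + fhigh F Q)"
  proof
    fix Q :: "'n \<Rightarrow> nat"
    consider "mdeg Q = 0" | "mdeg Q = 1" | "mdeg Q \<ge> 2" by linarith
    then show "F Q = flin (lin_part F) Q + fhigh F Q"
      by cases (use assms in \<open>auto simp: mdeg_eq_0_iff flin_lin_part flin_eq_0 fhigh_def\<close>)
  qed
  show ?thesis by (subst F) (simp add: fcomp_add_left fcomp_flin_left assms)
qed

lemma splits_mdeg_less:
  assumes "s \<in> splits T Q" "finite T" "card T \<ge> 2" "\<And>t. t \<in> T \<Longrightarrow> s t \<noteq> mzero" "t \<in> T"
  shows "mdeg (s t) < mdeg Q"
proof -
  have "mdeg Q = mdeg (s t) + (\<Sum>u\<in>T - {t}. mdeg (s u))"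
    using splits_mdeg[OF assms(1)] assms(2,5) by (simp add: sum.remove)
  moreover have "T - {t} \<noteq> {}"
  proof
    assume "T - {t} = {}"
    then have "T = {t}" using assms(5) by auto
    then show False using assms(3) by simp
  qed
  then have "(\<Sum>u\<in>T - {t}. mdeg (s u)) > 0"
    using assms(2,4) by (intro sum_pos) (auto simp: mdeg_eq_0_iff neq0_conv[symmetric])
  ultimately show ?thesis by simp
qed

lemma fcomp_fhigh_splits:
  "fcomp (fhigh F) G Q = (\<Sum>P | 2 \<le> mdeg P \<and> mdeg P \<le> mdeg Q.
      (\<Sum>s\<in>splits (slots P) Q. \<Prod>t\<in>slots P. G (s t) $ fst t) *s F P)"
  unfolding fcomp_splits
  by (rule sum.mono_neutral_cong_right) (auto simp: fhigh_def)

text \<open>With at least two slots and no zero part, every part has degree strictly below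
  \<open>mdeg Q\<close>; splits with a zero part contribute nothing on either side.\<close>

lemma fcomp_fhigh_cong:
  fixes G G' :: "'n::finite fmap"
  assumes "G mzero = 0" "G' mzero = 0" "\<And>R. mdeg R < mdeg Q \<Longrightarrow> G R = G' R"
  shows "fcomp (fhigh F) G Q = fcomp (fhigh F) G' Q"
  unfolding fcomp_fhigh_splits
proof (intro sum.cong refl arg_cong2[of _ _ _ _ "(*s)"])
  fix P :: "'n \<Rightarrow> nat" and s assume P: "P \<in> {P. 2 \<le> mdeg P \<and> mdeg P \<le> mdeg Q}" and s: "s \<in> splits (slots P) Q"
  show "(\<Prod>t\<in>slots P. G (s t) $ fst t) = (\<Prod>t\<in>slots P. G' (s t) $ fst t)"
  proof (cases "\<exists>t\<in>slots P. s t = mzero")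
    case True
    then obtain t where "t \<in> slots P" "s t = mzero" by auto
    then show ?thesis
      by (simp only: splits_prod_eq_0[where G = G and t = t, OF assms(1)] splits_prod_eq_0[where G = G' and t = t, OF assms(2)])
  next
    case False
    then show ?thesis using P splits_mdeg_less[OF s] by (intro prod.cong refl) (simp add: assms(3))
  qed
qed

text \<open>The inverse is the fixed point of \<open>F\<close> becoming \<open>B\<close> applied to
  the identity minus the higher part of \<open>G\<close> composed with \<open>F\<close>, a
  contraction with respect to degree. The recursion is returned as well, because both the
  convergence and the support of the inverse are read off from it.\<close>

theorem formal_right_inverse:
  fixes G :: "'n::finite fmap"
  assumes "G mzero = 0" "lin_part G ** B = mat 1" "B ** lin_part G = mat 1"
  obtains \<Theta> where "\<Theta> mzero = 0" "fcomp G \<Theta> = fid" "\<And>Q. \<Theta> Q = B *v (fid Q - fcomp (fhigh G) \<Theta> Q)"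
proof -
  define T where "T = rec_nat (\<lambda>_. 0) (\<lambda>_ F Q. B *v (fid Q - fcomp (fhigh G) F Q))"
  have T_Suc: "T (Suc m) Q = B *v (fid Q - fcomp (fhigh G) (T m) Q)" for m Q by (simp add: T_def)
  have f0: "fid mzero = 0" by (simp add: fid_def vec_eq_iff)
  have T0: "T m mzero = 0" for m
    by (cases m) (simp_all add: T_Suc fcomp_mzero fhigh_def f0, simp add: T_def)
  have step: "mdeg Q \<le> m \<Longrightarrow> T (Suc m) Q = T m Q" for m Q
  proof (induction m arbitrary: Q)
    case 0
    then show ?case by (simp add: mdeg_eq_0_iff T0)
  next
    case (Suc m)
    have "fcomp (fhigh G) (T (Suc m)) Q = fcomp (fhigh G) (T m) Q"
      by (intro fcomp_fhigh_cong T0 Suc.IH) (use Suc.prems in linarith)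
    then show ?case by (simp only: T_Suc)
  qed
  \<comment> \<open>The m-th iterate is final in degrees up to m, so the diagonal collects the
    limit.\<close>
  define \<Theta> where "\<Theta> = (\<lambda>Q. T (mdeg Q) Q)"
  have T_eq: "T m Q = \<Theta> Q" if "mdeg Q \<le> m" for m Q
    using that unfolding \<Theta>_def by (induction m rule: dec_induct) (auto simp: step)
  have \<Theta>0: "\<Theta> mzero = 0" by (simp add: \<Theta>_def T0)
  have eq: "\<Theta> Q = B *v (fid Q - fcomp (fhigh G) \<Theta> Q)" for Q
  proof -
    have "\<Theta> Q = T (Suc (mdeg Q)) Q" by (simp add: T_eq)
    also have "\<dots> = B *v (fid Q - fcomp (fhigh G) (T (mdeg Q)) Q)" by (rule T_Suc)
    also have "fcomp (fhigh G) (T (mdeg Q)) Q = fcomp (fhigh G) \<Theta> Q"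
      by (intro fcomp_fhigh_cong T0 \<Theta>0 T_eq) simp
    finally show ?thesis .
  qed
  have "fcomp G \<Theta> Q = fid Q" for Q
    using arg_cong[OF eq[of Q], of "(*v) (lin_part G)"]
    by (simp add: fcomp_fhigh[where F = G and G = \<Theta>, OF assms(1) \<Theta>0] matrix_vector_mul_assoc assms(2))
  then show ?thesis using that[of \<Theta>] \<Theta>0 eq by blast
qed

text \<open>The given formal linearization has an uncontrolled linear part \<open>T\<close>, and its
  linear models need not be diagonal. Precomposing it with the linear map \<open>T' ** P\<close>,
  where \<open>T'\<close> inverts \<open>T\<close>, corrects both at once.\<close>

lemma formal_linearization_obtain:
  fixes c :: "nat \<Rightarrow> 'n::finite fmap"
  assumes lin: "formally_linearizable h c" and c0: "\<And>k. k \<in> {1..h} \<Longrightarrow> c k mzero = 0"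
    and D: "\<And>k. k \<in> {1..h} \<Longrightarrow> lin_part (c k) ** P = P ** D k"
  obtains \<Phi> where "\<Phi> mzero = 0" "lin_part \<Phi> = P" "\<And>k. k \<in> {1..h} \<Longrightarrow> fcomp (c k) \<Phi> = fcomp \<Phi> (flin (D k))"
proof -
  obtain \<Phi>' \<Psi> where z: "\<Phi>' mzero = 0" "\<Psi> mzero = 0" and inv: "fcomp \<Phi>' \<Psi> = fid" "fcomp \<Psi> \<Phi>' = fid"
    and L: "\<And>k. k \<in> {1..h} \<Longrightarrow> flinear (fcomp \<Psi> (fcomp (c k) \<Phi>'))"
    using lin unfolding formally_linearizable_def by blast
  define T T' where "T = lin_part \<Phi>'" "T' = lin_part \<Psi>"
  have T: "T ** T' = mat 1" "T' ** T = mat 1"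
    using lin_part_fcomp[where F = \<Phi>' and G = \<Psi>, OF z] lin_part_fcomp[where F = \<Psi> and G = \<Phi>', OF z(2,1)]
    by (simp_all add: T_T'_def inv fid_eq_flin)
  define \<Phi> where "\<Phi> = fcomp \<Phi>' (flin (T' ** P))"
  have "fcomp (c k) \<Phi> = fcomp \<Phi> (flin (D k))" if k: "k \<in> {1..h}" for k
  proof -
    define M where "M = lin_part (fcomp \<Psi> (fcomp (c k) \<Phi>'))"
    have cz: "fcomp (c k) \<Phi>' mzero = 0" by (simp add: fcomp_mzero c0[OF k])
    have M: "fcomp \<Psi> (fcomp (c k) \<Phi>') = flin M"
      unfolding M_def by (rule flinear_eq_flin[OF L[OF k]])
    have "fcomp \<Phi>' (flin M) = fcomp (fcomp \<Phi>' \<Psi>) (fcomp (c k) \<Phi>')"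
      by (subst fcomp_assoc[symmetric]) (simp_all add: z cz M)
    then have e1: "fcomp \<Phi>' (flin M) = fcomp (c k) \<Phi>'" by (simp add: inv fcomp_fid_left cz)
    have "T ** M = lin_part (c k) ** T"
      using arg_cong[OF e1, of lin_part] by (simp add: lin_part_fcomp z c0[OF k] T_T'_def)
    then have "T' ** (T ** M) = T' ** (lin_part (c k) ** T)" by simp
    then have M': "M = T' ** lin_part (c k) ** T" by (simp only: matrix_mul_assoc T matrix_mul_lid)
    have "M ** (T' ** P) = T' ** lin_part (c k) ** (T ** T') ** P"
      unfolding M' by (simp only: matrix_mul_assoc)
    also have "\<dots> = T' ** (lin_part (c k) ** P)" by (simp only: T matrix_mul_rid matrix_mul_assoc)
    also have "\<dots> = T' ** P ** D k" by (simp only: D[OF k] matrix_mul_assoc)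
    finally have MW: "M ** (T' ** P) = T' ** P ** D k" .
    have "fcomp (c k) \<Phi> = fcomp (fcomp \<Phi>' (flin M)) (flin (T' ** P))"
      unfolding \<Phi>_def e1 by (rule fcomp_assoc) (simp_all add: z)
    also have "\<dots> = fcomp \<Phi>' (flin (T' ** P ** D k))"
      by (subst fcomp_assoc[symmetric]) (simp_all add: z flin_comp MW)
    also have "\<dots> = fcomp \<Phi> (flin (D k))"
      unfolding \<Phi>_def by (subst fcomp_assoc[symmetric]) (simp_all add: flin_comp)
    finally show ?thesis .
  qed
  moreover have "\<Phi> mzero = 0" by (simp add: \<Phi>_def fcomp_mzero z)
  moreover have "lin_part \<Phi> = P"
    unfolding \<Phi>_def by (subst lin_part_fcomp) (simp_all add: z, simp only: T_T'_def[symmetric] matrix_mul_assoc T matrix_mul_lid)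
  ultimately show ?thesis using that by blast
qed

section \<open>Majorants\<close>

lemma splits_nonzero_mdeg_le:
  assumes "s \<in> splits T Q" "finite T" "card T \<ge> 2" "\<And>t. t \<in> T \<Longrightarrow> s t \<noteq> mzero" "mdeg Q \<le> Suc N"
  shows "s \<in> PiE T (\<lambda>_. {R. mdeg R \<le> N})"
proof -
  have "mdeg (s t) \<le> N" if "t \<in> T" for t
    using splits_mdeg_less[OF assms(1-4) that] assms(5) by simp
  then show ?thesis using assms(1) by (auto simp: splits_def PiE_def)
qed

text \<open>Expanding the power gives a sum over all tuples of indices, in which each split of an
  element of \<open>X\<close> occurs once. Splits with a zero part have weight 0; in the others, at
  least two parts force each down to degree \<open>N\<close>. This gain of one degree drives the
  majorant induction.\<close>

lemma sum_splits_le: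
  fixes w :: "('n::finite \<Rightarrow> nat) \<Rightarrow> real"
  assumes T: "finite T" "card T \<ge> 2" and w: "\<And>R. w R \<ge> 0" "w mzero = 0"
    and X: "finite X" "\<And>Q. Q \<in> X \<Longrightarrow> mdeg Q \<le> Suc N"
  shows "(\<Sum>Q\<in>X. \<Sum>s\<in>splits T Q. \<Prod>t\<in>T. w (s t)) \<le> (\<Sum>R | mdeg R \<le> N. w R) ^ card T"
proof -
  define S where "S = PiE T (\<lambda>_. {R :: 'n \<Rightarrow> nat. mdeg R \<le> N})"
  define \<sigma> where "\<sigma> = (\<lambda>s::'a \<Rightarrow> 'n \<Rightarrow> nat. \<lambda>i. \<Sum>t\<in>T. s t i)"
  have S: "finite S" unfolding S_def by (intro finite_PiE T) auto
  have nn: "(\<Prod>t\<in>T. w (s t)) \<ge> 0" for s by (intro prod_nonneg) (simp add: w)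
  have "(\<Sum>Q\<in>X. \<Sum>s\<in>splits T Q. \<Prod>t\<in>T. w (s t)) \<le> (\<Sum>Q\<in>X. \<Sum>s\<in>{s \<in> {s \<in> S. \<sigma> s \<in> X}. \<sigma> s = Q}. \<Prod>t\<in>T. w (s t))"
  proof (rule sum_mono)
    fix Q assume Q: "Q \<in> X"
    define Z where "Z = {s \<in> splits T Q. \<forall>t\<in>T. s t \<noteq> mzero}"
    have "(\<Sum>s\<in>splits T Q. \<Prod>t\<in>T. w (s t)) = (\<Sum>s\<in>Z. \<Prod>t\<in>T. w (s t))"
    proof (rule sum.mono_neutral_right)
      show "\<forall>s\<in>splits T Q - Z. (\<Prod>t\<in>T. w (s t)) = 0"
      proof
        fix s assume "s \<in> splits T Q - Z"
        then obtain t where "t \<in> T" "s t = mzero" by (auto simp: Z_def)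
        then show "(\<Prod>t\<in>T. w (s t)) = 0" using T w(2) by (intro prod_zero) (auto intro!: bexI[of _ t])
      qed
    qed (auto simp: T Z_def)
    also have "\<dots> \<le> (\<Sum>s\<in>{s \<in> {s \<in> S. \<sigma> s \<in> X}. \<sigma> s = Q}. \<Prod>t\<in>T. w (s t))"
    proof (rule sum_mono2)
      show "Z \<subseteq> {s \<in> {s \<in> S. \<sigma> s \<in> X}. \<sigma> s = Q}"
      proof
        fix s assume s: "s \<in> Z"
        then have "s \<in> S" unfolding S_def Z_def by (intro splits_nonzero_mdeg_le[of s T Q] T X(2)[OF Q]) auto
        moreover have "\<sigma> s = Q" using s by (auto simp: Z_def splits_def \<sigma>_def)
        ultimately show "s \<in> {s \<in> {s \<in> S. \<sigma> s \<in> X}. \<sigma> s = Q}" using Q by simp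
      qed
    qed (auto simp: S nn)
    finally show "(\<Sum>s\<in>splits T Q. \<Prod>t\<in>T. w (s t)) \<le> (\<Sum>s\<in>{s \<in> {s \<in> S. \<sigma> s \<in> X}. \<sigma> s = Q}. \<Prod>t\<in>T. w (s t))" .
  qed
  also have "\<dots> = (\<Sum>s\<in>{s \<in> S. \<sigma> s \<in> X}. \<Prod>t\<in>T. w (s t))"
    by (rule sum.group) (auto simp: S X)
  also have "\<dots> \<le> (\<Sum>s\<in>S. \<Prod>t\<in>T. w (s t))"
    by (rule sum_mono2) (auto simp: S nn)
  also have "\<dots> = (\<Prod>t\<in>T. \<Sum>R | mdeg R \<le> N. w R)"
    unfolding S_def by (subst prod_sum_PiE) (auto simp: T)
  finally show ?thesis by simp
qed

text \<open>The coefficient at \<open>Q\<close> of the terms of order at least 2 in a composition,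
  with every component of the inner map replaced by the same scalar series \<open>v\<close>.\<close>

definition compose_norms :: "(('n::finite \<Rightarrow> nat) \<Rightarrow> real) \<Rightarrow> (('n \<Rightarrow> nat) \<Rightarrow> real) \<Rightarrow> ('n \<Rightarrow> nat) \<Rightarrow> real" where
  "compose_norms a v Q = (\<Sum>P | 2 \<le> mdeg P \<and> mdeg P \<le> mdeg Q.
     a P * (\<Sum>s\<in>splits (slots P) Q. \<Prod>t\<in>slots P. v (s t)))"

text \<open>Cauchy's method without solving the majorant equation: the partial sums
  \<open>U N\<close> of \<open>v\<close> at radius \<open>r\<close> satisfy
  \<open>U (Suc N) \<le> n * K * r\<close> plus the sum of \<open>a P * U N ^ mdeg P\<close>, and
  the bound \<open>x\<close> is preserved. Neither \<open>r\<close> nor \<open>x\<close> depends on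
  \<open>v\<close> or \<open>V\<close>.\<close>

lemma majorant_recursion:
  fixes a :: "('n::finite \<Rightarrow> nat) \<Rightarrow> real"
  assumes a: "\<And>P. a P \<ge> 0" and r0: "r0 > 0" and sm: "(\<lambda>P. a P * r0 ^ mdeg P) summable_on UNIV" and K: "K > 0"
  shows "\<exists>r>0. \<exists>x>0. \<forall>V v. (\<forall>Q. v Q \<ge> 0) \<longrightarrow> v mzero = 0 \<longrightarrow> (\<forall>j. v (munit j) \<le> K) \<longrightarrow>
    (\<forall>Q. 2 \<le> mdeg Q \<longrightarrow> mdeg Q \<le> V \<longrightarrow> v Q \<le> compose_norms a v Q) \<longrightarrow>
    (\<forall>Q. mdeg Q \<le> V \<longrightarrow> v Q \<le> x / r ^ mdeg Q)"
proof -
  define A where "A = infsum (\<lambda>P. a P * r0 ^ mdeg P) UNIV"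
  have fin: "(\<Sum>P\<in>F. a P * r0 ^ mdeg P) \<le> A" if "finite F" for F
    unfolding A_def by (rule finite_sum_le_infsum[OF sm that]) (use a r0 in auto)
  have A: "A \<ge> 0" using fin[of "{}"] by simp
  \<comment> \<open>Chosen so that the terms of order at least 2 contribute at most
    \<open>(x / r0)\<^sup>2 * A \<le> x / 2\<close>; \<open>A + 1\<close> avoids a division by zero.
    The radius \<open>r\<close> below reserves the other half for the linear terms.\<close>
  define x where "x = min r0 (r0\<^sup>2 / (2 * (A + 1)))"
  define n where "n = real CARD('n)"
  have n: "n > 0" by (simp add: n_def)
  define r where "r = x / (2 * n * K)"
  have x: "x > 0" "x \<le> r0" using r0 A by (auto simp: x_def)
  have r: "r > 0" "n * K * r = x / 2" using x n K by (auto simp: r_def)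
  have "x \<le> r0\<^sup>2 / (2 * (A + 1))" by (simp add: x_def)
  then have "x * (A + 1) \<le> r0\<^sup>2 / 2" using A by (simp add: field_simps)
  then have "x * A \<le> r0\<^sup>2 / 2" using x(1) by (simp add: algebra_simps)
  then have xA: "(x / r0)\<^sup>2 * A \<le> x / 2"
    using x r0 by (simp add: power2_eq_square field_simps)
  show ?thesis
  proof (rule exI[of _ r], rule conjI[OF r(1)], rule exI[of _ x], rule conjI[OF x(1)], intro allI impI)
    fix V :: nat and v :: "('n \<Rightarrow> nat) \<Rightarrow> real" and Q :: "'n \<Rightarrow> nat"
    assume v0: "\<forall>Q. v Q \<ge> 0" and vz: "v mzero = 0" and v1: "\<forall>j. v (munit j) \<le> K"
      and rec: "\<forall>Q. 2 \<le> mdeg Q \<longrightarrow> mdeg Q \<le> V \<longrightarrow> v Q \<le> compose_norms a v Q"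
      and QV: "mdeg Q \<le> V"
    define w where "w = (\<lambda>R. v R * r ^ mdeg R)"
    have w: "w R \<ge> 0" "w mzero = 0" for R using v0 r(1) vz by (auto simp: w_def)
    define U where "U = (\<lambda>N. \<Sum>R | mdeg R \<le> N. w R)"
    have U0: "U N \<ge> 0" for N unfolding U_def by (intro sum_nonneg w)
    have U: "N \<le> V \<Longrightarrow> U N \<le> x" for N
    proof (induction N)
      case 0
      have "{R :: 'n \<Rightarrow> nat. mdeg R \<le> 0} = {mzero}" by (auto simp: mdeg_eq_0_iff)
      then show ?case using x by (simp add: U_def w)
    next
      case (Suc N)
      then have IH: "U N \<le> x" by simp
      define X where "X = {R :: 'n \<Rightarrow> nat. 2 \<le> mdeg R \<and> mdeg R \<le> Suc N}"
      have X: "finite X" unfolding X_def by (rule finite_subset[OF _ finite_mdeg_le[of "Suc N"]]) auto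
      have low: "{R :: 'n \<Rightarrow> nat. mdeg R \<le> 1} = insert mzero (range munit)"
      proof -
        have "R = mzero \<or> R \<in> range munit" if "mdeg R \<le> 1" for R :: "'n \<Rightarrow> nat"
        proof (cases "mdeg R = 1")
          case True
          then obtain j where "R = munit j" by (rule mdeg_eq_1E)
          then show ?thesis by simp
        next
          case False then show ?thesis using that by (simp add: mdeg_eq_0_iff[symmetric])
        qed
        then show ?thesis by auto
      qed
      have "U (Suc N) = (\<Sum>R | mdeg R \<le> 1. w R) + (\<Sum>R\<in>X. w R)"
        unfolding U_def X_def by (subst sum.union_disjoint[symmetric]) (auto intro!: sum.cong X[unfolded X_def])
      moreover have "(\<Sum>R | mdeg R \<le> 1. w R) \<le> x / 2"
      proof -
        have "(\<Sum>R | mdeg R \<le> 1. w R) = (\<Sum>j\<in>UNIV. w (munit j))"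
          unfolding low by (subst sum.insert) (auto simp: w sum.reindex inj_on_def)
        also have "\<dots> \<le> (\<Sum>j\<in>(UNIV::'n set). K * r)"
          using v1 r(1) by (intro sum_mono) (simp add: w_def)
        also have "\<dots> = x / 2" using r(2) by (simp add: n_def mult_ac)
        finally show ?thesis .
      qed
      moreover have "(\<Sum>R\<in>X. w R) \<le> x / 2"
      proof -
        have "(\<Sum>R\<in>X. w R) \<le> (\<Sum>R\<in>X. \<Sum>P\<in>X. a P * (\<Sum>s\<in>splits (slots P) R. \<Prod>t\<in>slots P. w (s t)))"
        proof (rule sum_mono)
          fix R assume R: "R \<in> X"
          have sp: "(\<Sum>s\<in>splits (slots P) R. \<Prod>t\<in>slots P. v (s t)) * r ^ mdeg R = (\<Sum>s\<in>splits (slots P) R. \<Prod>t\<in>slots P. w (s t))" for P :: "'n \<Rightarrow> nat"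
          proof -
            have "r ^ mdeg R = (\<Prod>t\<in>slots P. r ^ mdeg (s t))" if "s \<in> splits (slots P) R" for s
              by (simp add: power_sum[symmetric] splits_mdeg[OF that])
            then show ?thesis by (simp add: sum_distrib_right w_def prod.distrib)
          qed
          have "v R \<le> compose_norms a v R" using R Suc.prems rec by (auto simp: X_def)
          then have "w R \<le> compose_norms a v R * r ^ mdeg R"
            unfolding w_def using r(1) by (intro mult_right_mono) auto
          also have "\<dots> = (\<Sum>P | 2 \<le> mdeg P \<and> mdeg P \<le> mdeg R. a P * ((\<Sum>s\<in>splits (slots P) R. \<Prod>t\<in>slots P. v (s t)) * r ^ mdeg R))"
            unfolding compose_norms_def sum_distrib_right[of _ "{P. 2 \<le> mdeg P \<and> mdeg P \<le> mdeg R}"] mult.assoc ..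
          also have "\<dots> = (\<Sum>P | 2 \<le> mdeg P \<and> mdeg P \<le> mdeg R. a P * (\<Sum>s\<in>splits (slots P) R. \<Prod>t\<in>slots P. w (s t)))"
            by (simp only: sp)
          also have "\<dots> \<le> (\<Sum>P\<in>X. a P * (\<Sum>s\<in>splits (slots P) R. \<Prod>t\<in>slots P. w (s t)))"
            by (rule sum_mono2) (use R in \<open>auto simp: X_def X[unfolded X_def] intro!: mult_nonneg_nonneg a sum_nonneg prod_nonneg w\<close>)
          finally show "w R \<le> (\<Sum>P\<in>X. a P * (\<Sum>s\<in>splits (slots P) R. \<Prod>t\<in>slots P. w (s t)))" .
        qed
        also have "\<dots> = (\<Sum>P\<in>X. a P * (\<Sum>R\<in>X. \<Sum>s\<in>splits (slots P) R. \<Prod>t\<in>slots P. w (s t)))"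
          by (subst sum.swap) (simp add: sum_distrib_left)
        also have "\<dots> \<le> (\<Sum>P\<in>X. a P * ((x / r0)\<^sup>2 * r0 ^ mdeg P))"
        proof (intro sum_mono mult_left_mono a)
          fix P assume P: "P \<in> X"
          have "(\<Sum>R\<in>X. \<Sum>s\<in>splits (slots P) R. \<Prod>t\<in>slots P. w (s t)) \<le> U N ^ card (slots P)"
            unfolding U_def by (rule sum_splits_le) (use P in \<open>auto simp: w X\<close>, auto simp: X_def)
          also have "\<dots> \<le> x ^ mdeg P" using IH U0[of N] by (simp add: power_mono)
          also have "\<dots> = (x / r0) ^ mdeg P * r0 ^ mdeg P" using r0 by (simp add: power_divide)
          also have "\<dots> \<le> (x / r0)\<^sup>2 * r0 ^ mdeg P"
            using x r0 P by (intro mult_right_mono power_decreasing) (auto simp: X_def)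
          finally show "(\<Sum>R\<in>X. \<Sum>s\<in>splits (slots P) R. \<Prod>t\<in>slots P. w (s t)) \<le> (x / r0)\<^sup>2 * r0 ^ mdeg P" .
        qed
        also have "\<dots> = (x / r0)\<^sup>2 * (\<Sum>P\<in>X. a P * r0 ^ mdeg P)" by (simp add: sum_distrib_left mult_ac)
        also have "\<dots> \<le> (x / r0)\<^sup>2 * A" by (intro mult_left_mono fin X) simp
        finally show ?thesis using xA by simp
      qed
      ultimately show ?case by simp
    qed
    have "w Q \<le> U (mdeg Q)" unfolding U_def by (rule member_le_sum) (auto simp: w)
    also have "\<dots> \<le> x" by (rule U[OF QV])
    finally show "v Q \<le> x / r ^ mdeg Q" using r(1) by (simp add: w_def field_simps)
  qed
qed

section \<open>Norm estimates and recursions with divisors\<close>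

lemma norm_vector_smult: "norm (c *s v) = cmod c * norm v" for v :: "complex^'n::finite"
  by (simp add: norm_vec_def norm_mult L2_set_right_distrib)

lemma norm_fcomp_fhigh_le:
  fixes F G :: "'n::finite fmap"
  shows "norm (fcomp (fhigh F) G Q) \<le> compose_norms (\<lambda>P. norm (F P)) (\<lambda>R. norm (G R)) Q"
  unfolding fcomp_fhigh_splits compose_norms_def
proof (rule order_trans[OF norm_sum], rule sum_mono)
  fix P :: "'n \<Rightarrow> nat"
  have "cmod (\<Sum>s\<in>splits (slots P) Q. \<Prod>t\<in>slots P. G (s t) $ fst t) \<le> (\<Sum>s\<in>splits (slots P) Q. \<Prod>t\<in>slots P. norm (G (s t)))"
    by (rule order_trans[OF norm_sum], rule sum_mono)
       (auto simp: prod_norm[symmetric] intro!: prod_mono Finite_Cartesian_Product.norm_nth_le)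
  then show "norm ((\<Sum>s\<in>splits (slots P) Q. \<Prod>t\<in>slots P. G (s t) $ fst t) *s F P)
     \<le> norm (F P) * (\<Sum>s\<in>splits (slots P) Q. \<Prod>t\<in>slots P. norm (G (s t)))"
    by (simp add: norm_vector_smult mult.commute mult_left_mono)
qed

text \<open>\<open>\<gamma> Q\<close> is the logarithmic loss at the index \<open>Q\<close> itself,
  \<open>G Q\<close> bounds the loss accumulated in all substitutions leading to \<open>Q\<close>.
  The degree bound \<open>V\<close> allows \<open>G\<close> to be a finite sum over scales.\<close>

definition superadditive_cost :: "nat \<Rightarrow> (('n::finite \<Rightarrow> nat) \<Rightarrow> real) \<Rightarrow> (('n \<Rightarrow> nat) \<Rightarrow> real) \<Rightarrow> bool" where
  "superadditive_cost V \<gamma> G \<longleftrightarrow> (\<forall>Q (P :: 'n \<Rightarrow> nat) s. 2 \<le> mdeg P \<longrightarrow> 2 \<le> mdeg Q \<longrightarrow> mdeg Q \<le> V \<longrightarrow>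
     s \<in> splits (slots P) Q \<longrightarrow> (\<forall>t\<in>slots P. s t \<noteq> mzero) \<longrightarrow> \<gamma> Q + (\<Sum>t\<in>slots P. G (s t)) \<le> G Q)"

text \<open>Named so that \<open>r\<close> and \<open>x\<close> are fixed before \<open>V\<close>,
  \<open>G\<close> and \<open>\<gamma>\<close>: different degree bounds use different costs but must
  share these constants.\<close>

definition cost_majorant :: "(('n::finite \<Rightarrow> nat) \<Rightarrow> real) \<Rightarrow> real \<Rightarrow> real \<Rightarrow> real \<Rightarrow> bool" where
  "cost_majorant a K r x \<longleftrightarrow> (\<forall>V (\<Phi> :: 'n fmap) G \<gamma>. \<Phi> mzero = 0 \<longrightarrow> (\<forall>j. norm (\<Phi> (munit j)) \<le> K) \<longrightarrow> (\<forall>Q. G Q \<ge> 0) \<longrightarrow>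
    (\<forall>Q. 2 \<le> mdeg Q \<longrightarrow> mdeg Q \<le> V \<longrightarrow> norm (\<Phi> Q) \<le> exp (\<gamma> Q) * compose_norms a (\<lambda>R. norm (\<Phi> R)) Q) \<longrightarrow>
    superadditive_cost V \<gamma> G \<longrightarrow>
    (\<forall>Q. mdeg Q \<le> V \<longrightarrow> norm (\<Phi> Q) \<le> x / r ^ mdeg Q * exp (G Q)))"

text \<open>Each coefficient gets the weight \<open>exp (- G Q)\<close>. By superadditivity
  \<open>exp (\<gamma> Q - G Q)\<close> is at most the product of the weights of the parts, so the
  weighted norms obey the recursion without divisors.\<close>

lemma majorant_with_cost:
  fixes a :: "('n::finite \<Rightarrow> nat) \<Rightarrow> real"
  assumes a: "\<And>P. a P \<ge> 0" and r0: "r0 > 0" and sm: "(\<lambda>P. a P * r0 ^ mdeg P) summable_on UNIV" and K: "K > 0"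
  shows "\<exists>r>0. \<exists>x>0. cost_majorant a K r x"
proof -
  obtain r x where r: "r > 0" "x > 0" and maj: "\<forall>V v. (\<forall>Q. v Q \<ge> 0) \<longrightarrow> v mzero = 0 \<longrightarrow> (\<forall>j. v (munit j) \<le> K) \<longrightarrow>
    (\<forall>Q. 2 \<le> mdeg Q \<longrightarrow> mdeg Q \<le> V \<longrightarrow> v Q \<le> compose_norms a v Q) \<longrightarrow>
    (\<forall>Q. mdeg Q \<le> V \<longrightarrow> v Q \<le> x / r ^ mdeg Q)"
    using majorant_recursion[OF a r0 sm K] by (elim exE conjE)
  show ?thesis
  proof (rule exI[of _ r], rule conjI[OF r(1)], rule exI[of _ x], rule conjI[OF r(2)],
      unfold cost_majorant_def, intro allI impI)
    fix V :: nat and \<Phi> :: "'n fmap" and G \<gamma> :: "('n \<Rightarrow> nat) \<Rightarrow> real" and Q :: "'n \<Rightarrow> nat"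
    assume z: "\<Phi> mzero = 0" and 1: "\<forall>j. norm (\<Phi> (munit j)) \<le> K" and G: "\<forall>Q. G Q \<ge> 0"
      and rec: "\<forall>Q. 2 \<le> mdeg Q \<longrightarrow> mdeg Q \<le> V \<longrightarrow> norm (\<Phi> Q) \<le> exp (\<gamma> Q) * compose_norms a (\<lambda>R. norm (\<Phi> R)) Q"
      and cost: "superadditive_cost V \<gamma> G"
      and Q: "mdeg Q \<le> V"
    define v where "v = (\<lambda>Q. norm (\<Phi> Q) * exp (- G Q))"
    have "v Q \<le> x / r ^ mdeg Q"
    proof (rule maj[rule_format, of v V Q, OF _ _ _ _ Q])
      show "v Q \<ge> 0" for Q by (simp add: v_def)
      show "v mzero = 0" by (simp add: v_def z)
      show "v (munit j) \<le> K" for j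
      proof -
        have "v (munit j) \<le> norm (\<Phi> (munit j)) * 1" unfolding v_def using G by (intro mult_left_mono) auto
        then show ?thesis using 1[rule_format, of j] by simp
      qed
      fix Q :: "'n \<Rightarrow> nat" assume Q: "2 \<le> mdeg Q" "mdeg Q \<le> V"
      have "v Q \<le> exp (\<gamma> Q) * compose_norms a (\<lambda>R. norm (\<Phi> R)) Q * exp (- G Q)"
        unfolding v_def by (intro mult_right_mono rec[rule_format] Q) simp
      also have "\<dots> = (\<Sum>P | 2 \<le> mdeg P \<and> mdeg P \<le> mdeg Q. a P * (\<Sum>s\<in>splits (slots P) Q. exp (\<gamma> Q - G Q) * (\<Prod>t\<in>slots P. norm (\<Phi> (s t)))))"
        by (simp add: compose_norms_def sum_distrib_left sum_distrib_right exp_diff exp_minus field_simps)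
      also have "\<dots> \<le> compose_norms a v Q"
        unfolding compose_norms_def
      proof (intro sum_mono mult_left_mono a)
        fix P :: "'n \<Rightarrow> nat" and s assume P: "P \<in> {P. 2 \<le> mdeg P \<and> mdeg P \<le> mdeg Q}" and s: "s \<in> splits (slots P) Q"
        have eq: "(\<Prod>t\<in>slots P. v (s t)) = exp (- (\<Sum>t\<in>slots P. G (s t))) * (\<Prod>t\<in>slots P. norm (\<Phi> (s t)))"
          by (simp add: v_def prod.distrib exp_sum[symmetric] sum_negf mult.commute)
        show "exp (\<gamma> Q - G Q) * (\<Prod>t\<in>slots P. norm (\<Phi> (s t))) \<le> (\<Prod>t\<in>slots P. v (s t))"
        proof (cases "\<exists>t\<in>slots P. s t = mzero")
          case True
          then obtain t where "t \<in> slots P" "s t = mzero" by blast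
          then have "(\<Prod>t\<in>slots P. norm (\<Phi> (s t))) = 0" using z by (intro prod_zero bexI[of _ t]) auto
          then show ?thesis unfolding eq by (simp only: mult_zero_right order_refl)
        next
          case False
          then have "\<gamma> Q + (\<Sum>t\<in>slots P. G (s t)) \<le> G Q" using P Q s by (intro cost[unfolded superadditive_cost_def, rule_format]) auto
          then show ?thesis unfolding eq by (intro mult_right_mono prod_nonneg) auto
        qed
      qed
      finally show "v Q \<le> compose_norms a v Q" .
    qed
    then have "norm (\<Phi> Q) * exp (- G Q) * exp (G Q) \<le> x / r ^ mdeg Q * exp (G Q)"
      unfolding v_def by (intro mult_right_mono) auto
    then show "norm (\<Phi> Q) \<le> x / r ^ mdeg Q * exp (G Q)" by (simp add: mult.assoc exp_minus)
  qed
qed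

section \<open>Counting small divisors\<close>

text \<open>All that the counting uses of the arithmetic: indices with a small divisor are far from
  0, and far from each other when comparable.\<close>

definition sparse_gap :: "nat \<Rightarrow> ('n::finite \<Rightarrow> nat) set \<Rightarrow> bool" where
  "sparse_gap m S \<longleftrightarrow> m \<ge> 1 \<and> (\<forall>Q\<in>S. m \<le> mdeg Q) \<and> (\<forall>Q\<in>S. \<forall>R\<in>S. Q \<le> R \<longrightarrow> Q \<noteq> R \<longrightarrow> mdeg Q + m \<le> mdeg R)"

text \<open>The shape of Brjuno's counting bound. It is at least 1 as soon as a small divisor is
  possible, and its \<open>- 1\<close> frees a unit whenever two large parts are joined.\<close>

definition count_bound :: "nat \<Rightarrow> nat \<Rightarrow> real" where
  "count_bound m x = (if x < m then 0 else 2 * real x / real m - 1)"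

definition count_bound_below :: "nat \<Rightarrow> nat \<Rightarrow> real" where
  "count_bound_below m x = max 0 (2 * real x / real m - 2)"

definition above :: "nat \<Rightarrow> ('n::finite \<Rightarrow> nat) set \<Rightarrow> ('n \<Rightarrow> nat) \<Rightarrow> ('n \<Rightarrow> nat) set" where
  "above m S Q = {R \<in> S. Q \<le> R \<and> Q \<noteq> R \<and> mdeg R < mdeg Q + m}"

text \<open>The bound 2 |Q| / m - 1 on the number of divisors met in decomposing Q improves to
  2 |R| / m - 2 when Q lies shortly below some R in S, because Q is then followed by a gap free of
  elements of S. Taking the minimum of all these bounds is what makes the cost superadditive.\<close>

definition gap_cost :: "nat \<Rightarrow> ('n::finite \<Rightarrow> nat) set \<Rightarrow> ('n \<Rightarrow> nat) \<Rightarrow> real" where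
  "gap_cost m S Q = Min (insert (count_bound m (mdeg Q)) ((\<lambda>R. count_bound_below m (mdeg R)) ` above m S Q))"

lemma finite_above: "finite (above m S Q)"
  by (rule finite_subset[OF _ finite_mdeg_le[of "mdeg Q + m"]]) (auto simp: above_def)

lemma gap_cost_le: "gap_cost m S Q \<le> count_bound m (mdeg Q)"
  unfolding gap_cost_def by (rule Min_le) (auto simp: finite_above)

lemma gap_cost_le_below: "R \<in> above m S Q \<Longrightarrow> gap_cost m S Q \<le> count_bound_below m (mdeg R)"
  unfolding gap_cost_def by (rule Min_le) (auto simp: finite_above)

lemma gap_cost_greatest:
  assumes "y \<le> count_bound m (mdeg Q)" "\<And>R. R \<in> above m S Q \<Longrightarrow> y \<le> count_bound_below m (mdeg R)"
  shows "y \<le> gap_cost m S Q"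
  unfolding gap_cost_def using assms by (subst Min_ge_iff) (auto simp: finite_above)

lemma count_bound_nonneg: "m \<ge> 1 \<Longrightarrow> count_bound m x \<ge> 0"
  by (auto simp: count_bound_def field_simps)

lemma count_bound_le: "m \<ge> 1 \<Longrightarrow> count_bound m x \<le> 2 * real x / real m"
  by (auto simp: count_bound_def)

lemma count_bound_mono:
  assumes "m \<ge> 1" "x \<le> y" shows "count_bound m x \<le> count_bound m y"
proof (cases "x < m")
  case True then show ?thesis using count_bound_nonneg[OF assms(1)] by (simp add: count_bound_def)
next
  case False then show ?thesis using assms by (simp add: count_bound_def divide_right_mono)
qed

lemma gap_cost_nonneg: "m \<ge> 1 \<Longrightarrow> gap_cost m S Q \<ge> 0"
  by (rule gap_cost_greatest) (auto simp: count_bound_nonneg count_bound_below_def)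

text \<open>Parts of degree below \<open>m\<close> cost nothing, so the number of large parts
  decides. With two or more, their constants add up to at most \<open>- 2\<close>, one unit below
  the bound for \<open>Q\<close>. A single one is either at least \<open>m\<close> below
  \<open>Q\<close>, which saves two units, or close to it; in that case \<open>Q\<close>, if it
  belongs to \<open>S\<close>, lies in the \<open>above\<close> set of this part and lowers its cost
  by the unit required.\<close>

lemma gap_cost_superadditive:
  fixes Q :: "'n::finite \<Rightarrow> nat"
  assumes S: "sparse_gap m S" and s: "s \<in> splits T Q" and T: "finite T" "card T \<ge> 2"
    and nz: "\<And>t. t \<in> T \<Longrightarrow> s t \<noteq> mzero"
  shows "(if Q \<in> S then 1 else 0) + (\<Sum>t\<in>T. gap_cost m S (s t)) \<le> gap_cost m S Q"
proof -
  define I where "I = (if Q \<in> S then 1 else 0 :: real)"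
  have m: "m \<ge> 1" and S1: "\<And>Q. Q \<in> S \<Longrightarrow> m \<le> mdeg Q"
    and S2: "\<And>Q R. Q \<in> S \<Longrightarrow> R \<in> S \<Longrightarrow> Q \<le> R \<Longrightarrow> Q \<noteq> R \<Longrightarrow> mdeg Q + m \<le> mdeg R"
    using S by (auto simp: sparse_gap_def)
  have m': "real m > 0" using m by simp
  define Big where "Big = {t \<in> T. m \<le> mdeg (s t)}"
  have Big: "finite Big" "Big \<subseteq> T" using T by (auto simp: Big_def)
  have sumBig: "(\<Sum>t\<in>T. gap_cost m S (s t)) = (\<Sum>t\<in>Big. gap_cost m S (s t))"
  proof (rule sum.mono_neutral_right)
    show "\<forall>t\<in>T - Big. gap_cost m S (s t) = 0"
    proof
      fix t assume "t \<in> T - Big"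
      then have "count_bound m (mdeg (s t)) = 0" by (auto simp: Big_def count_bound_def)
      then show "gap_cost m S (s t) = 0" using gap_cost_le[of m S "s t"] gap_cost_nonneg[OF m, of S "s t"] by simp
    qed
  qed (use T Big in auto)
  have degBig: "(\<Sum>t\<in>Big. mdeg (s t)) \<le> mdeg Q"
    using splits_mdeg[OF s] sum_mono2[OF T(1) Big(2), of "\<lambda>t. mdeg (s t)"] by simp
  have neQ: "s t \<noteq> Q" "s t \<le> Q" if "t \<in> T" for t
    using splits_mdeg_less[OF s T nz that] splits_le[OF s that] by auto
  consider "Big = {}" | t0 where "Big = {t0}" | "card Big \<ge> 2"
  proof -
    have "card Big = 0 \<or> card Big = 1 \<or> card Big \<ge> 2" by linarith
    then show thesis using that Big(1) by (auto simp: card_1_singleton_iff)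
  qed
  note cs = this
  have two: "(\<Sum>t\<in>Big. gap_cost m S (s t)) \<le> 2 * real (mdeg Q) / real m - 2" if "card Big \<ge> 2"
  proof -
    have "(\<Sum>t\<in>Big. gap_cost m S (s t)) \<le> (\<Sum>t\<in>Big. 2 * real (mdeg (s t)) / real m - 1)"
    proof (rule sum_mono)
      fix t assume "t \<in> Big"
      then show "gap_cost m S (s t) \<le> 2 * real (mdeg (s t)) / real m - 1"
        using gap_cost_le[of m S "s t"] by (simp add: Big_def count_bound_def not_less[symmetric])
    qed
    also have "\<dots> = 2 * real (\<Sum>t\<in>Big. mdeg (s t)) / real m - real (card Big)"
      by (simp add: sum_subtractf sum_divide_distrib sum_distrib_left)
    also have "\<dots> \<le> 2 * real (mdeg Q) / real m - 2"
      using that m' by (intro diff_mono divide_right_mono mult_left_mono of_nat_mono degBig) auto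
    finally show ?thesis .
  qed
  have one: "gap_cost m S (s t0) \<le> 2 * real (mdeg R) / real m - 3"
    if "t0 \<in> Big" "mdeg (s t0) + m \<le> mdeg R" for t0 R
  proof -
    have "gap_cost m S (s t0) \<le> 2 * real (mdeg (s t0)) / real m - 1"
      using gap_cost_le[of m S "s t0"] that(1) by (simp add: Big_def count_bound_def not_less[symmetric])
    also have "\<dots> \<le> 2 * real (mdeg R - m) / real m - 1"
      using that(2) m' by (intro diff_mono divide_right_mono) auto
    also have "\<dots> = 2 * real (mdeg R) / real m - 3"
      using that(2) m' by (simp add: of_nat_diff field_simps)
    finally show ?thesis .
  qed
  have Sbig: "2 * real (mdeg Q) / real m \<ge> 2" "count_bound m (mdeg Q) = 2 * real (mdeg Q) / real m - 1" if "m \<le> mdeg Q"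
    using that m' by (auto simp: count_bound_def field_simps)
  have "I + (\<Sum>t\<in>Big. gap_cost m S (s t)) \<le> gap_cost m S Q"
  proof (rule gap_cost_greatest)
    show "I + (\<Sum>t\<in>Big. gap_cost m S (s t)) \<le> count_bound m (mdeg Q)"
      using cs
    proof cases
      case 1
      then show ?thesis using S1[of Q] Sbig count_bound_nonneg[OF m, of "mdeg Q"] by (auto simp: I_def)
    next
      case (2 t0)
      then have t0: "t0 \<in> T" "t0 \<in> Big" using Big by auto
      have le: "gap_cost m S (s t0) \<le> count_bound m (mdeg Q)"
        using gap_cost_le[of m S "s t0"] count_bound_mono[OF m mdeg_mono[OF neQ(2)[OF t0(1)]]] by linarith
      show ?thesis
      proof (cases "Q \<in> S")
        case False then show ?thesis using 2 le by (simp add: I_def)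
      next
        case True
        note Q = Sbig[OF S1[OF True]]
        show ?thesis
        proof (cases "mdeg Q < mdeg (s t0) + m")
          case True
          then have "gap_cost m S (s t0) \<le> count_bound_below m (mdeg Q)"
            using \<open>Q \<in> S\<close> neQ[OF t0(1)] by (intro gap_cost_le_below) (auto simp: above_def)
          then show ?thesis using 2 Q \<open>Q \<in> S\<close> by (simp add: I_def count_bound_below_def)
        next
          case False
          then show ?thesis using 2 one[OF t0(2), of Q] Q \<open>Q \<in> S\<close> by (simp add: I_def)
        qed
      qed
    next
      case 3
      then obtain t where "t \<in> Big" by fastforce
      then have "m \<le> mdeg Q" using mdeg_mono[OF neQ(2)[of t]] by (auto simp: Big_def)
      from Sbig[OF this] show ?thesis using two[OF 3] by (simp add: I_def)
    qed
  next
    \<comment> \<open>Two comparable elements of \<open>S\<close> cannot be this close, so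
      \<open>Q\<close> is outside \<open>S\<close> and adds nothing itself.\<close>
    fix R assume R: "R \<in> above m S Q"
    then have I: "I = 0" using S2[of Q R] by (auto simp: above_def I_def)
    have QR: "mdeg Q \<le> mdeg R" using R by (auto simp: above_def intro: mdeg_mono)
    show "I + (\<Sum>t\<in>Big. gap_cost m S (s t)) \<le> count_bound_below m (mdeg R)"
      using cs
    proof cases
      case 1
      then show ?thesis by (simp add: I count_bound_below_def)
    next
      case (2 t0)
      then have t0: "t0 \<in> T" "t0 \<in> Big" using Big by auto
      show ?thesis
      proof (cases "mdeg R < mdeg (s t0) + m")
        case True
        \<comment> \<open>The part lies below \<open>Q\<close>, hence below \<open>R\<close>, and is
          still within \<open>m\<close> of it: the bound imposed by \<open>R\<close> is
          inherited.\<close>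
        have "R \<noteq> s t0" using neQ[OF t0(1)] R by (auto simp: above_def)
        moreover have "s t0 \<le> R" using neQ(2)[OF t0(1)] R by (auto simp: above_def)
        ultimately have "R \<in> above m S (s t0)" using R True by (auto simp: above_def)
        then show ?thesis using 2 gap_cost_le_below[of R m S "s t0"] by (simp add: I)
      next
        case False
        then show ?thesis using 2 one[OF t0(2), of R] by (simp add: I count_bound_below_def)
      qed
    next
      case 3
      have "2 * real (mdeg Q) / real m \<le> 2 * real (mdeg R) / real m"
        using QR m' by (intro divide_right_mono) auto
      then show ?thesis using two[OF 3] by (simp add: I count_bound_below_def)
    qed
  qed
  then show ?thesis by (simp add: sumBig I_def)
qed

section \<open>Summation over scales and components\<close>

definition total_cost :: "nat \<Rightarrow> (nat \<Rightarrow> real) \<Rightarrow> (nat \<Rightarrow> nat) \<Rightarrow> (nat \<Rightarrow> 'n \<Rightarrow> ('n::finite \<Rightarrow> nat) set) \<Rightarrow> ('n \<Rightarrow> nat) \<Rightarrow> real" where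
  "total_cost V d m S Q = (\<Sum>\<nu><V. d \<nu> * (\<Sum>j\<in>UNIV. gap_cost (m \<nu>) (S \<nu> j) Q))"

lemma total_cost_nonneg:
  assumes "\<And>\<nu>. d \<nu> \<ge> 0" "\<And>\<nu>. m \<nu> \<ge> 1" shows "total_cost V d m S Q \<ge> 0"
  unfolding total_cost_def by (intro sum_nonneg mult_nonneg_nonneg assms gap_cost_nonneg)

lemma total_cost_le:
  fixes Q :: "'n::finite \<Rightarrow> nat"
  assumes "\<And>\<nu>. d \<nu> \<ge> 0" "\<And>\<nu>. m \<nu> \<ge> 1"
  shows "total_cost V d m S Q \<le> 2 * real CARD('n) * real (mdeg Q) * (\<Sum>\<nu><V. d \<nu> / real (m \<nu>))"
proof -
  have "total_cost V d m S Q \<le> (\<Sum>\<nu><V. d \<nu> * (\<Sum>j\<in>(UNIV::'n set). 2 * real (mdeg Q) / real (m \<nu>)))"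
    unfolding total_cost_def
    by (intro sum_mono mult_left_mono assms order_trans[OF gap_cost_le count_bound_le])
  also have "\<dots> = 2 * real CARD('n) * real (mdeg Q) * (\<Sum>\<nu><V. d \<nu> / real (m \<nu>))"
    by (simp add: sum_distrib_left mult_ac)
  finally show ?thesis .
qed

lemma total_cost_superadditive:
  assumes d: "\<And>\<nu>. d \<nu> \<ge> 0" and S: "\<And>\<nu> j. sparse_gap (m \<nu>) (S \<nu> j)"
    and s: "s \<in> splits T Q" and T: "finite T" "card T \<ge> 2" and nz: "\<And>t. t \<in> T \<Longrightarrow> s t \<noteq> mzero"
  shows "(\<Sum>\<nu><V. d \<nu> * (\<Sum>j\<in>UNIV. if Q \<in> S \<nu> j then 1 else 0)) + (\<Sum>t\<in>T. total_cost V d m S (s t)) \<le> total_cost V d m S Q"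
proof -
  have "(\<Sum>t\<in>T. total_cost V d m S (s t)) = (\<Sum>\<nu><V. d \<nu> * (\<Sum>j\<in>UNIV. \<Sum>t\<in>T. gap_cost (m \<nu>) (S \<nu> j) (s t)))"
    unfolding total_cost_def
    by (subst sum.swap) (simp add: sum_distrib_left[symmetric] sum.swap[of _ T])
  then have "(\<Sum>\<nu><V. d \<nu> * (\<Sum>j\<in>UNIV. if Q \<in> S \<nu> j then 1 else 0)) + (\<Sum>t\<in>T. total_cost V d m S (s t))
     = (\<Sum>\<nu><V. d \<nu> * (\<Sum>j\<in>UNIV. (if Q \<in> S \<nu> j then 1 else 0) + (\<Sum>t\<in>T. gap_cost (m \<nu>) (S \<nu> j) (s t))))"
    by (simp add: sum.distrib algebra_simps)
  also have "\<dots> \<le> total_cost V d m S Q"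
    unfolding total_cost_def
    by (intro sum_mono mult_left_mono d gap_cost_superadditive S s T nz)
  finally show ?thesis .
qed

section \<open>Convergent power series\<close>

lemma sasy_diff_bigO:
  assumes "sasy N f a" "sasy N g a" shows "(\<lambda>z. f z - g z) \<in> bigO (Suc N)"
  using bigO_diff[OF assms[unfolded sasy_def]] by simp

definition conv :: "real \<Rightarrow> 'n::finite fmap \<Rightarrow> bool" where
  "conv r c \<longleftrightarrow> r > 0 \<and> (\<lambda>Q. norm (c Q) * r ^ mdeg Q) summable_on UNIV"

definition psum :: "'n::finite fmap \<Rightarrow> complex^'n \<Rightarrow> complex^'n" where
  "psum c z = (\<Sum>\<^sub>\<infinity>Q. monom z Q *s c Q)"

text \<open>Every finite family of indices lies in a box, over which the sum factors into truncated
  geometric series.\<close>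

lemma summable_on_power_mdeg:
  fixes x :: real
  assumes "0 \<le> x" "x < 1"
  shows "(\<lambda>Q :: 'n::finite \<Rightarrow> nat. x ^ mdeg Q) summable_on UNIV"
proof (rule nonneg_bdd_above_summable_on)
  show "bdd_above (sum (\<lambda>Q :: 'n \<Rightarrow> nat. x ^ mdeg Q) ` {F. F \<subseteq> UNIV \<and> finite F})"
  proof (rule bdd_aboveI2)
    fix F :: "('n \<Rightarrow> nat) set" assume "F \<in> {F. F \<subseteq> UNIV \<and> finite F}"
    then have F: "finite F" by simp
    define N where "N = Max (mdeg ` F)"
    have "F \<subseteq> PiE UNIV (\<lambda>_. {..N})"
      using F by (auto simp: N_def intro: order_trans[OF le_mdeg Max_ge])
    then have "(\<Sum>Q\<in>F. x ^ mdeg Q) \<le> (\<Sum>Q\<in>PiE (UNIV::'n set) (\<lambda>_. {..N}). x ^ mdeg Q)"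
      using assms by (intro sum_mono2) (auto simp: finite_PiE)
    also have "\<dots> = (\<Prod>i\<in>(UNIV::'n set). \<Sum>k\<le>N. x ^ k)"
      by (subst prod_sum_PiE) (auto simp: mdeg_def power_sum)
    also have "\<dots> \<le> (\<Prod>i\<in>(UNIV::'n set). 1 / (1 - x))"
    proof (rule prod_mono, intro conjI)
      have "(\<Sum>k\<le>N. x ^ k) = (1 - x ^ Suc N) / (1 - x)"
        using assms sum_gp0[of x N] by simp
      also have "\<dots> \<le> 1 / (1 - x)" using assms by (intro divide_right_mono) auto
      finally show "(\<Sum>k\<le>N. x ^ k) \<le> 1 / (1 - x)" .
    qed (use assms in \<open>auto intro!: sum_nonneg\<close>)
    finally show "(\<Sum>Q\<in>F. x ^ mdeg Q) \<le> (\<Prod>i\<in>(UNIV::'n set). 1 / (1 - x))" .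
  qed
qed (use assms in auto)

lemma convI:
  assumes "\<And>Q. norm (c Q) \<le> M * b ^ mdeg Q" "b > 0"
  shows "conv (1 / (2 * b)) c"
  unfolding conv_def
proof
  show "(\<lambda>Q. norm (c Q) * (1 / (2 * b)) ^ mdeg Q) summable_on UNIV"
  proof (rule summable_on_comparison_test)
    show "(\<lambda>Q. M * (1 / 2 :: real) ^ mdeg Q) summable_on UNIV"
      by (intro summable_on_cmult_right summable_on_power_mdeg) auto
    show "norm (c Q) * (1 / (2 * b)) ^ mdeg Q \<le> M * (1 / 2) ^ mdeg Q" for Q
    proof -
      have "norm (c Q) * (1 / (2 * b)) ^ mdeg Q \<le> M * b ^ mdeg Q * (1 / (2 * b)) ^ mdeg Q"
        using assms by (intro mult_right_mono) auto
      also have "\<dots> = M * (1 / 2) ^ mdeg Q" using assms(2) by (simp add: power_divide power_mult_distrib)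
      finally show ?thesis .
    qed
  qed (use assms in auto)
qed (use assms in simp)

lemma convD_has_sum:
  assumes "conv r c" "\<And>i. cmod (z $ i) \<le> r"
  shows "((\<lambda>Q. monom z Q *s c Q) has_sum psum c z) UNIV"
proof -
  have "(\<lambda>Q. norm (monom z Q *s c Q)) summable_on UNIV"
  proof (rule summable_on_comparison_test)
    show "(\<lambda>Q. norm (c Q) * r ^ mdeg Q) summable_on UNIV" using assms(1) by (simp add: conv_def)
    show "norm (monom z Q *s c Q) \<le> norm (c Q) * r ^ mdeg Q" for Q
      unfolding norm_vector_smult by (subst mult.commute) (intro mult_left_mono norm_monom_le assms(2) norm_ge_zero)
  qed auto
  then have "(\<lambda>Q. monom z Q *s c Q) summable_on UNIV" by (rule abs_summable_summable)
  then show ?thesis unfolding psum_def by (rule has_sum_infsum)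
qed

lemma psum_unique: "((\<lambda>Q. monom z Q *s c Q) has_sum x) UNIV \<Longrightarrow> psum c z = x"
  unfolding psum_def by (rule infsumI)

lemma has_sum_nth:
  fixes f :: "'a \<Rightarrow> complex^'n::finite"
  assumes "(f has_sum x) A" shows "((\<lambda>y. f y $ i) has_sum x $ i) A"
  by (rule has_sum_bounded_linear[where h = "\<lambda>v. v $ i", OF bounded_linear_vec_nth assms])

lemma summable_on_sum:
  fixes f :: "'b \<Rightarrow> 'a \<Rightarrow> real"
  assumes "finite I" "\<And>i. i \<in> I \<Longrightarrow> f i summable_on A"
  shows "(\<lambda>x. \<Sum>i\<in>I. f i x) summable_on A"
  using assms by (induction I) (auto intro!: summable_on_add)

lemma eventually_nhds_0_norm: "\<epsilon> > 0 \<Longrightarrow> (\<And>z. norm z < \<epsilon> \<Longrightarrow> P z) \<Longrightarrow> \<forall>\<^sub>F z in nhds 0. P z"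
  unfolding eventually_nhds_metric by (auto simp: dist_norm)

lemma conv_has_expansion:
  assumes "conv r c" shows "has_expansion (psum c) c"
  unfolding has_expansion_def
proof (rule eventually_nhds_0_norm)
  show "r > 0" using assms by (simp add: conv_def)
  show "((\<lambda>Q. monom z Q *s c Q) has_sum psum c z) UNIV" if "norm z < r" for z
    by (rule convD_has_sum[OF assms]) (use that in \<open>auto intro: order_trans[OF Finite_Cartesian_Product.norm_nth_le]\<close>)
qed

text \<open>Unconditional convergence at one point whose coordinates all have modulus
  \<open>r\<close> makes every scalar component absolutely summable there, and hence the norms of
  the coefficients with weights \<open>r ^ mdeg Q\<close>.\<close>

lemma has_expansion_conv:
  fixes c :: "'n::finite fmap"
  assumes "has_expansion g c"
  obtains r where "conv r c" "\<forall>\<^sub>F z in nhds 0. g z = psum c z"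
proof -
  obtain d where d: "d > 0" "\<And>z. norm z < d \<Longrightarrow> ((\<lambda>Q. monom z Q *s c Q) has_sum g z) UNIV"
    using assms unfolding has_expansion_def eventually_nhds_metric by auto
  \<comment> \<open>The point with all coordinates \<open>r\<close> then has norm at most
    \<open>d / 2\<close> and stays inside the ball of convergence.\<close>
  define r where "r = d / (2 * real CARD('n))"
  have r: "r > 0" using d by (simp add: r_def)
  define z :: "complex^'n" where "z = (\<chi> i. of_real r)"
  have "norm z \<le> (\<Sum>i\<in>UNIV. norm (z $ i))" by (simp add: norm_vec_def L2_set_le_sum)
  also have "\<dots> = d / 2" using r by (simp add: z_def) (simp add: r_def)
  also have "\<dots> < d" using d by simp
  finally have hs: "((\<lambda>Q. monom z Q *s c Q) has_sum g z) UNIV" by (rule d(2))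
  have mz: "cmod (monom z Q) = r ^ mdeg Q" for Q
    using r by (simp add: z_def monom_def mdeg_def power_sum[symmetric] norm_power)
  have "(\<lambda>Q. \<Sum>i\<in>UNIV. norm ((monom z Q *s c Q) $ i)) summable_on UNIV"
  proof (rule summable_on_sum[OF finite_class.finite_UNIV])
    fix i
    have "(\<lambda>Q. (monom z Q *s c Q) $ i) summable_on UNIV"
      using has_sum_nth[OF hs, of i] by (auto simp: summable_on_def)
    then show "(\<lambda>Q. norm ((monom z Q *s c Q) $ i)) summable_on UNIV"
      by (simp only: summable_on_iff_abs_summable_on_complex)
  qed
  then have "(\<lambda>Q. norm (c Q) * r ^ mdeg Q) summable_on UNIV"
  proof (rule summable_on_comparison_test)
    show "norm (c Q) * r ^ mdeg Q \<le> (\<Sum>i\<in>UNIV. norm ((monom z Q *s c Q) $ i))" for Q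
    proof -
      have "norm (c Q) * r ^ mdeg Q = norm (monom z Q *s c Q)" by (simp add: norm_vector_smult mz)
      also have "\<dots> \<le> (\<Sum>i\<in>UNIV. norm ((monom z Q *s c Q) $ i))" unfolding norm_vec_def by (intro L2_set_le_sum) auto
      finally show ?thesis .
    qed
  qed (use r in auto)
  then have "conv r c" using r by (simp add: conv_def)
  moreover have "\<forall>\<^sub>F z in nhds 0. g z = psum c z"
    using assms unfolding has_expansion_def by eventually_elim (metis psum_unique)
  ultimately show ?thesis using that by blast
qed

lemma conv_asy:
  fixes c :: "'n::finite fmap"
  assumes "conv r c" shows "asy N (psum c) c"
  unfolding asy_def sasy_def
proof (intro allI bigOI eventually_nhds_0_norm)
  show r: "r > 0" using assms by (simp add: conv_def)
  fix i and z :: "complex^'n" assume z: "norm z < r"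
  define L where "L = {Q :: 'n \<Rightarrow> nat. mdeg Q \<le> N}"
  define A where "A = infsum (\<lambda>Q. norm (c Q) * r ^ mdeg Q) UNIV"
  define \<kappa> where "\<kappa> = (norm z / r) ^ Suc N"
  have \<kappa>: "\<kappa> \<ge> 0" using r by (simp add: \<kappa>_def)
  have sm: "(\<lambda>Q. norm (c Q) * r ^ mdeg Q) summable_on UNIV" using assms by (simp add: conv_def)
  have "cmod (z $ j) \<le> r" for j using z by (meson Finite_Cartesian_Product.norm_nth_le less_imp_le order_trans)
  then have "((\<lambda>Q. monom z Q *s c Q) has_sum psum c z) UNIV" by (rule convD_has_sum[OF assms])
  then have "((\<lambda>Q. (monom z Q *s c Q) $ i) has_sum psum c z $ i) UNIV" by (rule has_sum_nth)
  moreover have "((\<lambda>Q. (monom z Q *s c Q) $ i) has_sum tpoly N (\<lambda>Q. c Q $ i) z) L"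
    by (rule has_sum_finiteI) (auto simp: L_def tpoly_def mult.commute)
  ultimately have hs: "((\<lambda>Q. (monom z Q *s c Q) $ i) has_sum (psum c z $ i - tpoly N (\<lambda>Q. c Q $ i) z)) (UNIV - L)"
    by (rule has_sum_Diff) simp
  have bound: "norm ((monom z Q *s c Q) $ i) \<le> (norm z / r) ^ Suc N * (norm (c Q) * r ^ mdeg Q)" if "Q \<in> UNIV - L" for Q
  proof -
    have "norm ((monom z Q *s c Q) $ i) \<le> norm z ^ mdeg Q * norm (c Q)"
      by (simp add: norm_mult mult_mono norm_monom_le_norm Finite_Cartesian_Product.norm_nth_le)
    also have "\<dots> = (norm z / r) ^ mdeg Q * (norm (c Q) * r ^ mdeg Q)"
      using r by (simp add: power_divide)
    also have "\<dots> \<le> (norm z / r) ^ Suc N * (norm (c Q) * r ^ mdeg Q)"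
      using that z r by (intro mult_right_mono power_decreasing) (auto simp: L_def)
    finally show ?thesis .
  qed
  have sm2: "(\<lambda>Q. \<kappa> * (norm (c Q) * r ^ mdeg Q)) summable_on (UNIV - L)"
    by (intro summable_on_cmult_right summable_on_subset_banach[OF sm]) auto
  have abs: "(\<lambda>Q. norm ((monom z Q *s c Q) $ i)) summable_on (UNIV - L)"
    by (rule summable_on_comparison_test[OF sm2]) (use bound[folded \<kappa>_def] in auto)
  have "norm (psum c z $ i - tpoly N (\<lambda>Q. c Q $ i) z) \<le> infsum (\<lambda>Q. norm ((monom z Q *s c Q) $ i)) (UNIV - L)"
    by (rule norm_has_sum_bound[OF has_sum_infsum[OF abs] hs])
  also have "\<dots> \<le> infsum (\<lambda>Q. \<kappa> * (norm (c Q) * r ^ mdeg Q)) (UNIV - L)"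
    by (rule infsum_mono[OF abs sm2 bound[folded \<kappa>_def]])
  also have "\<dots> \<le> infsum (\<lambda>Q. \<kappa> * (norm (c Q) * r ^ mdeg Q)) UNIV"
    by (rule infsum_mono2) (use sm2 sm r \<kappa> in \<open>auto intro!: summable_on_cmult_right\<close>)
  also have "\<dots> = \<kappa> * A" unfolding A_def by (rule infsum_cmult_right) (use sm in simp)
  also have "\<dots> = (A / r ^ Suc N) * norm z ^ Suc N" by (simp add: \<kappa>_def power_divide)
  finally show "cmod (psum c z $ i - tpoly N (\<lambda>Q. c Q $ i) z) \<le> (A / r ^ Suc N) * norm z ^ Suc N"
    unfolding A_def .
qed

section \<open>Identity of convergent compositions along complex lines\<close>

definition holo_curve :: "real \<Rightarrow> (complex \<Rightarrow> complex^'n::finite) \<Rightarrow> bool" where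
  "holo_curve R w \<longleftrightarrow> (\<forall>i. continuous_on (cball 0 R) (\<lambda>t. w t $ i) \<and> (\<lambda>t. w t $ i) holomorphic_on ball 0 R)"

text \<open>The M-test with the terms at radius \<open>r\<close> gives uniform convergence on the
  closed disc. The conclusion has the form of the hypothesis on \<open>w\<close>, so composites
  follow by a second application, and holomorphy in one variable is all that is needed.\<close>

lemma holo_curve_psum:
  fixes c :: "'n::finite fmap"
  assumes c: "conv r c" and w: "holo_curve R w" and le: "\<And>t i. t \<in> cball 0 R \<Longrightarrow> cmod (w t $ i) \<le> r"
  shows "holo_curve R (\<lambda>t. psum c (w t))"
  unfolding holo_curve_def
proof
  fix i
  have sm: "(\<lambda>Q. norm (c Q) * r ^ mdeg Q) summable_on UNIV" using c by (simp add: conv_def)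
  have hs: "((\<lambda>Q. monom (w t) Q * c Q $ i) has_sum (psum c (w t) $ i)) UNIV" if "t \<in> cball 0 R" for t
    using has_sum_nth[OF convD_has_sum[OF c, of "w t"], of i] le[OF that] by simp
  have bd: "norm (monom (w t) Q * c Q $ i) \<le> norm (c Q) * r ^ mdeg Q" if "t \<in> cball 0 R" for t Q
    unfolding norm_mult by (subst mult.commute, intro mult_mono norm_monom_le le that Finite_Cartesian_Product.norm_nth_le) auto
  have ul: "uniform_limit (cball 0 R) (\<lambda>X t. \<Sum>Q\<in>X. monom (w t) Q * c Q $ i) (\<lambda>t. psum c (w t) $ i) (finite_subsets_at_top UNIV)"
    by (rule Weierstrass_m_test_general'[OF _ _ sm]) (use hs bd in auto)
  have "\<forall>\<^sub>F X in finite_subsets_at_top UNIV. continuous_on (cball 0 R) (\<lambda>t. \<Sum>Q\<in>X. monom (w t) Q * c Q $ i)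
      \<and> (\<lambda>t. \<Sum>Q\<in>X. monom (w t) Q * c Q $ i) holomorphic_on ball 0 R"
    using w unfolding holo_curve_def monom_def
    by (intro always_eventually allI conjI continuous_on_sum continuous_on_mult continuous_on_prod
        continuous_on_power continuous_on_const holomorphic_intros) auto
  from holomorphic_uniform_limit[OF this ul]
  show "continuous_on (cball 0 R) (\<lambda>t. psum c (w t) $ i) \<and> (\<lambda>t. psum c (w t) $ i) holomorphic_on ball 0 R"
    by auto
qed

text \<open>If the restriction to the line through \<open>z\<close> were not constant, it would have
  a zero of finite order n at 0, against the bound by a multiple of |t|^(n+1). The disc of radius 2
  serves to have the parameter 1 in its interior.\<close>

lemma line_identity:
  fixes f :: "complex^'n::finite \<Rightarrow> complex"
  assumes hol: "(\<lambda>t. f (t *s z)) holomorphic_on ball 0 2" and f: "\<And>N. f \<in> bigO (Suc N)"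
  shows "f z = 0"
proof -
  define u where "u = (\<lambda>t. f (t *s z))"
  have bound: "\<exists>C. \<forall>\<^sub>F t in nhds 0. cmod (u t) \<le> C * cmod t ^ Suc N" for N
  proof -
    obtain C where C: "C > 0" "\<forall>\<^sub>F z in nhds 0. cmod (f z) \<le> C * norm z ^ Suc N" using bigOE[OF f] .
    have "filterlim (\<lambda>t. t *s z) (nhds 0) (nhds 0)"
    proof (rule Lim_null_comparison)
      show "\<forall>\<^sub>F t in nhds 0. norm (t *s z) \<le> cmod t * norm z" by (simp add: norm_vector_smult)
      have "((\<lambda>t::complex. cmod t * norm z) \<longlongrightarrow> cmod 0 * norm z) (nhds 0)"
        by (intro tendsto_intros filterlim_ident)
      then show "((\<lambda>t::complex. cmod t * norm z) \<longlongrightarrow> 0) (nhds 0)" by simp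
    qed
    with C(2) have "\<forall>\<^sub>F t in nhds 0. cmod (f (t *s z)) \<le> C * norm (t *s z) ^ Suc N"
      by (auto simp: filterlim_iff)
    then have "\<forall>\<^sub>F t in nhds 0. cmod (u t) \<le> (C * norm z ^ Suc N) * cmod t ^ Suc N"
      by eventually_elim (simp add: u_def norm_vector_smult power_mult_distrib mult_ac)
    then show ?thesis by blast
  qed
  have u0: "u 0 = 0"
    using bound[of 0] eventually_nhds_x_imp_x by fastforce
  have "u constant_on ball 0 2"
  proof (rule ccontr)
    assume "\<not> u constant_on ball 0 2"
    note nonconst = this
    have hol': "u holomorphic_on ball 0 2" using hol by (simp add: u_def)
    obtain g r n where n: "0 < n" "0 < r" "ball 0 r \<subseteq> ball (0::complex) 2"
        "g holomorphic_on ball 0 r" "\<And>w. w \<in> ball 0 r \<Longrightarrow> u w = (w - 0)^n * g w"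
        "\<And>w. w \<in> ball 0 r \<Longrightarrow> g w \<noteq> 0"
      by (rule holomorphic_factor_zero_nonconstant[OF hol' _ _ _ u0 nonconst]) auto
    obtain C where C: "\<forall>\<^sub>F t in nhds 0. cmod (u t) \<le> C * cmod t ^ Suc n" using bound by blast
    have "\<forall>\<^sub>F t in nhds 0. t \<in> ball (0::complex) r" using n(2) by (intro eventually_nhds_in_open) auto
    with C have "\<forall>\<^sub>F t in nhds 0. t \<noteq> 0 \<longrightarrow> cmod (g t) \<le> C * cmod t"
    proof eventually_elim
      case (elim t)
      have "cmod t ^ n * cmod (g t) \<le> cmod t ^ n * (C * cmod t)"
        using elim n(5)[of t] by (simp add: norm_mult norm_power mult_ac)
      then show ?case by (auto simp: mult_le_cancel_left)
    qed
    then have "\<forall>\<^sub>F t in at 0. cmod (g t) \<le> C * cmod t" by (simp add: eventually_at_filter)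
    moreover have "((\<lambda>t::complex. C * cmod t) \<longlongrightarrow> C * cmod 0) (at 0)" by (intro tendsto_intros)
    then have "((\<lambda>t::complex. C * cmod t) \<longlongrightarrow> 0) (at 0)" by simp
    ultimately have "(g \<longlongrightarrow> 0) (at 0)" by (rule Lim_null_comparison)
    moreover have "continuous (at 0) g"
      using n(2,4) by (metis centre_in_ball continuous_on_interior holomorphic_on_imp_continuous_on interior_open open_ball)
    then have "(g \<longlongrightarrow> g 0) (at 0)" by (simp add: isCont_def)
    ultimately have "g 0 = 0" using LIM_unique by blast
    then show False using n(2) n(6)[of 0] by simp
  qed
  then have "u 1 = u 0" unfolding constant_on_def by (metis centre_in_ball dist_0_norm mem_ball norm_one one_less_numeral_iff semiring_norm(76) zero_less_numeral)
  then show ?thesis using u0 by (simp add: u_def)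
qed

lemma psum_mzero:
  assumes "conv r c" shows "psum c 0 = c mzero"
proof (rule psum_unique)
  have "((\<lambda>Q. monom 0 Q *s c Q) has_sum c mzero) {mzero}"
    by (rule has_sum_finiteI) auto
  moreover have "monom 0 Q *s c Q = 0" if "Q \<noteq> mzero" for Q :: "'a \<Rightarrow> nat"
  proof -
    obtain i where "Q i > 0" using \<open>Q \<noteq> mzero\<close> by (auto simp: mzero_def fun_eq_iff)
    then have "monom 0 Q = 0" unfolding monom_def by (intro prod_zero bexI[of _ i]) auto
    then show ?thesis by simp
  qed
  ultimately show "((\<lambda>Q. monom 0 Q *s c Q) has_sum c mzero) UNIV"
    by (subst has_sum_cong_neutral[where T = "{mzero}" and g = "\<lambda>Q. monom 0 Q *s c Q"]) auto
qed

lemma holo_curve_line: "holo_curve R (\<lambda>t. t *s z)"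
  unfolding holo_curve_def by (auto intro!: continuous_intros holomorphic_intros)

lemma conv_small:
  fixes G :: "'n::finite fmap"
  assumes "conv r G" "G mzero = 0" "\<epsilon> > 0"
  shows "\<exists>d>0. \<forall>y. norm y < d \<longrightarrow> norm y \<le> r \<and> norm (psum G y) \<le> \<epsilon>"
proof -
  obtain C where C: "C > 0" "\<forall>\<^sub>F z in nhds 0. norm (psum G z) \<le> C * norm z"
    using asy_norm_bound[OF conv_asy[OF assms(1), of 0] assms(2)] .
  then obtain e where e: "e > 0" "\<And>z. norm z < e \<Longrightarrow> norm (psum G z) \<le> C * norm z"
    by (auto simp: eventually_nhds_metric)
  have r: "r > 0" using assms(1) by (simp add: conv_def)
  show ?thesis
  proof (intro exI[of _ "min (min e r) (\<epsilon> / C)"] conjI allI impI)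
    fix y :: "complex^'n" assume y: "norm y < min (min e r) (\<epsilon> / C)"
    then show "norm y \<le> r" by simp
    have "norm (psum G y) \<le> C * norm y" using e(2) y by simp
    also have "\<dots> \<le> \<epsilon>" using y C(1) by (simp add: field_simps)
    finally show "norm (psum G y) \<le> \<epsilon>" .
  qed (use e(1) r C(1) assms(3) in auto)
qed

lemma holo_curve_psum_psum:
  fixes F G :: "'n::finite fmap"
  assumes F: "conv r F" and G: "conv r' G" "G mzero = 0"
  shows "\<exists>d>0. \<forall>z. norm z < d \<longrightarrow> holo_curve 2 (\<lambda>t. psum F (psum G (t *s z)))"
proof -
  have "r > 0" using F by (simp add: conv_def)
  from conv_small[OF G this] obtain d where d: "d > 0" "\<And>y. norm y < d \<Longrightarrow> norm y \<le> r' \<and> norm (psum G y) \<le> r" by blast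
  show ?thesis
  \<comment> \<open>A third of \<open>d\<close>, since the line parameter has modulus up to
    2.\<close>
  proof (intro exI[of _ "d / 3"] conjI allI impI)
    fix z :: "complex^'n" assume z: "norm z < d / 3"
    have "norm (t *s z) < d" if "t \<in> cball 0 2" for t
    proof -
      have "cmod t * norm z \<le> 2 * norm z" using that by (intro mult_right_mono) auto
      then show ?thesis using z d(1) unfolding norm_vector_smult by linarith
    qed
    note * = d(2)[OF this]
    have **: "cmod ((t *s z) $ i) \<le> r'" "cmod (psum G (t *s z) $ i) \<le> r" if "t \<in> cball 0 2" for t i
      using *[OF that] by (meson Finite_Cartesian_Product.norm_nth_le order_trans)+
    show "holo_curve 2 (\<lambda>t. psum F (psum G (t *s z)))"
      by (intro holo_curve_psum[OF F] holo_curve_psum[OF G(1)] holo_curve_line **)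
  qed (use d in simp)
qed

text \<open>The passage from formal to actual identities. Comparing two compositions covers
  conjugacies, and also inverses when one side is \<open>fid\<close> composed with itself.\<close>

theorem psum_compose_eq:
  fixes F G F' G' :: "'n::finite fmap"
  assumes F: "conv r1 F" and G: "conv r2 G" "G mzero = 0" and F': "conv r3 F'" and G': "conv r4 G'" "G' mzero = 0"
    and eq: "fcomp F G = fcomp F' G'"
  shows "\<forall>\<^sub>F z in nhds 0. psum F (psum G z) = psum F' (psum G' z)"
proof -
  obtain d where d: "d > 0" "\<And>z. norm z < d \<Longrightarrow> holo_curve 2 (\<lambda>t. psum F (psum G (t *s z)))"
    using holo_curve_psum_psum[OF F G] by blast
  obtain e where e: "e > 0" "\<And>z. norm z < e \<Longrightarrow> holo_curve 2 (\<lambda>t. psum F' (psum G' (t *s z)))"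
    using holo_curve_psum_psum[OF F' G'] by blast
  show ?thesis
  proof (rule eventually_nhds_0_norm)
    show "min d e > 0" using d e by simp
    fix z :: "complex^'n" assume z: "norm z < min d e"
    have "psum F (psum G z) $ i - psum F' (psum G' z) $ i = 0" for i
    proof (rule line_identity[of "\<lambda>z. psum F (psum G z) $ i - psum F' (psum G' z) $ i"])
      show "(\<lambda>t. psum F (psum G (t *s z)) $ i - psum F' (psum G' (t *s z)) $ i) holomorphic_on ball 0 2"
        using d(2)[of z] e(2)[of z] z by (intro holomorphic_intros) (auto simp: holo_curve_def)
      show "(\<lambda>z. psum F (psum G z) $ i - psum F' (psum G' z) $ i) \<in> bigO (Suc N)" for N
      proof -
        have "asy N (\<lambda>z. psum F (psum G z)) (fcomp F G)"
          by (intro asy_compose conv_asy[OF F] conv_asy[OF G(1)] G)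
        moreover have "asy N (\<lambda>z. psum F' (psum G' z)) (fcomp F G)"
          unfolding eq by (intro asy_compose conv_asy[OF F'] conv_asy[OF G'(1)] G')
        ultimately show ?thesis
          unfolding asy_def by (intro sasy_diff_bigO[where a = "\<lambda>Q. fcomp F G Q $ i"]) auto
      qed
    qed
    then show "psum F (psum G z) = psum F' (psum G' z)" by (simp add: vec_eq_iff)
  qed
qed

lemma asy_eventually_cong:
  fixes f g :: "complex^'n::finite \<Rightarrow> complex^'n"
  assumes "asy N f F" "\<forall>\<^sub>F z in nhds 0. f z = g z" shows "asy N g F"
  unfolding asy_def sasy_def
proof
  fix i
  have "(\<lambda>z. f z $ i - tpoly N (\<lambda>Q. F Q $ i) z) \<in> bigO (Suc N)"
    using assms(1) by (simp add: asy_def sasy_def)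
  then obtain C where "\<forall>\<^sub>F z in nhds 0. cmod (f z $ i - tpoly N (\<lambda>Q. F Q $ i) z) \<le> C * norm z ^ Suc N"
    by (rule bigOE)
  with assms(2) have "\<forall>\<^sub>F z in nhds 0. cmod (g z $ i - tpoly N (\<lambda>Q. F Q $ i) z) \<le> C * norm z ^ Suc N"
    by eventually_elim simp
  then show "(\<lambda>z. g z $ i - tpoly N (\<lambda>Q. F Q $ i) z) \<in> bigO (Suc N)" by (rule bigOI)
qed

lemma has_expansion_asy: "has_expansion f c \<Longrightarrow> asy N f c"
  by (elim has_expansion_conv) (metis (mono_tags, lifting) asy_eventually_cong conv_asy eventually_mono)

lemma has_expansion_mzero:
  assumes "has_expansion f c" shows "c mzero = f 0"
proof -
  obtain r where "conv r c" "\<forall>\<^sub>F z in nhds 0. f z = psum c z" using has_expansion_conv[OF assms] .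
  moreover from this(2) have "f 0 = psum c 0" by (rule eventually_nhds_x_imp_x)
  ultimately show ?thesis using psum_mzero[of r c] by simp
qed

lemma conv_mono:
  assumes "conv r c" "0 < r'" "r' \<le> r" shows "conv r' c"
  unfolding conv_def
proof
  show "(\<lambda>Q. norm (c Q) * r' ^ mdeg Q) summable_on UNIV"
    by (rule summable_on_comparison_test[of "\<lambda>Q. norm (c Q) * r ^ mdeg Q"])
       (use assms in \<open>auto simp: conv_def intro!: mult_left_mono power_mono\<close>)
qed (use assms in simp)

lemma flin_has_sum:
  fixes A :: "complex^'n::finite^'n"
  shows "((\<lambda>Q. monom z Q *s flin A Q) has_sum A *v z) UNIV"
proof -
  have "((\<lambda>Q. monom z Q *s flin A Q) has_sum A *v z) (range munit)"
  proof (rule has_sum_finiteI)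
    have "(\<Sum>Q\<in>range munit. monom z Q *s flin A Q) = (\<Sum>j\<in>UNIV. z $ j *s flin A (munit j))"
      by (subst sum.reindex) (auto simp: inj_on_def)
    then show "A *v z = (\<Sum>Q\<in>range munit. monom z Q *s flin A Q)"
      by (simp add: vec_eq_iff flin_munit matrix_vector_mult_def mult.commute)
  qed simp
  then show ?thesis
  proof (rule has_sum_cong_neutral[THEN iffD1, rotated -1])
    fix Q :: "'n \<Rightarrow> nat" assume "Q \<in> UNIV - range munit"
    then have "mdeg Q \<noteq> 1" using mdeg_eq_1E by blast
    then show "monom z Q *s flin A Q = 0" by (simp add: flin_eq_0)
  qed auto
qed

lemma conv_flin:
  fixes A :: "complex^'n::finite^'n" shows "conv 1 (flin A)"
  unfolding conv_def
proof
  have "(\<lambda>Q. norm (flin A Q) * 1 ^ mdeg Q) summable_on (range munit :: ('n \<Rightarrow> nat) set)" by simp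
  then show "(\<lambda>Q. norm (flin A Q) * 1 ^ mdeg Q) summable_on UNIV"
  proof (rule summable_on_cong_neutral[THEN iffD1, rotated -1])
    fix Q :: "'n \<Rightarrow> nat" assume "Q \<in> UNIV - range munit"
    then have "mdeg Q \<noteq> 1" using mdeg_eq_1E by blast
    then show "norm (flin A Q) * 1 ^ mdeg Q = 0" by (simp add: flin_eq_0)
  qed auto
qed simp

lemma psum_flin: "psum (flin A) z = A *v z"
  by (rule psum_unique[OF flin_has_sum])

section \<open>Convergence of inverses and linear parts of germs\<close>

lemma matrix_bound:
  fixes A :: "complex^'n::finite^'n"
  obtains b where "b > 0" "\<And>v. norm (A *v v) \<le> b * norm v"
proof -
  have "bounded_linear ((*v) A)" by (rule matrix_vector_mul_bounded_linear)
  from bounded_linear.pos_bounded[OF this] show ?thesis using that by (auto simp: mult.commute)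
qed

lemma compose_norms_cmult: "compose_norms (\<lambda>P. b * a P) v Q = b * compose_norms a v Q"
  by (simp add: compose_norms_def sum_distrib_left mult.assoc)

lemma compose_norms_mono:
  assumes "\<And>P. a P \<le> a' P" "\<And>R. v R \<ge> 0" shows "compose_norms a v Q \<le> compose_norms a' v Q"
  unfolding compose_norms_def by (intro sum_mono mult_right_mono assms sum_nonneg prod_nonneg)

lemma norm_le_sum_coeff:
  fixes c :: "'n::finite fmap"
  shows "norm (c (munit i)) \<le> 1 + (\<Sum>j\<in>UNIV. norm (c (munit j)))"
proof -
  have "norm (c (munit i)) \<le> (\<Sum>j\<in>UNIV. norm (c (munit j)))" by (rule member_le_sum) auto
  then show ?thesis by simp
qed

text \<open>The recursion of the formal inverse contains no divisors: the cost is zero, and the norm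
  of \<open>B\<close> is absorbed into the coefficients of \<open>F\<close>.\<close>

lemma convergent_right_inverse:
  fixes F :: "'n::finite fmap"
  assumes F: "conv r F" "F mzero = 0" and B: "lin_part F ** B = mat 1" "B ** lin_part F = mat 1"
  obtains r' \<Theta> where "conv r' \<Theta>" "\<Theta> mzero = 0" "fcomp F \<Theta> = fid"
proof -
  obtain \<Theta> where z: "\<Theta> mzero = 0" and inv: "fcomp F \<Theta> = fid" and eq: "\<And>Q. \<Theta> Q = B *v (fid Q - fcomp (fhigh F) \<Theta> Q)"
    by (rule formal_right_inverse[where G = F, OF F(2) B]) (rule that)
  obtain b where b: "b > 0" "\<And>v. norm (B *v v) \<le> b * norm v" by (rule matrix_bound[of B]) (rule that)
  define K where "K = 1 + (\<Sum>j\<in>UNIV. norm (\<Theta> (munit j)))"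
  have K: "K > 0" unfolding K_def by (intro add_pos_nonneg sum_nonneg) auto
  have r: "r > 0" using F(1) by (simp add: conv_def)
  have sm: "(\<lambda>P. b * norm (F P) * r ^ mdeg P) summable_on UNIV"
    using F(1) unfolding conv_def by (simp add: mult.assoc summable_on_cmult_right)
  have nn: "b * norm (F P) \<ge> 0" for P using b(1) by simp
  obtain \<rho> x where \<rho>: "\<rho> > 0" "x > 0" and maj: "cost_majorant (\<lambda>P. b * norm (F P)) K \<rho> x"
    using majorant_with_cost[OF nn r sm K] by (elim exE conjE)
  have "norm (\<Theta> Q) \<le> x / \<rho> ^ mdeg Q * exp 0" for Q
  proof (rule maj[unfolded cost_majorant_def, rule_format, of \<Theta> "\<lambda>_. 0" "mdeg Q" "\<lambda>_. 0" Q])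
    show "norm (\<Theta> (munit j)) \<le> K" for j unfolding K_def by (rule norm_le_sum_coeff)
    show "norm (\<Theta> R) \<le> exp 0 * compose_norms (\<lambda>P. b * norm (F P)) (\<lambda>R. norm (\<Theta> R)) R" if "2 \<le> mdeg R" for R
    proof -
      have "fid R = 0" using that by (simp add: fid_eq_flin flin_eq_0)
      then have "norm (\<Theta> R) = norm (B *v (0 - fcomp (fhigh F) \<Theta> R))" by (subst eq) simp
      also have "\<dots> \<le> b * norm (fcomp (fhigh F) \<Theta> R)" using b(2)[of "0 - fcomp (fhigh F) \<Theta> R"] by simp
      also have "\<dots> \<le> b * compose_norms (\<lambda>P. norm (F P)) (\<lambda>R. norm (\<Theta> R)) R"
        using b(1) by (intro mult_left_mono norm_fcomp_fhigh_le) auto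
      finally show ?thesis by (simp add: compose_norms_cmult)
    qed
  qed (simp_all add: z superadditive_cost_def)
  then have "norm (\<Theta> Q) \<le> x * (1 / \<rho>) ^ mdeg Q" for Q by (simp add: power_divide)
  from convI[of \<Theta>, OF this] \<rho> have "conv (1 / (2 * (1 / \<rho>))) \<Theta>" by simp
  then show ?thesis using that z inv by blast
qed

text \<open>By associativity a right inverse of the right inverse is \<open>F\<close> itself, so the
  formal inverse is two-sided; both identities then pass to the sums.\<close>

theorem convergent_inverse:
  fixes F :: "'n::finite fmap"
  assumes F: "conv r F" "F mzero = 0" and B: "lin_part F ** B = mat 1" "B ** lin_part F = mat 1"
  obtains r' \<Theta> where "conv r' \<Theta>" "\<Theta> mzero = 0" "germ_inverse (psum F) (psum \<Theta>)"
proof -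
  obtain r' \<Theta> where \<Theta>: "conv r' \<Theta>" "\<Theta> mzero = 0" "fcomp F \<Theta> = fid" by (rule convergent_right_inverse[where F = F, OF F B]) (rule that)
  have l: "lin_part F ** lin_part \<Theta> = mat 1"
    using lin_part_fcomp[where F = F and G = \<Theta>, OF F(2) \<Theta>(2)] by (simp add: \<Theta> fid_eq_flin)
  then have "B ** (lin_part F ** lin_part \<Theta>) = B" by simp
  then have lT: "lin_part \<Theta> = B" by (simp add: matrix_mul_assoc B)
  then have lT': "lin_part \<Theta> ** lin_part F = mat 1" using B by simp
  obtain X where X: "X mzero = 0" "fcomp \<Theta> X = fid"
    by (rule formal_right_inverse[where G = \<Theta> and B = "lin_part F", OF \<Theta>(2) lT' l]) (rule that)
  have "fcomp (fcomp F \<Theta>) X = fcomp F (fcomp \<Theta> X)" by (rule fcomp_assoc[symmetric]) (simp_all add: \<Theta> X)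
  then have "X = F" by (simp add: \<Theta> X fcomp_fid_left fcomp_fid_right)
  then have left: "fcomp \<Theta> F = fid" using X by simp
  have fid: "fcomp fid fid = fid" "conv 1 fid" "fid mzero = 0" "\<And>z. psum fid z = z"
    by (simp_all add: fcomp_fid_right flin_comp conv_flin psum_flin fid_eq_flin)
  have "\<forall>\<^sub>F z in nhds 0. psum \<Theta> (psum F z) = psum fid (psum fid z)"
    by (rule psum_compose_eq[OF \<Theta>(1) F(1) F(2) fid(2) fid(2) fid(3)]) (simp add: left fid)
  moreover have "\<forall>\<^sub>F z in nhds 0. psum F (psum \<Theta> z) = psum fid (psum fid z)"
    by (rule psum_compose_eq[OF F(1) \<Theta>(1) \<Theta>(2) fid(2) fid(2) fid(3)]) (simp add: \<Theta> fid)
  moreover have "psum \<Theta> 0 = 0" using psum_mzero[OF \<Theta>(1)] \<Theta>(2) by simp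
  ultimately have "germ_inverse (psum F) (psum \<Theta>)" by (simp add: germ_inverse_def fid)
  then show ?thesis using that \<Theta> by blast
qed

text \<open>Serves to exclude zero eigenvalues. Composing with the inverse germ and comparing
  expansions to order 1 gives the left inverse.\<close>

lemma biholo_lin_part_left_inverse:
  fixes f :: "complex^'n::finite \<Rightarrow> complex^'n"
  assumes f: "biholo_germ0 f" "has_expansion f c"
  obtains B where "B ** lin_part c = mat 1" "c mzero = 0"
proof -
  obtain \<psi> d where \<psi>: "has_expansion \<psi> d" "germ_inverse f \<psi>" and f0: "f 0 = 0"
    using f(1) unfolding biholo_germ0_def holo_germ_def by blast
  have c0: "c mzero = 0" using has_expansion_mzero[OF f(2)] f0 by simp
  have d0: "d mzero = 0" using has_expansion_mzero[OF \<psi>(1)] \<psi>(2) by (simp add: germ_inverse_def)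
  have "asy 1 (\<lambda>z. \<psi> (f z)) (fcomp d c)" by (intro asy_compose has_expansion_asy \<psi> f c0)
  moreover have "\<forall>\<^sub>F z in nhds 0. \<psi> (f z) = mat 1 *v z" using \<psi>(2) by (simp add: germ_inverse_def)
  ultimately have "asy 1 ((*v) (mat 1)) (fcomp d c)" by (rule asy_eventually_cong)
  then have "fcomp d c (munit j) = flin (mat 1) (munit j)" for j
    by (rule asy_unique[OF _ asy_matrix]) auto
  then have "lin_part (fcomp d c) = mat 1" by (simp add: lin_part_def flin_munit vec_eq_iff)
  then show ?thesis using that[of "lin_part d"] c0 lin_part_fcomp[where F = d and G = c, OF d0 c0] by simp
qed

section \<open>Convergence of the linearization\<close>

text \<open>Coefficientwise, the conjugacy equation reads
  (Lambda_k^Q - lambda_(k,j)) (P^-1 Phi_Q)_j = (P^-1 (higher order terms of c_k o Phi)_Q)_j;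
  for each Q and j it is used with the k that makes the divisor largest.\<close>

lemma conjugacy_majorant:
  fixes c :: "nat \<Rightarrow> 'n::finite fmap"
  assumes c0: "\<And>k. k \<in> {1..h} \<Longrightarrow> c k mzero = 0"
    and P: "P ** P' = mat 1" "P' ** P = mat 1"
    and D: "\<And>k. k \<in> {1..h} \<Longrightarrow> lin_part (c k) ** P = P ** diag (lam k)"
    and \<Phi>: "\<Phi> mzero = 0" "\<And>k. k \<in> {1..h} \<Longrightarrow> fcomp (c k) \<Phi> = fcomp \<Phi> (flin (diag (lam k)))"
  obtains K where "K > 0"
    "\<And>Q \<epsilon>. \<epsilon> > 0 \<Longrightarrow> (\<And>j. \<exists>k\<in>{1..h}. \<epsilon> \<le> cmod (lampow lam k Q - lam k j)) \<Longrightarrow>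
       norm (\<Phi> Q) \<le> (1 / \<epsilon>) * compose_norms (\<lambda>P. K * (\<Sum>k\<in>{1..h}. norm (c k P))) (\<lambda>R. norm (\<Phi> R)) Q"
proof -
  obtain p where p: "p > 0" "\<And>v. norm (P *v v) \<le> p * norm v" by (rule matrix_bound[of P]) (rule that)
  obtain q where q: "q > 0" "\<And>v. norm (P' *v v) \<le> q * norm v" by (rule matrix_bound[of P']) (rule that)
  \<comment> \<open>The price of passing to eigencoordinates and back, with the norm in between
    bounded by the sum of its components.\<close>
  define K where "K = p * real CARD('n) * q"
  have K: "K > 0" using p q by (simp add: K_def)
  show ?thesis
  proof (rule that[OF K])
    fix Q :: "'n \<Rightarrow> nat" and \<epsilon> :: real
    assume \<epsilon>: "\<epsilon> > 0" and dv: "\<And>j. \<exists>k\<in>{1..h}. \<epsilon> \<le> cmod (lampow lam k Q - lam k j)"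
    define N where "N = compose_norms (\<lambda>P. \<Sum>k\<in>{1..h}. norm (c k P)) (\<lambda>R. norm (\<Phi> R)) Q"
    define \<xi> where "\<xi> = P' *v \<Phi> Q"
    have comp: "cmod (\<xi> $ j) \<le> q * N / \<epsilon>" for j
    proof -
      obtain k where k: "k \<in> {1..h}" "\<epsilon> \<le> cmod (lampow lam k Q - lam k j)" using dv by blast
      define H where "H = fcomp (fhigh (c k)) \<Phi> Q"
      have "lampow lam k Q *s \<Phi> Q = lin_part (c k) *v \<Phi> Q + H"
        using fcomp_fhigh[where F = "c k" and G = \<Phi> and Q = Q, OF c0[OF k(1)] \<Phi>(1)]
        by (simp add: \<Phi>(2)[OF k(1)] fcomp_flin_diag lampow_def H_def)
      then have "P' *v (lampow lam k Q *s \<Phi> Q) = P' *v (lin_part (c k) *v \<Phi> Q) + P' *v H"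
        by (simp add: matrix_vector_right_distrib)
      moreover have "P' *v (lin_part (c k) *v \<Phi> Q) = diag (lam k) *v \<xi>"
      proof -
        have "P' ** lin_part (c k) = P' ** lin_part (c k) ** (P ** P')" by (simp add: P)
        also have "\<dots> = P' ** (lin_part (c k) ** P) ** P'" by (simp only: matrix_mul_assoc)
        also have "\<dots> = (P' ** P) ** diag (lam k) ** P'" by (simp only: D[OF k(1)] matrix_mul_assoc)
        finally show ?thesis by (simp add: P \<xi>_def matrix_vector_mul_assoc)
      qed
      moreover have "P' *v (lampow lam k Q *s \<Phi> Q) = lampow lam k Q *s \<xi>"
        by (simp add: \<xi>_def vector_scalar_commute)
      ultimately have "(lampow lam k Q *s \<xi>) $ j = (diag (lam k) *v \<xi> + P' *v H) $ j" by simp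
      then have "(lampow lam k Q - lam k j) * \<xi> $ j = (P' *v H) $ j"
        by (simp add: diag_mult_vec algebra_simps)
      then have "cmod (lampow lam k Q - lam k j) * cmod (\<xi> $ j) = cmod ((P' *v H) $ j)"
        by (metis norm_mult)
      also have "\<dots> \<le> norm (P' *v H)" by (rule Finite_Cartesian_Product.norm_nth_le)
      also have "\<dots> \<le> q * norm H" by (rule q(2))
      also have "\<dots> \<le> q * N"
      proof (rule mult_left_mono)
        have "norm H \<le> compose_norms (\<lambda>P. norm (c k P)) (\<lambda>R. norm (\<Phi> R)) Q"
          unfolding H_def by (rule norm_fcomp_fhigh_le)
        also have "\<dots> \<le> N" unfolding N_def
          by (rule compose_norms_mono) (use k(1) in \<open>auto intro!: member_le_sum\<close>)
        finally show "norm H \<le> N" .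
      qed (use q in simp)
      finally have "cmod (lampow lam k Q - lam k j) * cmod (\<xi> $ j) \<le> q * N" .
      moreover have "\<epsilon> * cmod (\<xi> $ j) \<le> cmod (lampow lam k Q - lam k j) * cmod (\<xi> $ j)"
        using k(2) by (intro mult_right_mono) auto
      ultimately have "\<epsilon> * cmod (\<xi> $ j) \<le> q * N" by linarith
      then show ?thesis using \<epsilon> by (simp add: field_simps)
    qed
    have "\<Phi> Q = P *v \<xi>" by (simp add: \<xi>_def matrix_vector_mul_assoc P)
    then have "norm (\<Phi> Q) \<le> p * norm \<xi>" using p(2) by simp
    also have "norm \<xi> \<le> (\<Sum>j\<in>UNIV. cmod (\<xi> $ j))" by (simp add: norm_vec_def L2_set_le_sum)
    also have "\<dots> \<le> (\<Sum>j\<in>(UNIV::'n set). q * N / \<epsilon>)" by (intro sum_mono comp)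
    also have "p * \<dots> = (1 / \<epsilon>) * (K * N)" by (simp add: K_def)
    finally show "norm (\<Phi> Q) \<le> (1 / \<epsilon>) * compose_norms (\<lambda>P. K * (\<Sum>k\<in>{1..h}. norm (c k P))) (\<lambda>R. norm (\<Phi> R)) Q"
      using p(1) by (simp add: N_def compose_norms_cmult)
  qed
qed

lemma conv_family:
  fixes c :: "nat \<Rightarrow> 'n::finite fmap"
  assumes "finite I" "\<And>k. k \<in> I \<Longrightarrow> \<exists>r. conv r (c k)"
  shows "\<exists>r>0. \<forall>k\<in>I. conv r (c k)"
  using assms
proof (induction I)
  case empty
  then show ?case by (intro exI[of _ 1]) simp
next
  case (insert k I)
  then obtain r where r: "r > 0" "\<forall>k\<in>I. conv r (c k)" by auto
  obtain r' where r': "conv r' (c k)" using insert.prems by blast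
  have "r' > 0" using r' by (simp add: conv_def)
  then have "min r r' > 0" "\<forall>k\<in>insert k I. conv (min r r') (c k)"
    using r r' by (auto intro: conv_mono)
  then show ?case by blast
qed

text \<open>The costs may change with \<open>V\<close>, but \<open>B\<close> and
  \<open>\<epsilon>\<^sub>0\<close> may not; linear growth of \<open>G\<close> then only shrinks the
  radius. The alternative \<open>\<Phi> Q = 0\<close> is meant for resonant indices, where all
  divisors vanish.\<close>

theorem conjugacy_converges:
  fixes c :: "nat \<Rightarrow> 'n::finite fmap"
  assumes conv: "\<And>k. k \<in> {1..h} \<Longrightarrow> \<exists>r. conv r (c k)" and c0: "\<And>k. k \<in> {1..h} \<Longrightarrow> c k mzero = 0"
    and P: "P ** P' = mat 1" "P' ** P = mat 1"
    and D: "\<And>k. k \<in> {1..h} \<Longrightarrow> lin_part (c k) ** P = P ** diag (lam k)"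
    and \<Phi>: "\<Phi> mzero = 0" "\<And>k. k \<in> {1..h} \<Longrightarrow> fcomp (c k) \<Phi> = fcomp \<Phi> (flin (diag (lam k)))"
    and \<epsilon>0: "\<epsilon>\<^sub>0 > 0"
    and cost: "\<And>V. \<exists>G \<gamma>. (\<forall>Q. G Q \<ge> 0) \<and> (\<forall>Q. G Q \<le> B * real (mdeg Q)) \<and>
      superadditive_cost V \<gamma> G \<and>
      (\<forall>Q. 2 \<le> mdeg Q \<longrightarrow> mdeg Q \<le> V \<longrightarrow> \<Phi> Q = 0 \<or>
         (\<forall>j. \<exists>k\<in>{1..h}. \<epsilon>\<^sub>0 * exp (- \<gamma> Q) \<le> cmod (lampow lam k Q - lam k j)))"
  shows "\<exists>r. conv r \<Phi>"
proof -
  obtain K where K: "K > 0" and est: "\<And>Q \<epsilon>. \<epsilon> > 0 \<Longrightarrow> (\<And>j. \<exists>k\<in>{1..h}. \<epsilon> \<le> cmod (lampow lam k Q - lam k j)) \<Longrightarrow>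
       norm (\<Phi> Q) \<le> (1 / \<epsilon>) * compose_norms (\<lambda>P. K * (\<Sum>k\<in>{1..h}. norm (c k P))) (\<lambda>R. norm (\<Phi> R)) Q"
    by (rule conjugacy_majorant[OF c0 P D \<Phi>]) (blast intro: that)+
  \<comment> \<open>The fixed factor \<open>1 / \<epsilon>\<^sub>0\<close> is charged to the
    coefficients, which leaves only index-dependent losses to the cost.\<close>
  define a where "a = (\<lambda>P. (1 / \<epsilon>\<^sub>0) * (K * (\<Sum>k\<in>{1..h}. norm (c k P))))"
  have a: "a P \<ge> 0" for P unfolding a_def using K \<epsilon>0 by (intro mult_nonneg_nonneg sum_nonneg) auto
  obtain r where r: "r > 0" "\<forall>k\<in>{1..h}. conv r (c k)" using conv_family[of "{1..h}" c] conv by auto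
  have "(\<lambda>P. \<Sum>k\<in>{1..h}. norm (c k P) * r ^ mdeg P) summable_on UNIV"
    by (rule summable_on_sum) (use r in \<open>auto simp: conv_def\<close>)
  then have "(\<lambda>P. (1 / \<epsilon>\<^sub>0 * K) * (\<Sum>k\<in>{1..h}. norm (c k P) * r ^ mdeg P)) summable_on UNIV"
    by (rule summable_on_cmult_right)
  then have sm: "(\<lambda>P. a P * r ^ mdeg P) summable_on UNIV" by (simp add: a_def sum_distrib_right mult.assoc)
  define M where "M = 1 + (\<Sum>j\<in>UNIV. norm (\<Phi> (munit j)))"
  have M: "M > 0" unfolding M_def by (intro add_pos_nonneg sum_nonneg) auto
  obtain \<rho> x where \<rho>: "\<rho> > 0" "x > 0" and maj: "cost_majorant a M \<rho> x"
    using majorant_with_cost[OF a r(1) sm M] by (elim exE conjE)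
  have "norm (\<Phi> Q) \<le> x * (exp B / \<rho>) ^ mdeg Q" for Q
  proof -
    obtain G \<gamma> where G: "\<forall>Q. G Q \<ge> 0" "\<forall>Q. G Q \<le> B * real (mdeg Q)"
      and sup: "superadditive_cost (mdeg Q) \<gamma> G"
      and dv: "\<forall>R. 2 \<le> mdeg R \<longrightarrow> mdeg R \<le> mdeg Q \<longrightarrow> \<Phi> R = 0 \<or>
         (\<forall>j. \<exists>k\<in>{1..h}. \<epsilon>\<^sub>0 * exp (- \<gamma> R) \<le> cmod (lampow lam k R - lam k j))"
      using cost[of "mdeg Q"] by (elim exE conjE)
    have "norm (\<Phi> Q) \<le> x / \<rho> ^ mdeg Q * exp (G Q)"
    proof (rule maj[unfolded cost_majorant_def, rule_format, of \<Phi> G "mdeg Q" \<gamma> Q])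
      show "norm (\<Phi> (munit j)) \<le> M" for j unfolding M_def by (rule norm_le_sum_coeff)
      show "norm (\<Phi> R) \<le> exp (\<gamma> R) * compose_norms a (\<lambda>R. norm (\<Phi> R)) R" if R: "2 \<le> mdeg R" "mdeg R \<le> mdeg Q" for R
      proof (cases "\<Phi> R = 0")
        case True
        then show ?thesis
          unfolding compose_norms_def by (simp only: norm_zero)
            (intro mult_nonneg_nonneg sum_nonneg prod_nonneg a norm_ge_zero exp_ge_zero)
      next
        case False
        then have "norm (\<Phi> R) \<le> (1 / (\<epsilon>\<^sub>0 * exp (- \<gamma> R))) * compose_norms (\<lambda>P. K * (\<Sum>k\<in>{1..h}. norm (c k P))) (\<lambda>R. norm (\<Phi> R)) R"
          using dv R \<epsilon>0 by (intro est) auto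
        then show ?thesis unfolding a_def compose_norms_cmult by (simp add: exp_minus field_simps)
      qed
    qed (use \<Phi>(1) G sup in auto)
    also have "\<dots> \<le> x / \<rho> ^ mdeg Q * exp (B * real (mdeg Q))"
      using \<rho> G by (intro mult_left_mono) auto
    also have "\<dots> = x * (exp B / \<rho>) ^ mdeg Q"
      by (simp add: power_divide exp_of_nat2_mult)
    finally show ?thesis .
  qed
  from convI[of \<Phi>, OF this] \<rho> show ?thesis by (meson divide_pos_pos exp_gt_zero)
qed

text \<open>The conjugacy is turned into an identity of sums before the inverse germ is applied; the
  latter is evaluated at \<open>D k *v z\<close>, which stays near 0 with \<open>z\<close>.\<close>

theorem linearize_germs:
  fixes f :: "nat \<Rightarrow> complex^'n::finite \<Rightarrow> complex^'n"
  assumes f: "\<And>k. k \<in> {1..h} \<Longrightarrow> has_expansion (f k) (c k)"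
    and P: "P ** P' = mat 1" "P' ** P = mat 1"
    and \<Phi>: "conv r \<Phi>" "\<Phi> mzero = 0" "lin_part \<Phi> = P" "\<And>k. k \<in> {1..h} \<Longrightarrow> fcomp (c k) \<Phi> = fcomp \<Phi> (flin (D k))"
  shows "\<exists>\<phi> \<psi>. biholo_germ0 \<phi> \<and> holo_germ \<psi> \<and> germ_inverse \<phi> \<psi> \<and>
           (\<forall>k\<in>{1..h}. \<exists>A::complex^'n^'n. \<forall>\<^sub>F z in nhds 0. \<psi> (f k (\<phi> z)) = A *v z)"
proof -
  obtain r' \<Theta> where \<Theta>: "conv r' \<Theta>" "\<Theta> mzero = 0" "germ_inverse (psum \<Phi>) (psum \<Theta>)"
    by (rule convergent_inverse[where F = \<Phi> and B = P', OF \<Phi>(1,2)]) (use \<Phi>(3) P in auto)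
  have h: "holo_germ (psum \<Phi>)" "holo_germ (psum \<Theta>)"
    using conv_has_expansion[OF \<Phi>(1)] conv_has_expansion[OF \<Theta>(1)] unfolding holo_germ_def by blast+
  have "psum \<Phi> 0 = 0" using psum_mzero[OF \<Phi>(1)] \<Phi>(2) by simp
  then have "biholo_germ0 (psum \<Phi>)" unfolding biholo_germ0_def using h \<Theta>(3) by blast
  moreover have "\<forall>\<^sub>F z in nhds 0. psum \<Theta> (f k (psum \<Phi> z)) = D k *v z" if k: "k \<in> {1..h}" for k
  proof -
    obtain s where s: "conv s (c k)" "\<forall>\<^sub>F z in nhds 0. f k z = psum (c k) z"
      using has_expansion_conv[OF f[OF k]] .
    have "\<forall>\<^sub>F z in nhds 0. psum (c k) (psum \<Phi> z) = psum \<Phi> (psum (flin (D k)) z)"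
      by (rule psum_compose_eq[OF s(1) \<Phi>(1,2) \<Phi>(1) conv_flin]) (simp_all add: \<Phi>(4)[OF k])
    moreover have "\<forall>\<^sub>F z in nhds 0. f k (psum \<Phi> z) = psum (c k) (psum \<Phi> z)"
    proof -
      obtain C where "\<forall>\<^sub>F z in nhds 0. norm (psum \<Phi> z) \<le> C * norm z"
        using asy_norm_bound[OF conv_asy[OF \<Phi>(1), of 0] \<Phi>(2)] by metis
      from filterlim_nhds_0_linear_bound[OF this] show ?thesis using s(2) by (auto simp: filterlim_iff)
    qed
    moreover have "\<forall>\<^sub>F z in nhds 0. psum \<Theta> (psum \<Phi> (D k *v z)) = D k *v z"
    proof -
      obtain b where "b > 0" "\<And>v. norm (D k *v v) \<le> b * norm v" by (rule matrix_bound[of "D k"]) (rule that)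
      then have "\<forall>\<^sub>F z in nhds 0. norm (D k *v z) \<le> b * norm z" by simp
      from filterlim_nhds_0_linear_bound[OF this] show ?thesis
        using \<Theta>(3) by (auto simp: filterlim_iff germ_inverse_def)
    qed
    ultimately show ?thesis by eventually_elim (simp add: psum_flin)
  qed
  ultimately show ?thesis using h \<Theta>(3) by blast
qed

section \<open>Estimates of the divisors\<close>

text \<open>The inner maximum of \<open>eps\<close>, kept apart for each \<open>j\<close>: the
  comparison of two small divisors works only for one and the same component.\<close>

definition divisor :: "nat \<Rightarrow> (nat \<Rightarrow> 'n::finite \<Rightarrow> complex) \<Rightarrow> ('n \<Rightarrow> nat) \<Rightarrow> 'n \<Rightarrow> real" where
  "divisor h lam Q j = Max ((\<lambda>k. cmod (lampow lam k Q - lam k j)) ` {1..h})"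

lemma divisor_attained:
  assumes "h \<ge> 1"
  obtains k where "k \<in> {1..h}" "divisor h lam Q j = cmod (lampow lam k Q - lam k j)"
proof -
  have "divisor h lam Q j \<in> (\<lambda>k. cmod (lampow lam k Q - lam k j)) ` {1..h}"
    unfolding divisor_def using assms by (intro Max_in) auto
  then show ?thesis using that by blast
qed

lemma divisor_ge: "k \<in> {1..h} \<Longrightarrow> cmod (lampow lam k Q - lam k j) \<le> divisor h lam Q j"
  unfolding divisor_def by (rule Max_ge) auto

lemma eps_le_divisor: "eps h lam Q \<le> divisor h lam Q j"
  unfolding eps_def divisor_def by (rule Min_le) auto

lemma finite_nonres: "finite (nonres h lam m)"
  by (rule finite_subset[OF _ finite_mdeg_le[of m]]) (auto simp: nonres_def)

lemma lampow_add: "lampow lam k (\<lambda>i. Q i + R i) = lampow lam k Q * lampow lam k R"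
  by (simp add: lampow_def power_add prod.distrib)

lemma lampow_munit: "lampow lam k (munit j) = lam k j"
proof -
  have "lampow lam k (munit j) = (\<Prod>i\<in>UNIV. if i = j then lam k i else 1)"
    unfolding lampow_def munit_def by (rule prod.cong) auto
  then show ?thesis by simp
qed

lemma mdeg_add: "mdeg (\<lambda>i. Q i + R i) = mdeg Q + mdeg R"
  by (simp add: mdeg_def sum.distrib)

text \<open>If Lambda_k^Q and Lambda_k^R are both close to lambda_(k,j), then Lambda_k^(R-Q) is
  close to 1 and \<open>Q'\<close>, which is R - Q + e_j, has a small divisor at the same
  \<open>j\<close>. Its degree exceeds that of the difference by one only, so a lower bound for
  divisors in low degrees keeps \<open>Q\<close> and \<open>R\<close> apart.\<close>

lemma divisor_difference:
  fixes Q R :: "'n::finite \<Rightarrow> nat"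
  assumes h: "h \<ge> 1" and \<kappa>: "\<And>k. k \<in> {1..h} \<Longrightarrow> 2 * \<eta> \<le> cmod (lam k j)"
    and QR: "Q \<le> R" "Q \<noteq> R" and small: "divisor h lam Q j < \<eta>" "divisor h lam R j < \<eta>"
  obtains Q' where "mdeg Q' + mdeg Q = Suc (mdeg R)" "mdeg Q' \<ge> 2" "divisor h lam Q' j < 4 * \<eta>"
proof -
  define D where "D = (\<lambda>i. R i - Q i)"
  have R: "R = (\<lambda>i. Q i + D i)" using QR(1) by (auto simp: D_def le_fun_def fun_eq_iff)
  define Q' where "Q' = (\<lambda>i. D i + munit j i)"
  have deg: "mdeg R = mdeg Q + mdeg D" by (subst R) (rule mdeg_add)
  have degQ': "mdeg Q' = Suc (mdeg D)" unfolding Q'_def mdeg_add by simp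
  have "mdeg D \<ge> 1" using mdeg_strict_mono[OF QR] deg by simp
  obtain k where k: "k \<in> {1..h}" "divisor h lam Q' j = cmod (lampow lam k Q' - lam k j)"
    using divisor_attained[OF h] .
  define \<mu> q d where "\<mu> = lam k j" "q = lampow lam k Q" "d = lampow lam k D"
  have 1: "cmod (q - \<mu>) < \<eta>" "cmod (q * d - \<mu>) < \<eta>"
    using divisor_ge[OF k(1), of lam Q j] divisor_ge[OF k(1), of lam R j] small lampow_add[of lam k Q D]
    by (auto simp: \<mu>_q_d_def R[symmetric])
  \<comment> \<open>From \<open>cmod (q - \<mu>) < \<eta>\<close> and
    \<open>2 * \<eta> \<le> cmod \<mu>\<close>. Replacing \<open>q\<close> by \<open>\<mu>\<close>
    thus at most doubles the error \<open>2 * \<eta>\<close>, whence the factor 4.\<close>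
  have 2: "cmod \<mu> \<le> 2 * cmod q"
    using 1(1) norm_triangle_ineq2[of \<mu> q] \<kappa>[OF k(1)] by (simp add: \<mu>_q_d_def norm_minus_commute)
  have "q * d - q = (q * d - \<mu>) - (q - \<mu>)" by simp
  then have "cmod (q * d - q) \<le> cmod (q * d - \<mu>) + cmod (q - \<mu>)" by (metis norm_triangle_ineq4)
  then have 3: "cmod q * cmod (d - 1) < 2 * \<eta>" using 1 by (simp add: norm_mult[symmetric] algebra_simps)
  have "cmod (d * \<mu> - \<mu>) = cmod \<mu> * cmod (d - 1)" by (simp add: norm_mult[symmetric] algebra_simps)
  also have "\<dots> \<le> 2 * cmod q * cmod (d - 1)" by (intro mult_right_mono 2) simp
  also have "\<dots> < 4 * \<eta>" using 3 by simp
  finally have "divisor h lam Q' j < 4 * \<eta>"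
    unfolding k(2) by (simp add: Q'_def lampow_add lampow_munit \<mu>_q_d_def)
  then show ?thesis using that[of Q'] degQ' deg \<open>mdeg D \<ge> 1\<close> by simp
qed

text \<open>The logarithm of a small divisor is telescoped into the jumps \<open>d \<nu>\<close>
  between consecutive thresholds, and each jump is charged to its own sparse set. The count pays for
  jump \<open>\<nu>\<close> at the rate \<open>1 / q \<nu>\<close>, and
  \<open>q \<nu> = p (Suc \<nu>)\<close> is the denominator of the Brjuno term with index
  \<open>Suc \<nu>\<close>.\<close>

lemma nonresonant_cost:
  fixes lam :: "nat \<Rightarrow> 'n::finite \<Rightarrow> complex"
  assumes h: "h \<ge> 1" and lam0: "\<And>k j. k \<in> {1..h} \<Longrightarrow> lam k j \<noteq> 0"
    and brj: "simultaneous_brjuno h lam"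
    and nr: "\<And>Q. 2 \<le> mdeg Q \<Longrightarrow> Q \<notin> (\<Inter>k\<in>{1..h}. \<Inter>j. Res lam k j)"
  obtains \<epsilon> B where "\<epsilon> > 0" "\<And>V. \<exists>G \<gamma>. (\<forall>Q. G Q \<ge> 0) \<and> (\<forall>Q. G Q \<le> B * real (mdeg Q)) \<and>
      superadditive_cost V \<gamma> G \<and>
      (\<forall>Q. 2 \<le> mdeg Q \<longrightarrow> mdeg Q \<le> V \<longrightarrow>
         (\<forall>j. \<exists>k\<in>{1..h}. \<epsilon> * exp (- \<gamma> Q) \<le> cmod (lampow lam k Q - lam k j)))"
proof -
  obtain p where p: "strict_mono p" "p 0 = 1"
    and pos: "\<And>\<nu>. nonres h lam (p (Suc \<nu>)) \<noteq> {} \<Longrightarrow> omega h lam (p (Suc \<nu>)) > 0"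
    and sm: "summable (\<lambda>\<nu>. max 0 (brjuno_term h lam p \<nu>))"
    using brj unfolding simultaneous_brjuno_def by blast
  define q where "q = (\<lambda>\<nu>. p (Suc \<nu>))"
  define w where "w = (\<lambda>\<nu>. omega h lam (q \<nu>))"
  \<comment> \<open>Consequently indices of degree at most \<open>V\<close> have divisors no smaller
    than the threshold of number \<open>V\<close>, and \<open>V\<close> scales suffice.\<close>
  have q_ge: "q \<nu> \<ge> Suc (Suc \<nu>)" for \<nu>
  proof (induction \<nu>)
    case 0 then show ?case using strict_monoD[OF p(1), of 0 1] p(2) by (simp add: q_def)
  next
    case (Suc \<nu>) then show ?case using strict_monoD[OF p(1), of "Suc \<nu>" "Suc (Suc \<nu>)"] by (simp add: q_def)
  qed
  have q1: "q \<nu> \<ge> 1" for \<nu> using q_ge[of \<nu>] by simp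
  have nres: "nonres h lam m = {Q. 2 \<le> mdeg Q \<and> mdeg Q \<le> m}" for m
    using nr by (auto simp: nonres_def)
  have ne: "nonres h lam (q \<nu>) \<noteq> {}" for \<nu>
  proof -
    obtain j :: 'n where True by simp
    have "mdeg (\<lambda>i. munit j i + munit j i) = 2" by (subst mdeg_add) simp
    then have "(\<lambda>i. munit j i + munit j i) \<in> nonres h lam (q \<nu>)" using q_ge[of \<nu>] by (simp add: nres)
    then show ?thesis by blast
  qed
  have w_pos: "w \<nu> > 0" for \<nu> using pos[of \<nu>] ne[of \<nu>] by (simp add: w_def q_def)
  have w_le: "w \<nu> \<le> divisor h lam Q j" if "2 \<le> mdeg Q" "mdeg Q \<le> q \<nu>" for \<nu> Q j
  proof -
    have "w \<nu> \<le> eps h lam Q"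
      unfolding w_def omega_def by (rule Min_le) (use that in \<open>auto simp: finite_nonres nres\<close>)
    then show ?thesis using eps_le_divisor[of h lam Q j] by linarith
  qed
  have w_mono: "w (Suc \<nu>) \<le> w \<nu>" for \<nu>
    unfolding w_def omega_def
  proof (rule Min_antimono)
    have "q \<nu> \<le> q (Suc \<nu>)" using p(1) by (simp add: q_def strict_mono_less_eq)
    then show "eps h lam ` nonres h lam (q \<nu>) \<subseteq> eps h lam ` nonres h lam (q (Suc \<nu>))"
      by (auto simp: nres)
  qed (use ne in \<open>auto simp: finite_nonres\<close>)
  define \<kappa> where "\<kappa> = Min (insert 1 ((\<lambda>(k,j). cmod (lam k j)) ` ({1..h} \<times> UNIV)))"
  have \<kappa>: "\<kappa> > 0" "\<kappa> \<le> 1" "\<And>k j. k \<in> {1..h} \<Longrightarrow> \<kappa> \<le> cmod (lam k j)"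
  proof -
    show "\<kappa> > 0" unfolding \<kappa>_def using lam0 by (subst Min_gr_iff) auto
    show "\<kappa> \<le> 1" unfolding \<kappa>_def by (rule Min_le) auto
    show "\<kappa> \<le> cmod (lam k j)" if "k \<in> {1..h}" for k j
      unfolding \<kappa>_def by (rule Min_le) (use that in \<open>auto intro!: image_eqI[of _ _ "(k, j)"]\<close>)
  qed
  \<comment> \<open>The 4 answers the factor lost in \<open>divisor_difference\<close>; the cap by
    \<open>\<kappa>\<close>, a lower bound for the moduli of all eigenvalues, provides the other
    hypothesis of that lemma.\<close>
  define \<eta> where "\<eta> = (\<lambda>\<nu>. min (w \<nu>) \<kappa> / 4)"
  have \<eta>: "\<eta> \<nu> > 0" "4 * \<eta> \<nu> \<le> w \<nu>" "4 * \<eta> \<nu> \<le> \<kappa>" "\<eta> (Suc \<nu>) \<le> \<eta> \<nu>" for \<nu>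
    using w_pos[of \<nu>] \<kappa>(1) w_mono[of \<nu>] by (auto simp: \<eta>_def)
  have \<eta>_anti: "\<eta> n \<le> \<eta> m" if "m \<le> n" for m n
    by (rule lift_Suc_antimono_le[of \<eta>, OF \<eta>(4) that])
  define d where "d = (\<lambda>\<nu>. ln (\<eta> \<nu>) - ln (\<eta> (Suc \<nu>)))"
  have d0: "d \<nu> \<ge> 0" for \<nu> using \<eta>[of \<nu>] \<eta>(1)[of "Suc \<nu>"] by (simp add: d_def)
  define b where "b = (\<lambda>\<nu>. max 0 (brjuno_term h lam p \<nu>))"
  have d_le: "d \<nu> / real (q \<nu>) \<le> b (Suc \<nu>)" for \<nu>
  proof -
    have "d \<nu> \<le> max 0 (ln (1 / w (Suc \<nu>)))"
    proof (cases "\<kappa> \<le> w (Suc \<nu>)")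
      case True
      then have "\<eta> (Suc \<nu>) = \<eta> \<nu>" using w_mono[of \<nu>] by (simp add: \<eta>_def min_def)
      then show ?thesis by (simp add: d_def)
    next
      case False
      then have e: "\<eta> (Suc \<nu>) = w (Suc \<nu>) / 4" by (simp add: \<eta>_def)
      \<comment> \<open>As \<open>\<kappa> \<le> 1\<close>, the old threshold is at most 1/4, which
        cancels the 4 in the new one.\<close>
      have "ln (\<eta> \<nu>) \<le> ln (1 / 4)" using \<eta>(1,3)[of \<nu>] \<kappa>(2) by (subst ln_le_cancel_iff) auto
      then have "d \<nu> \<le> ln (1 / w (Suc \<nu>))"
        using w_pos[of "Suc \<nu>"] by (simp add: d_def e ln_div)
      then show ?thesis by simp
    qed
    then have "d \<nu> / real (q \<nu>) \<le> max 0 (ln (1 / w (Suc \<nu>))) / real (q \<nu>)" by (intro divide_right_mono) auto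
    also have "\<dots> = b (Suc \<nu>)"
      using ne[of "Suc \<nu>"] by (simp add: b_def brjuno_term_def w_def q_def max_divide_distrib_right)
    finally show ?thesis .
  qed
  \<comment> \<open>The 2 comes from \<open>count_bound_le\<close>, the dimension from counting each
    component separately.\<close>
  define B where "B = 2 * real CARD('n) * suminf b"
  have sumd: "(\<Sum>\<nu><V. d \<nu> / real (q \<nu>)) \<le> suminf b" for V
  proof -
    have "(\<Sum>\<nu><V. d \<nu> / real (q \<nu>)) \<le> (\<Sum>\<nu><V. b (Suc \<nu>))" by (intro sum_mono d_le)
    also have "\<dots> \<le> (\<Sum>\<nu><Suc V. b \<nu>)" unfolding sum.lessThan_Suc_shift by (simp add: b_def)
    also have "\<dots> \<le> suminf b" by (rule sum_le_suminf) (use sm in \<open>auto simp: b_def\<close>)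
    finally show ?thesis .
  qed
  define S where "S = (\<lambda>\<nu> j. {Q. 2 \<le> mdeg Q \<and> divisor h lam Q j < \<eta> \<nu>})"
  have gap: "sparse_gap (q \<nu>) (S \<nu> j)" for \<nu> j
    unfolding sparse_gap_def
  proof (intro conjI ballI impI q1)
    fix Q assume "Q \<in> S \<nu> j"
    then show "q \<nu> \<le> mdeg Q" using w_le[of Q \<nu> j] \<eta>(1,2)[of \<nu>] by (force simp: S_def)
  next
    fix Q R assume QR: "Q \<in> S \<nu> j" "R \<in> S \<nu> j" "Q \<le> R" "Q \<noteq> R"
    have "2 * \<eta> \<nu> \<le> cmod (lam k j)" if "k \<in> {1..h}" for k
      using \<kappa>(3)[OF that, of j] \<eta>(1,3)[of \<nu>] by linarith
    then obtain Q' where Q': "mdeg Q' + mdeg Q = Suc (mdeg R)" "mdeg Q' \<ge> 2" "divisor h lam Q' j < 4 * \<eta> \<nu>"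
      by (rule divisor_difference[OF h _ QR(3,4), of "\<eta> \<nu>" lam j]) (use QR in \<open>auto simp: S_def\<close>)
    \<comment> \<open>The strict inequality \<open>mdeg Q' > q \<nu>\<close> makes up for the extra
      unit e_j in \<open>Q'\<close>, so the full gap \<open>q \<nu>\<close> results.\<close>
    have "\<not> mdeg Q' \<le> q \<nu>" using w_le[OF Q'(2), of \<nu> j] Q'(3) \<eta>(2)[of \<nu>] by linarith
    then show "mdeg Q + q \<nu> \<le> mdeg R" using Q'(1) by linarith
  qed
  show ?thesis
  proof (rule that[OF \<eta>(1)[of 0]])
    fix V
    define G where "G = total_cost V d q S"
    define \<gamma> where "\<gamma> = (\<lambda>Q. \<Sum>\<nu><V. d \<nu> * (\<Sum>j\<in>UNIV. if Q \<in> S \<nu> j then 1 else 0))"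
    have G0: "\<forall>Q. G Q \<ge> 0" unfolding G_def by (intro allI total_cost_nonneg d0 q1)
    have GB: "\<forall>Q. G Q \<le> B * real (mdeg Q)"
    proof
      fix Q
      have "G Q \<le> 2 * real CARD('n) * real (mdeg Q) * (\<Sum>\<nu><V. d \<nu> / real (q \<nu>))"
        unfolding G_def by (rule total_cost_le[OF d0 q1])
      also have "\<dots> \<le> 2 * real CARD('n) * real (mdeg Q) * suminf b" by (intro mult_left_mono sumd) auto
      finally show "G Q \<le> B * real (mdeg Q)" by (simp add: B_def mult_ac)
    qed
    have super: "\<gamma> Q + (\<Sum>t\<in>slots P. G (s t)) \<le> G Q"
      if "2 \<le> mdeg P" "s \<in> splits (slots P) Q" "\<forall>t\<in>slots P. s t \<noteq> mzero" for Q P :: "'n \<Rightarrow> nat" and s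
      unfolding G_def \<gamma>_def by (rule total_cost_superadditive[OF d0 gap that(2)]) (use that in auto)
    have div: "\<eta> 0 * exp (- \<gamma> Q) \<le> divisor h lam Q j" if Q: "2 \<le> mdeg Q" "mdeg Q \<le> V" for Q j
    proof -
      define M where "M = divisor h lam Q j"
      have "\<eta> V' \<le> M \<Longrightarrow> ln (\<eta> 0) - ln M \<le> (\<Sum>\<nu><V'. d \<nu> * (if Q \<in> S \<nu> j then 1 else 0))" for V'
      proof (induction V')
        case 0 then show ?case using \<eta>(1)[of 0] by simp
      next
        case (Suc V')
        show ?case
        proof (cases "\<eta> V' \<le> M")
          case True
          have "d V' * (if Q \<in> S V' j then 1 else 0) \<ge> 0" using d0 by simp
          then show ?thesis using Suc.IH[OF True] by simp
        next
          case False
          \<comment> \<open>Thresholds decrease: an index that fails the last one belongs to all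
            earlier sets, so no summand is missing and the sum telescopes.\<close>
          have "Q \<in> S \<nu> j" if "\<nu> < Suc V'" for \<nu>
            using False \<eta>_anti[of \<nu> V'] that Q by (auto simp: S_def M_def)
          then have "(\<Sum>\<nu><Suc V'. d \<nu> * (if Q \<in> S \<nu> j then 1 else 0)) = (\<Sum>\<nu><Suc V'. d \<nu>)"
            by (intro sum.cong) auto
          also have "\<dots> = ln (\<eta> 0) - ln (\<eta> (Suc V'))"
            unfolding d_def by (rule sum_lessThan_telescope')
          finally have e: "(\<Sum>\<nu><Suc V'. d \<nu> * (if Q \<in> S \<nu> j then 1 else 0)) = ln (\<eta> 0) - ln (\<eta> (Suc V'))" .
          have "ln (\<eta> (Suc V')) \<le> ln M" using Suc.prems \<eta>(1)[of "Suc V'"] by simp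
          then show ?thesis unfolding e by simp
        qed
      qed
      moreover have MV: "\<eta> V \<le> M"
      proof -
        have "mdeg Q \<le> q V" using Q(2) q_ge[of V] by linarith
        then show ?thesis using w_le[OF Q(1), of V j] \<eta>(1,2)[of V] by (simp add: M_def)
      qed
      ultimately have "ln (\<eta> 0) - ln M \<le> (\<Sum>\<nu><V. d \<nu> * (if Q \<in> S \<nu> j then 1 else 0))" by blast
      also have "\<dots> \<le> \<gamma> Q"
        unfolding \<gamma>_def by (intro sum_mono mult_left_mono d0 member_le_sum[of j UNIV "\<lambda>j. if Q \<in> S _ j then 1 else (0::real)"]) auto
      finally have "ln (\<eta> 0) - \<gamma> Q \<le> ln M" by linarith
      moreover have "M > 0" using MV \<eta>(1)[of V] by linarith
      ultimately have "exp (ln (\<eta> 0) - \<gamma> Q) \<le> M" by (metis exp_le_cancel_iff exp_ln)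
      then show ?thesis using \<eta>(1)[of 0] by (simp add: exp_diff exp_minus M_def field_simps)
    qed
    have "\<exists>k\<in>{1..h}. \<eta> 0 * exp (- \<gamma> Q) \<le> cmod (lampow lam k Q - lam k j)" if "2 \<le> mdeg Q" "mdeg Q \<le> V" for Q j
      using div[OF that, of j] divisor_attained[OF h, of lam Q j] by metis
    then show "\<exists>G \<gamma>. (\<forall>Q. G Q \<ge> 0) \<and> (\<forall>Q. G Q \<le> B * real (mdeg Q)) \<and>
      superadditive_cost V \<gamma> G \<and>
      (\<forall>Q. 2 \<le> mdeg Q \<longrightarrow> mdeg Q \<le> V \<longrightarrow>
         (\<forall>j. \<exists>k\<in>{1..h}. \<eta> 0 * exp (- \<gamma> Q) \<le> cmod (lampow lam k Q - lam k j)))"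
      using G0 GB super by (intro exI[of _ G] exI[of _ \<gamma>]) (simp add: superadditive_cost_def)
  qed
qed

text \<open>The conjugacy equation leaves resonant coefficients free, so their growth is not
  controlled by it. The resonant part \<open>\<Gamma>\<close> of \<open>\<Phi>\<close> and its
  inverse commute with the scalar maps; composing \<open>\<Phi>\<close> with this inverse gives
  another conjugacy, without resonant terms of degree 2 or more.\<close>

lemma resonant_normal_form:
  fixes c :: "nat \<Rightarrow> 'n::finite fmap" and \<mu> :: "nat \<Rightarrow> complex"
  assumes c0: "\<And>k. k \<in> {1..h} \<Longrightarrow> c k mzero = 0" and \<mu>0: "\<And>k. k \<in> {1..h} \<Longrightarrow> \<mu> k \<noteq> 0"
    and \<Phi>: "\<Phi> mzero = 0" "lin_part \<Phi> = mat 1" "\<And>k. k \<in> {1..h} \<Longrightarrow> fcomp (c k) \<Phi> = fcomp \<Phi> (flin (diag (\<lambda>_. \<mu> k)))"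
  obtains \<Phi>' where "\<Phi>' mzero = 0" "lin_part \<Phi>' = mat 1"
    "\<And>k. k \<in> {1..h} \<Longrightarrow> fcomp (c k) \<Phi>' = fcomp \<Phi>' (flin (diag (\<lambda>_. \<mu> k)))"
    "\<And>Q. 2 \<le> mdeg Q \<Longrightarrow> \<forall>k\<in>{1..h}. \<mu> k ^ mdeg Q = \<mu> k \<Longrightarrow> \<Phi>' Q = 0"
proof -
  \<comment> \<open>The equation \<open>\<mu> k ^ mdeg Q = \<mu> k\<close> divided by
    \<open>\<mu> k\<close>. Degree 0 is excluded by hand, since truncated subtraction would admit
    the zero index.\<close>
  define E where "E = {Q :: 'n \<Rightarrow> nat. 1 \<le> mdeg Q \<and> (\<forall>k\<in>{1..h}. \<mu> k ^ (mdeg Q - 1) = 1)}"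
  have E_iff: "Q \<in> E \<longleftrightarrow> 1 \<le> mdeg Q \<and> (\<forall>k\<in>{1..h}. \<mu> k ^ mdeg Q = \<mu> k)" for Q
  proof (cases "mdeg Q")
    case (Suc m) then show ?thesis using \<mu>0 by (auto simp: E_def)
  qed (simp add: E_def)
  \<comment> \<open>Membership in \<open>E\<close> is compatible with substitution. This yields both
    support statements below: the inverse of \<open>\<Gamma>\<close> stays inside \<open>E\<close>,
    and \<open>N\<close> composed with it stays outside.\<close>
  have E_sum: "Q \<in> E \<longleftrightarrow> P \<in> E"
    if P: "1 \<le> mdeg P" "1 \<le> mdeg Q" and s: "s \<in> splits (slots P) Q" "\<And>t. t \<in> slots P \<Longrightarrow> s t \<in> E" for P Q s
  proof -
    have "\<mu> k ^ mdeg Q = \<mu> k ^ mdeg P" if k: "k \<in> {1..h}" for k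
    proof -
      have "\<mu> k ^ mdeg Q = (\<Prod>t\<in>slots P. \<mu> k ^ mdeg (s t))"
        by (simp add: power_sum[symmetric] splits_mdeg[OF s(1)])
      also have "\<dots> = (\<Prod>t\<in>slots P. \<mu> k)" using s(2) k by (intro prod.cong) (auto simp: E_iff)
      finally show ?thesis by simp
    qed
    then show ?thesis using P by (simp add: E_iff)
  qed
  define \<Gamma> where "\<Gamma> = (\<lambda>Q. if Q \<in> E then \<Phi> Q else 0)"
  define N where "N = (\<lambda>Q. if Q \<in> E then 0 else \<Phi> Q)"
  have units: "munit j \<in> E" for j by (simp add: E_def)
  have zE: "mzero \<notin> E" by (simp add: E_def)
  have lin\<Gamma>: "lin_part \<Gamma> = mat 1" using \<Phi>(2) units by (simp add: lin_part_def \<Gamma>_def)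
  have \<Gamma>0: "\<Gamma> mzero = 0" by (simp add: \<Gamma>_def zE)
  obtain \<Theta> where z: "\<Theta> mzero = 0" and inv: "fcomp \<Gamma> \<Theta> = fid" and eq: "\<And>Q. \<Theta> Q = mat 1 *v (fid Q - fcomp (fhigh \<Gamma>) \<Theta> Q)"
    by (rule formal_right_inverse[where G = \<Gamma> and B = "mat 1", OF \<Gamma>0]) (auto simp: lin\<Gamma> intro: that)
  have prod0: "(\<Prod>t\<in>slots P. \<Theta> (s t) $ fst t) = 0" if "t \<in> slots P" "\<Theta> (s t) = 0" for P s t
    using that by (intro prod_zero bexI[of _ t]) auto
  have \<Theta>E: "\<Theta> Q = 0" if "Q \<notin> E" for Q
    using that
  proof (induction "mdeg Q" arbitrary: Q rule: less_induct)
    case less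
    show ?case
    proof (cases "Q = mzero")
      case False
      then have Q1: "1 \<le> mdeg Q" by (simp add: Suc_le_eq neq0_conv[symmetric] mdeg_eq_0_iff del: neq0_conv)
      have "Q \<noteq> munit j" for j using less.prems units by auto
      then have fid: "fid Q = 0" by (simp add: fid_def vec_eq_iff)
      have "fcomp (fhigh \<Gamma>) \<Theta> Q = 0"
        unfolding fcomp_fhigh_splits
      proof (rule sum.neutral, safe)
        fix P :: "'n \<Rightarrow> nat" assume P: "2 \<le> mdeg P" "mdeg P \<le> mdeg Q"
        show "(\<Sum>s\<in>splits (slots P) Q. \<Prod>t\<in>slots P. \<Theta> (s t) $ fst t) *s \<Gamma> P = 0"
        proof (cases "P \<in> E")
          case True
          have "(\<Sum>s\<in>splits (slots P) Q. \<Prod>t\<in>slots P. \<Theta> (s t) $ fst t) = 0"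
          proof (rule sum.neutral, safe)
            fix s assume s: "s \<in> splits (slots P) Q"
            have "\<exists>t\<in>slots P. \<Theta> (s t) = 0"
            proof (rule ccontr)
              assume nz: "\<not> (\<exists>t\<in>slots P. \<Theta> (s t) = 0)"
              then have nz': "s t \<noteq> mzero" if "t \<in> slots P" for t using z that by auto
              have "s t \<in> E" if "t \<in> slots P" for t
                using less.hyps[of "s t"] splits_mdeg_less[OF s _ _ nz' that] P nz that by auto
              then have "Q \<in> E" using E_sum[OF _ Q1 s] P True by simp
              then show False using less.prems by simp
            qed
            then show "(\<Prod>t\<in>slots P. \<Theta> (s t) $ fst t) = 0" using prod0 by blast
          qed
          then show ?thesis by simp
        qed (simp add: \<Gamma>_def)
      qed
      then show ?thesis by (subst eq) (simp add: fid)
    qed (simp add: z)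
  qed
  define \<Phi>' where "\<Phi>' = fcomp \<Phi> \<Theta>"
  have split: "\<Phi> = (\<lambda>Q. \<Gamma> Q + N Q)" by (auto simp: \<Gamma>_def N_def)
  \<comment> \<open>Only \<open>\<Gamma>\<close> contributes to a resonant coefficient of
    \<open>\<Phi>'\<close>, and \<open>\<Gamma>\<close> composed with its inverse is the
    identity.\<close>
  have res: "\<Phi>' Q = 0" if "2 \<le> mdeg Q" "Q \<in> E" for Q
  proof -
    have "fid Q = 0" using that by (simp add: fid_eq_flin flin_eq_0)
    moreover have "fcomp N \<Theta> Q = 0"
      unfolding fcomp_splits
    proof (rule sum.neutral, safe)
      fix P :: "'n \<Rightarrow> nat" assume P: "mdeg P \<le> mdeg Q"
      show "(\<Sum>s\<in>splits (slots P) Q. \<Prod>t\<in>slots P. \<Theta> (s t) $ fst t) *s N P = 0"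
      proof (cases "P \<in> E \<or> P = mzero")
        case False
        then have P1: "1 \<le> mdeg P" by (simp add: Suc_le_eq neq0_conv[symmetric] mdeg_eq_0_iff del: neq0_conv)
        have "(\<Sum>s\<in>splits (slots P) Q. \<Prod>t\<in>slots P. \<Theta> (s t) $ fst t) = 0"
        proof (rule sum.neutral, safe)
          fix s assume s: "s \<in> splits (slots P) Q"
          have "\<exists>t\<in>slots P. \<Theta> (s t) = 0"
          proof (rule ccontr)
            assume "\<not> (\<exists>t\<in>slots P. \<Theta> (s t) = 0)"
            then have "s t \<in> E" if "t \<in> slots P" for t using \<Theta>E that by blast
            then have "P \<in> E" using E_sum[OF P1 _ s] that by simp
            then show False using False by simp
          qed
          then show "(\<Prod>t\<in>slots P. \<Theta> (s t) $ fst t) = 0" using prod0 by blast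
        qed
        then show ?thesis by simp
      qed (auto simp: N_def \<Phi>(1))
    qed
    ultimately show ?thesis unfolding \<Phi>'_def by (subst split) (simp add: fcomp_add_left inv)
  qed
  have "lin_part \<Gamma> ** lin_part \<Theta> = mat 1"
    using lin_part_fcomp[where F = \<Gamma> and G = \<Theta>, OF \<Gamma>0 z] by (simp add: inv fid_eq_flin)
  then have lin: "lin_part \<Phi>' = mat 1"
    unfolding \<Phi>'_def by (subst lin_part_fcomp) (simp_all add: \<Phi> z lin\<Gamma>)
  have conj: "fcomp (c k) \<Phi>' = fcomp \<Phi>' (flin (diag (\<lambda>_. \<mu> k)))" if k: "k \<in> {1..h}" for k
  proof -
    have comm: "fcomp (flin (diag (\<lambda>_. \<mu> k))) \<Theta> = fcomp \<Theta> (flin (diag (\<lambda>_. \<mu> k)))"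
    proof
      fix Q :: "'n \<Rightarrow> nat"
      have "(\<Prod>i\<in>UNIV. \<mu> k ^ Q i) = \<mu> k ^ mdeg Q" by (simp add: power_sum mdeg_def)
      moreover have "diag (\<lambda>_. \<mu> k) *v \<Theta> Q = \<mu> k *s \<Theta> Q" by (simp add: diag_mult_vec vec_eq_iff)
      ultimately show "fcomp (flin (diag (\<lambda>_. \<mu> k))) \<Theta> Q = fcomp \<Theta> (flin (diag (\<lambda>_. \<mu> k))) Q"
        using \<Theta>E[of Q] k by (cases "Q \<in> E") (auto simp: fcomp_flin_left z fcomp_flin_diag E_iff)
    qed
    have "fcomp (c k) \<Phi>' = fcomp (fcomp \<Phi> (flin (diag (\<lambda>_. \<mu> k)))) \<Theta>"
      unfolding \<Phi>'_def \<Phi>(3)[OF k, symmetric] by (rule fcomp_assoc) (simp_all add: \<Phi> z)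
    also have "\<dots> = fcomp \<Phi> (fcomp \<Theta> (flin (diag (\<lambda>_. \<mu> k))))"
      by (subst fcomp_assoc[symmetric]) (simp_all add: z comm)
    also have "\<dots> = fcomp \<Phi>' (flin (diag (\<lambda>_. \<mu> k)))"
      unfolding \<Phi>'_def by (rule fcomp_assoc) (simp_all add: z)
    finally show ?thesis .
  qed
  show ?thesis
  proof (rule that[OF _ lin conj])
    show "\<Phi>' mzero = 0" by (simp add: \<Phi>'_def fcomp_mzero \<Phi>)
    show "\<Phi>' Q = 0" if "2 \<le> mdeg Q" "\<forall>k\<in>{1..h}. \<mu> k ^ mdeg Q = \<mu> k" for Q
      using that by (intro res) (auto simp: E_iff)
  qed
qed

text \<open>Powers of a root of unity are periodic, so finitely many divisors occur and the nonzero
  ones have a positive minimum; the inserted 1 covers the case that there are none.\<close>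

lemma roots_of_unity_divisor_bound:
  fixes \<mu> :: "nat \<Rightarrow> complex"
  assumes d: "d \<ge> 1" and root: "\<And>k. k \<in> {1..h} \<Longrightarrow> \<mu> k ^ d = 1"
  obtains \<epsilon> where "\<epsilon> > 0" "\<And>k m. k \<in> {1..h} \<Longrightarrow> \<mu> k ^ m \<noteq> \<mu> k \<Longrightarrow> \<epsilon> \<le> cmod (\<mu> k ^ m - \<mu> k)"
proof -
  define X where "X = {x \<in> (\<lambda>(k, e). cmod (\<mu> k ^ e - \<mu> k)) ` ({1..h} \<times> {..<d}). x \<noteq> 0}"
  have X: "finite X" by (simp add: X_def)
  define \<epsilon> where "\<epsilon> = Min (insert 1 X)"
  have "\<epsilon> > 0" unfolding \<epsilon>_def using X by (subst Min_gr_iff) (auto simp: X_def)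
  moreover have "\<epsilon> \<le> cmod (\<mu> k ^ m - \<mu> k)" if k: "k \<in> {1..h}" and ne: "\<mu> k ^ m \<noteq> \<mu> k" for k m
  proof -
    have "\<mu> k ^ m = \<mu> k ^ (d * (m div d) + m mod d)" by simp
    also have "\<dots> = \<mu> k ^ (m mod d)" unfolding power_add power_mult root[OF k] by simp
    finally have e: "\<mu> k ^ m = \<mu> k ^ (m mod d)" .
    have "cmod (\<mu> k ^ m - \<mu> k) \<in> X"
      unfolding X_def using k ne d by (auto simp: e intro!: image_eqI[of _ _ "(k, m mod d)"])
    then show ?thesis unfolding \<epsilon>_def using X by (intro Min_le) auto
  qed
  ultimately show ?thesis using that by blast
qed

section \<open>Conclusion from the nonresonant and the scalar case\<close>

lemma eigenvalue_nonzero: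
  fixes A :: "complex^'n::finite^'n" and d :: "'n \<Rightarrow> complex"
  assumes "B ** A = mat 1" "P' ** P = mat 1" "A ** P = P ** diag d"
  shows "d j \<noteq> 0"
proof
  assume "d j = 0"
  then have "diag d *v axis j 1 = (0 :: complex^'n)" by (auto simp: diag_mult_vec vec_eq_iff axis_def)
  moreover have "P' ** (B ** (A ** P)) = mat 1" using assms(1,2) by (simp add: matrix_mul_assoc)
  then have "(P' ** B ** P) ** diag d = mat 1" unfolding assms(3) by (simp add: matrix_mul_assoc)
  then have "(P' ** B ** P) *v (diag d *v axis j 1) = (axis j 1 :: complex^'n)" by (simp add: matrix_vector_mul_assoc)
  ultimately have "axis j 1 = (0 :: complex^'n)" by simp
  then have "(axis j 1 :: complex^'n) $ j = 0 $ j" by simp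
  then show False by (simp add: axis_def)
qed

theorem theorem3p2:
  fixes f :: "nat \<Rightarrow> complex^'n::finite \<Rightarrow> complex^'n"
    and c :: "nat \<Rightarrow> 'n fmap"
    and h :: nat
    and P :: "complex^'n^'n"
    and lam :: "nat \<Rightarrow> 'n \<Rightarrow> complex"
  assumes "h \<ge> 2"
    and "\<forall>k\<in>{1..h}. biholo_germ0 (f k)"
    and "\<forall>k\<in>{1..h}. has_expansion (f k) (c k)"
    and "formally_linearizable h c"
    and "invertible P"
    and "\<forall>k\<in>{1..h}. lin_part (c k) ** P = P ** diag (lam k)"
    and "simultaneous_brjuno h lam"
  shows "\<exists>\<phi> \<psi>. biholo_germ0 \<phi> \<and> holo_germ \<psi> \<and> germ_inverse \<phi> \<psi> \<and>
           (\<forall>k\<in>{1..h}. \<exists>A::complex^'n^'n. \<forall>\<^sub>F z in nhds 0. \<psi> (f k (\<phi> z)) = A *v z)"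
proof -
  have f: "has_expansion (f k) (c k)" if "k \<in> {1..h}" for k using assms(3) that by blast
  have D: "lin_part (c k) ** P = P ** diag (lam k)" if "k \<in> {1..h}" for k using assms(6) that by blast
  obtain P' where P: "P ** P' = mat 1" "P' ** P = mat 1" using assms(5) unfolding invertible_def by blast
  have h: "h \<ge> 1" using assms(1) by simp
  have conv: "\<exists>r. conv r (c k)" if "k \<in> {1..h}" for k
    using has_expansion_conv[OF f[OF that]] by blast
  have inv: "c k mzero = 0 \<and> (\<exists>B. B ** lin_part (c k) = mat 1)" if "k \<in> {1..h}" for k
    using biholo_lin_part_left_inverse[OF assms(2)[rule_format, OF that] f[OF that]] by blast
  have c0: "c k mzero = 0" if "k \<in> {1..h}" for k using inv[OF that] by blast
  have lam0: "lam k j \<noteq> 0" if k: "k \<in> {1..h}" for k j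
  proof -
    obtain B where "B ** lin_part (c k) = mat 1" using inv[OF k] by blast
    from eigenvalue_nonzero[OF this P(2) D[OF k]] show ?thesis .
  qed
  show ?thesis
  \<comment> \<open>\<open>nonres\<close> drops an index only when it is resonant for every
    \<open>k\<close> and every \<open>j\<close>; a single such index makes \<open>lam k j\<close>
    independent of \<open>j\<close>.\<close>
  proof (cases "\<exists>Q. 2 \<le> mdeg Q \<and> Q \<in> (\<Inter>k\<in>{1..h}. \<Inter>j. Res lam k j)")
    case False
    then have nr: "\<And>Q. 2 \<le> mdeg Q \<Longrightarrow> Q \<notin> (\<Inter>k\<in>{1..h}. \<Inter>j. Res lam k j)" by blast
    obtain \<epsilon> B where \<epsilon>: "\<epsilon> > 0" and cost: "\<And>V. \<exists>G \<gamma>. (\<forall>Q. G Q \<ge> 0) \<and> (\<forall>Q. G Q \<le> B * real (mdeg Q)) \<and>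
      superadditive_cost V \<gamma> G \<and>
      (\<forall>Q. 2 \<le> mdeg Q \<longrightarrow> mdeg Q \<le> V \<longrightarrow>
         (\<forall>j. \<exists>k\<in>{1..h}. \<epsilon> * exp (- \<gamma> Q) \<le> cmod (lampow lam k Q - lam k j)))"
      by (rule nonresonant_cost[OF h lam0 assms(7) nr]) (assumption | rule that)+
    obtain \<Phi> where \<Phi>: "\<Phi> mzero = 0" "lin_part \<Phi> = P"
      "\<And>k. k \<in> {1..h} \<Longrightarrow> fcomp (c k) \<Phi> = fcomp \<Phi> (flin (diag (lam k)))"
      by (rule formal_linearization_obtain[OF assms(4) c0 D]) (assumption | rule that)+
    have "\<exists>r. conv r \<Phi>"
    proof (rule conjugacy_converges[OF conv c0 P D \<Phi>(1,3) \<epsilon>])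
      fix V
      from cost[of V] show "\<exists>G \<gamma>. (\<forall>Q. G Q \<ge> 0) \<and> (\<forall>Q. G Q \<le> B * real (mdeg Q)) \<and>
        superadditive_cost V \<gamma> G \<and>
        (\<forall>Q. 2 \<le> mdeg Q \<longrightarrow> mdeg Q \<le> V \<longrightarrow> \<Phi> Q = 0 \<or>
           (\<forall>j. \<exists>k\<in>{1..h}. \<epsilon> * exp (- \<gamma> Q) \<le> cmod (lampow lam k Q - lam k j)))"
        by (elim exE conjE) (intro exI conjI, assumption+, blast)
    qed
    then obtain r where "conv r \<Phi>" by blast
    from linearize_germs[OF f P this \<Phi>] show ?thesis .
  next
    case True
    then obtain R where R: "2 \<le> mdeg R" "\<And>k j. k \<in> {1..h} \<Longrightarrow> lampow lam k R = lam k j"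
      by (auto simp: Res_def)
    define \<mu> where "\<mu> = (\<lambda>k. lampow lam k R)"
    have lam: "lam k = (\<lambda>_. \<mu> k)" if "k \<in> {1..h}" for k using R(2)[OF that] by (auto simp: \<mu>_def)
    have lampow: "lampow lam k Q = \<mu> k ^ mdeg Q" if "k \<in> {1..h}" for k Q
      by (simp add: lampow_def lam[OF that] mdeg_def power_sum)
    have \<mu>0: "\<mu> k \<noteq> 0" if "k \<in> {1..h}" for k using lam0[OF that] lam[OF that] by simp
    \<comment> \<open>Cancelling the nonzero \<open>\<mu> k\<close> in
      \<open>\<mu> k ^ mdeg R = \<mu> k\<close> leaves this exponent.\<close>
    define d where "d = mdeg R - 1"
    have root: "\<mu> k ^ d = 1" if k: "k \<in> {1..h}" for k
    proof -
      have "\<mu> k ^ Suc d = \<mu> k" using lampow[OF k, of R] R(1) by (simp add: \<mu>_def d_def)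
      then show ?thesis using \<mu>0[OF k] by simp
    qed
    have "d \<ge> 1" using R(1) by (simp add: d_def)
    then obtain \<epsilon> where \<epsilon>: "\<epsilon> > 0" "\<And>k m. k \<in> {1..h} \<Longrightarrow> \<mu> k ^ m \<noteq> \<mu> k \<Longrightarrow> \<epsilon> \<le> cmod (\<mu> k ^ m - \<mu> k)"
      by (rule roots_of_unity_divisor_bound[of d h \<mu>]) (use root in blast)+
    have scal: "diag (\<lambda>_. x) ** M = M ** diag (\<lambda>_. x)" for x and M :: "complex^'n^'n"
      by (simp add: diag_def matrix_matrix_mult_def vec_eq_iff if_distrib[of "\<lambda>x. x * _"] if_distrib[of "\<lambda>x. _ * x"] cong: if_cong)
    \<comment> \<open>A matrix similar to a scalar one is that scalar matrix, so the original
      coordinates are already eigencoordinates and the conjugacy can be tangent to the identity, as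
      \<open>resonant_normal_form\<close> requires.\<close>
    have D1: "lin_part (c k) ** mat 1 = mat 1 ** diag (lam k)" if k: "k \<in> {1..h}" for k
    proof -
      have "lin_part (c k) = lin_part (c k) ** P ** P'" by (simp add: matrix_mul_assoc[symmetric] P)
      also have "\<dots> = diag (\<lambda>_. \<mu> k) ** P ** P'" by (simp add: D[OF k] lam[OF k] scal)
      also have "\<dots> = diag (lam k)" by (simp add: matrix_mul_assoc[symmetric] P lam[OF k])
      finally show ?thesis by simp
    qed
    obtain \<Phi>0 where \<Phi>0: "\<Phi>0 mzero = 0" "lin_part \<Phi>0 = mat 1"
      "\<And>k. k \<in> {1..h} \<Longrightarrow> fcomp (c k) \<Phi>0 = fcomp \<Phi>0 (flin (diag (lam k)))"
      by (rule formal_linearization_obtain[OF assms(4) c0 D1]) (assumption | rule that)+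
    have \<Phi>0': "fcomp (c k) \<Phi>0 = fcomp \<Phi>0 (flin (diag (\<lambda>_. \<mu> k)))" if "k \<in> {1..h}" for k
      using \<Phi>0(3)[OF that] by (simp add: lam[OF that])
    obtain \<Phi> where \<Phi>: "\<Phi> mzero = 0" "lin_part \<Phi> = mat 1"
      "\<And>k. k \<in> {1..h} \<Longrightarrow> fcomp (c k) \<Phi> = fcomp \<Phi> (flin (diag (\<lambda>_. \<mu> k)))"
      "\<And>Q. 2 \<le> mdeg Q \<Longrightarrow> \<forall>k\<in>{1..h}. \<mu> k ^ mdeg Q = \<mu> k \<Longrightarrow> \<Phi> Q = 0"
      by (rule resonant_normal_form[OF c0 \<mu>0 \<Phi>0(1,2) \<Phi>0']) (assumption | rule that)+
    have conj: "fcomp (c k) \<Phi> = fcomp \<Phi> (flin (diag (lam k)))" if "k \<in> {1..h}" for k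
      using \<Phi>(3)[OF that] by (simp add: lam[OF that])
    have one: "mat 1 ** mat 1 = (mat 1 :: complex^'n^'n)" by simp
    have "\<exists>r. conv r \<Phi>"
    proof (rule conjugacy_converges[OF conv c0 one one D1 \<Phi>(1) conj \<epsilon>(1)])
      fix V
      have "\<Phi> Q = 0 \<or> (\<forall>j. \<exists>k\<in>{1..h}. \<epsilon> * exp (- 0) \<le> cmod (lampow lam k Q - lam k j))" if "2 \<le> mdeg Q" for Q
      proof (cases "\<forall>k\<in>{1..h}. \<mu> k ^ mdeg Q = \<mu> k")
        case True then show ?thesis using \<Phi>(4)[OF that] by blast
      next
        case False
        then obtain k where k: "k \<in> {1..h}" "\<mu> k ^ mdeg Q \<noteq> \<mu> k" by blast
        then have "\<epsilon> * exp (- 0) \<le> cmod (lampow lam k Q - lam k j)" for j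
          using \<epsilon>(2)[OF k] by (simp add: lampow[OF k(1)] lam[OF k(1)])
        then show ?thesis using k(1) by blast
      qed
      then show "\<exists>G \<gamma>. (\<forall>Q. G Q \<ge> 0) \<and> (\<forall>Q. G Q \<le> 0 * real (mdeg Q)) \<and>
        superadditive_cost V \<gamma> G \<and>
        (\<forall>Q. 2 \<le> mdeg Q \<longrightarrow> mdeg Q \<le> V \<longrightarrow> \<Phi> Q = 0 \<or>
           (\<forall>j. \<exists>k\<in>{1..h}. \<epsilon> * exp (- \<gamma> Q) \<le> cmod (lampow lam k Q - lam k j)))"
        by (intro exI[of _ "\<lambda>_. 0"]) (simp add: superadditive_cost_def)
    qed
    then obtain r where "conv r \<Phi>" by blast
    from linearize_germs[OF f one one this \<Phi>(1,2) conj] show ?thesis .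
  qed
qed

end
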